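(* Let $G$ be a non-elementary word-hyperbolic group with finite symmetric generating set $S$, and let $\phi:G\to\mathbb{Z}$ be a bicombable function on $G$. Then there is a constant $E$ such that for any $\epsilon>0$ there are a constant $K$ and an integer $N$ so that for every $n\ge N$, if $G_n$ denotes the set of elements of $G$ of word length $n$ with respect to $S$, there is a subset $G_n'\subset G_n$ with $|G_n'|/|G_n|\ge1-\epsilon$ such that for all $g\in G_n'$ $$|\phi(g)-nE|\le K\cdot\sqrt{n}.$$
   Context: $S$ generates $G$ as a semigroup. A word-hyperbolic group is elementary if it contains a finite index cyclic subgroup. $S^*$ is the set of finite words in $S$; for $w\in S^*$, $|w|$ is its length and $\overline{w}\in G$ its evaluation. A finite digraph $\Gamma$ with initial vertex $v_1$, whose edges are labeled by letters of $S$ with at most one outgoing edge with any given label at each vertex, parameterizes a prefix-closed language $L\subset S^*$ if $L$ is exactly the set of words read along directed paths starting at $v_1$; a prefix-closed language is regular iff it is parameterized by some such $\Gamma$. A combing of $G$ with respect to $S$ is a prefix-closed regular language $L\subset S^*$ such that evaluation $L\to G$ is a bijection and every $w\in L$ is geodesic. $\phi:G\to\mathbb{Z}$ is weakly combable with respect to $S$ and a combing $L$ if there are a digraph $\Gamma$ parameterizing $L$ and a function $d\phi$ from its vertices to $\mathbb{Z}$ with $\phi(\overline{w})=\sum_{i=0}^{|w|}d\phi(\gamma(i))$ for all $w\in L$, where $\gamma$ is the path in $\Gamma$ starting at $v_1$ corresponding to $w$ and $\gamma(i)$ is the vertex reached after $i$ edges ($\gamma(0)=v_1$). It is bicombable if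 moreover there is $C$ with $|\phi(as)-\phi(a)|\le C$ and $|\phi(sa)-\phi(a)|\le C$ for all $a\in G$, $s\in S$. For word-hyperbolic $G$, bicombability does not depend on the choice of finite symmetric generating set or combing. *)

theory Defs
  imports
    Complex_Main
    "HOL-Library.Sublist"
    "HOL-Algebra.Elementary_Groups"
    "Graph_Theory.Arc_Walk"
begin

definition word_eval :: "('a, 'b) monoid_scheme \<Rightarrow> 'a list \<Rightarrow> 'a" where
  "word_eval G w = foldr (\<otimes>\<^bsub>G\<^esub>) w \<one>\<^bsub>G\<^esub>"

definition finite_symmetric_generating_set :: "('a, 'b) monoid_scheme \<Rightarrow> 'a set \<Rightarrow> bool" where
  "finite_symmetric_generating_set G S \<longleftrightarrow>
     finite S \<and> S \<subseteq> carrier G \<and> (\<forall>s\<in>S. inv\<^bsub>G\<^esub> s \<in> S) \<and> word_eval G ` lists S = carrier G"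

text \<open>The \<open>LEAST\<close> is meaningful only for elements that are values of words in \<open>S\<close>; below, \<open>S\<close> always
  generates \<open>G\<close>.\<close>

definition word_length :: "('a, 'b) monoid_scheme \<Rightarrow> 'a set \<Rightarrow> 'a \<Rightarrow> nat" where
  "word_length G S g = (LEAST n. \<exists>w\<in>lists S. word_eval G w = g \<and> length w = n)"

definition word_sphere :: "('a, 'b) monoid_scheme \<Rightarrow> 'a set \<Rightarrow> nat \<Rightarrow> 'a set" where
  "word_sphere G S n = {g \<in> carrier G. word_length G S g = n}"

definition word_dist :: "('a, 'b) monoid_scheme \<Rightarrow> 'a set \<Rightarrow> 'a \<Rightarrow> 'a \<Rightarrow> nat" where
  "word_dist G S x y = word_length G S (inv\<^bsub>G\<^esub> x \<otimes>\<^bsub>G\<^esub> y)"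

text \<open>A geodesic edge path in the Cayley graph, given by its vertices \<open>p 0, \<dots>, p n\<close>.\<close>

definition cayley_geodesic ::
    "('a, 'b) monoid_scheme \<Rightarrow> 'a set \<Rightarrow> 'a \<Rightarrow> 'a \<Rightarrow> nat \<Rightarrow> (nat \<Rightarrow> 'a) \<Rightarrow> bool" where
  "cayley_geodesic G S x y n p \<longleftrightarrow>
     p 0 = x \<and> p n = y \<and> (\<forall>i\<le>n. p i \<in> carrier G) \<and>
     (\<forall>i\<le>n. \<forall>j\<le>n. int (word_dist G S (p i) (p j)) = \<bar>int i - int j\<bar>)"

text \<open>Thin (Rips) triangles in the Cayley graph. Only one side is mentioned: relabelling the corners
  and reversing sides gives the condition for the other two. Triangles have their corners at
  vertices; allowing corners and points inside edges changes \<open>\<delta>\<close> by a bounded amount only.\<close>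

definition cayley_hyperbolic :: "('a, 'b) monoid_scheme \<Rightarrow> 'a set \<Rightarrow> nat \<Rightarrow> bool" where
  "cayley_hyperbolic G S \<delta> \<longleftrightarrow>
     (\<forall>x y z l m n p q r.
        cayley_geodesic G S x y l p \<longrightarrow> cayley_geodesic G S x z m q \<longrightarrow> cayley_geodesic G S y z n r \<longrightarrow>
        (\<forall>i\<le>l. (\<exists>j\<le>m. word_dist G S (p i) (q j) \<le> \<delta>) \<or> (\<exists>k\<le>n. word_dist G S (p i) (r k) \<le> \<delta>)))"

definition word_hyperbolic :: "('a, 'b) monoid_scheme \<Rightarrow> bool" where
  "word_hyperbolic G \<longleftrightarrow>
     (\<exists>S \<delta>. finite_symmetric_generating_set G S \<and> cayley_hyperbolic G S \<delta>)"

definition elementary :: "('a, 'b) monoid_scheme \<Rightarrow> bool" where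
  "elementary G \<longleftrightarrow>
     (\<exists>H. subgroup H G \<and> finite (rcosets\<^bsub>G\<^esub> H) \<and> cyclic_group (G\<lparr>carrier := H\<rparr>))"

text \<open>\<open>parameterizes S \<Gamma> lab v1 L\<close>: the digraph \<open>\<Gamma>\<close>, with arcs labelled by \<open>lab\<close> and initial vertex
  \<open>v1\<close>, parameterizes the language \<open>L\<close>.\<close>

definition parameterizes ::
    "'a set \<Rightarrow> ('v, 'e) pre_digraph \<Rightarrow> ('e \<Rightarrow> 'a) \<Rightarrow> 'v \<Rightarrow> 'a list set \<Rightarrow> bool" where
  "parameterizes S \<Gamma> lab v1 L \<longleftrightarrow>
     fin_digraph \<Gamma> \<and> v1 \<in> verts \<Gamma> \<and> lab ` arcs \<Gamma> \<subseteq> S \<and>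
     (\<forall>e\<in>arcs \<Gamma>. \<forall>f\<in>arcs \<Gamma>. tail \<Gamma> e = tail \<Gamma> f \<and> lab e = lab f \<longrightarrow> e = f) \<and>
     L = {map lab p |p v. pre_digraph.awalk \<Gamma> v1 p v}"

definition prefix_closed :: "'a list set \<Rightarrow> bool" where
  "prefix_closed L \<longleftrightarrow> (\<forall>w\<in>L. \<forall>u. prefix u w \<longrightarrow> u \<in> L)"

text \<open>Regularity is expressed by the existence of a parameterizing digraph. Here and in
  \<open>weakly_combable\<close> vertices and arcs are natural numbers, which is no restriction for finite
  digraphs.\<close>

definition combing :: "('a, 'b) monoid_scheme \<Rightarrow> 'a set \<Rightarrow> 'a list set \<Rightarrow> bool" where
  "combing G S L \<longleftrightarrow>
     L \<subseteq> lists S \<and> prefix_closed L \<and>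
     (\<exists>(\<Gamma> :: (nat, nat) pre_digraph) lab v1. parameterizes S \<Gamma> lab v1 L) \<and>
     bij_betw (word_eval G) L (carrier G) \<and>
     (\<forall>w\<in>L. length w = word_length G S (word_eval G w))"

text \<open>For \<open>w \<in> L\<close> there is exactly one path \<open>p\<close> from \<open>v1\<close> with label \<open>w\<close>, and \<open>awalk_verts v1 p ! i\<close>
  is the vertex it reaches after \<open>i\<close> edges.\<close>

definition weakly_combable ::
    "('a, 'b) monoid_scheme \<Rightarrow> 'a set \<Rightarrow> 'a list set \<Rightarrow> ('a \<Rightarrow> int) \<Rightarrow> bool" where
  "weakly_combable G S L \<phi> \<longleftrightarrow>
     (\<exists>(\<Gamma> :: (nat, nat) pre_digraph) lab v1 (d\<phi> :: nat \<Rightarrow> int).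
        parameterizes S \<Gamma> lab v1 L \<and>
        (\<forall>w\<in>L. \<forall>p v. pre_digraph.awalk \<Gamma> v1 p v \<and> map lab p = w \<longrightarrow>
           \<phi> (word_eval G w) = (\<Sum>i=0..length w. d\<phi> (pre_digraph.awalk_verts \<Gamma> v1 p ! i))))"

definition bicombable_wrt ::
    "('a, 'b) monoid_scheme \<Rightarrow> 'a set \<Rightarrow> 'a list set \<Rightarrow> ('a \<Rightarrow> int) \<Rightarrow> bool" where
  "bicombable_wrt G S L \<phi> \<longleftrightarrow>
     weakly_combable G S L \<phi> \<and>
     (\<exists>C. \<forall>a\<in>carrier G. \<forall>s\<in>S.
        \<bar>\<phi> (a \<otimes>\<^bsub>G\<^esub> s) - \<phi> a\<bar> \<le> C \<and> \<bar>\<phi> (s \<otimes>\<^bsub>G\<^esub> a) - \<phi> a\<bar> \<le> C)"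

text \<open>On a word-hyperbolic group bicombability does not depend on the generating set or on the
  combing, so \<open>\<phi>\<close> is called bicombable if it is so for some choice of them.\<close>

definition bicombable :: "('a, 'b) monoid_scheme \<Rightarrow> ('a \<Rightarrow> int) \<Rightarrow> bool" where
  "bicombable G \<phi> \<longleftrightarrow>
     (\<exists>S L. finite_symmetric_generating_set G S \<and> combing G S L \<and> bicombable_wrt G S L \<phi>)"

end

(*
  The word metric of S is hyperbolic by the Morse lemma. Declaring the parent of g to be g s^-1, for the
  least letter s in which a geodesic word for g can end, makes the group a tree whose n-th level is the
  sphere of radius n. By Cannon's argument there are finitely many types of subtrees, even if the
  increments of phi are recorded: a path of the combing runs near every geodesic of S, so the increments
  are determined by the combing states and the values of phi on a ball of bounded radius.

  In a nonelementary group a bounded word can be inserted between any two elements so that lengths add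
  up to a constant. Hence the spheres grow like lam^n, the operator "sum over the children, divided by
  lam" is power bounded, and the mean ergodic projection wt of the constant 1 turns the tree into a
  finite state Markov chain with transition operator P. Decompose the drift of phi as E + h - P h with
  P E = E. Then phi - n E + h is a martingale, and wherever E is constant the variance of phi on the n-th
  level is O(n). The vertices with wt = 0 only have exponentially fewer descendants.

  E is constant: the elements reached with mean E_min have positive density, and after insertion of a
  bounded word they can be put behind an element all of whose neighbours have mean E_max, where such
  increments are rare. The theorem then follows from Chebyshev's inequality.
*)

theory Submission
  imports Defs "HOL-Computational_Algebra.Polynomial"
begin

section \<open>Thin geodesic spaces\<close>

text \<open>The spheres belong to \<open>S\<close>, whereas bicombability is given for some possibly
  different generating set, so the tree cannot be read off the digraph of the combing. It is built
  from \<open>S\<close> alone, and the combing only shows that finitely many labelled subtrees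
  occur. The graph of types may be periodic and reducible. Periodicity is why weights are Cesaro
  limits. Reducibility is the real obstacle: each recurrent part might have its own mean. While
  \<open>E\<close> may vary, the weighted second moment of \<phi> - n E is only o(n^2). This weak
  law is what makes a comparison of the parts possible: right multiplication by a bounded element
  and left translation with insertion move many elements between them, and change \<phi> by a
  bounded amount because \<phi> is Lipschitz on both sides. Being nonelementary enters through the
  insertion: if it fails, short elements almost fix a far away point, and the Busemann function
  centred there shows that a cyclic subgroup has finite index. Elements of weight 0 still count in
  the sphere, but the weighted moments do not see them, so they need an estimate of their
  own.\<close>

locale nat_geodesic =
  fixes M :: "'a set" and d :: "'a \<Rightarrow> 'a \<Rightarrow> nat"
  assumes d_self [simp]: "x \<in> M \<Longrightarrow> d x x = 0"
    and d_sym: "x \<in> M \<Longrightarrow> y \<in> M \<Longrightarrow> d x y = d y x"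
    and d_tri: "x \<in> M \<Longrightarrow> y \<in> M \<Longrightarrow> z \<in> M \<Longrightarrow> d x z \<le> d x y + d y z"
    and geodesic_ex: "x \<in> M \<Longrightarrow> y \<in> M \<Longrightarrow>
      \<exists>p. p 0 = x \<and> p (d x y) = y \<and> (\<forall>i\<le>d x y. p i \<in> M) \<and>
          (\<forall>i\<le>d x y. \<forall>j\<le>d x y. int (d (p i) (p j)) = \<bar>int i - int j\<bar>)"
begin

text \<open>The interval: the union of all geodesics between the two ends. Thinness can then be
  stated without naming geodesics.\<close>

definition seg :: "'a \<Rightarrow> 'a \<Rightarrow> 'a set" where
  "seg x y = {p \<in> M. d x p + d p y = d x y}"

definition thin :: "nat \<Rightarrow> bool" where
  "thin \<delta> \<longleftrightarrow> (\<forall>x\<in>M. \<forall>y\<in>M. \<forall>z\<in>M. \<forall>p\<in>seg x y. \<exists>q\<in>seg x z \<union> seg z y. d p q \<le> \<delta>)"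

text \<open>Gromov's four-point inequality, written with sums of opposite distances instead of
  Gromov products so that all terms are natural numbers.\<close>

definition four_point :: "nat \<Rightarrow> bool" where
  "four_point \<delta> \<longleftrightarrow> (\<forall>x\<in>M. \<forall>y\<in>M. \<forall>z\<in>M. \<forall>w\<in>M.
     d x z + d y w \<le> max (d x y + d z w) (d y z + d x w) + \<delta>)"

text \<open>A discrete quasi-geodesic with a multiplicative constant only, which is what a geodesic
  of another word metric becomes.\<close>

definition quasi_path :: "nat \<Rightarrow> (nat \<Rightarrow> 'a) \<Rightarrow> nat \<Rightarrow> bool" where
  "quasi_path k c n \<longleftrightarrow> (\<forall>i\<le>n. c i \<in> M) \<and>
     (\<forall>i\<le>n. \<forall>j\<le>n. i \<le> j \<longrightarrow> d (c i) (c j) \<le> k * (j - i) \<and> j - i \<le> k * d (c i) (c j))"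

lemma seg_sym: "x \<in> M \<Longrightarrow> y \<in> M \<Longrightarrow> seg x y = seg y x"
  unfolding seg_def by (auto simp: d_sym add.commute)

lemma segD: "p \<in> seg x y \<Longrightarrow> p \<in> M \<and> d x p + d p y = d x y"
  by (simp add: seg_def)

lemma end_in_seg: "x \<in> M \<Longrightarrow> y \<in> M \<Longrightarrow> x \<in> seg x y" "x \<in> M \<Longrightarrow> y \<in> M \<Longrightarrow> y \<in> seg x y"
  by (simp_all add: seg_def)

lemma geodesic_path:
  assumes "x \<in> M" "y \<in> M"
  obtains p where "p 0 = x" "p (d x y) = y" "\<And>i. i \<le> d x y \<Longrightarrow> p i \<in> seg x y"
    "\<And>i. i \<le> d x y \<Longrightarrow> d x (p i) = i" "\<And>i. i < d x y \<Longrightarrow> d (p i) (p (Suc i)) = 1"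
proof -
  obtain p where p: "p 0 = x" "p (d x y) = y" "\<forall>i\<le>d x y. p i \<in> M"
    "\<forall>i\<le>d x y. \<forall>j\<le>d x y. int (d (p i) (p j)) = \<bar>int i - int j\<bar>"
    using geodesic_ex[OF assms] by blast
  have a: "d x (p i) = i" if "i \<le> d x y" for i
    using p(4)[rule_format, of 0 i] that p(1) by simp
  have b: "d (p i) y = d x y - i" if "i \<le> d x y" for i
    using p(4)[rule_format, of i "d x y"] that p(2) by simp
  have "d (p i) (p (Suc i)) = 1" if "i < d x y" for i
    using p(4)[rule_format, of i "Suc i"] that by simp
  with p a b show ?thesis by (intro that[of p]) (auto simp: seg_def)
qed

lemma seg_at:
  assumes "x \<in> M" "y \<in> M" "t \<le> d x y"
  obtains p where "p \<in> seg x y" "d x p = t"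
  using geodesic_path[OF assms(1,2)] assms(3) by metis

lemma thinD:
  assumes "thin \<delta>" "x \<in> M" "y \<in> M" "z \<in> M" "p \<in> seg x y"
  obtains q where "q \<in> seg x z \<union> seg z y" "d p q \<le> \<delta>"
  using assms unfolding thin_def by blast

lemma geodesic_through:
  assumes M: "x \<in> M" "y \<in> M" and p: "p \<in> seg x y"
  obtains c where "c 0 = x" "c (d x y) = y" "c (d x p) = p" "\<And>i. i \<le> d x y \<Longrightarrow> c i \<in> seg x y"
    "\<And>i j. i \<le> j \<Longrightarrow> j \<le> d x y \<Longrightarrow> d (c i) (c j) = j - i"
proof -
  have pM: "p \<in> M" and ps: "d x p + d p y = d x y" using segD[OF p] by auto
  obtain a where a: "a 0 = x" "a (d x p) = p" "\<And>i. i \<le> d x p \<Longrightarrow> a i \<in> M"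
    "\<And>i j. i \<le> d x p \<Longrightarrow> j \<le> d x p \<Longrightarrow> int (d (a i) (a j)) = \<bar>int i - int j\<bar>"
    using geodesic_ex[OF M(1) pM] by blast
  obtain b where b: "b 0 = p" "b (d p y) = y" "\<And>i. i \<le> d p y \<Longrightarrow> b i \<in> M"
    "\<And>i j. i \<le> d p y \<Longrightarrow> j \<le> d p y \<Longrightarrow> int (d (b i) (b j)) = \<bar>int i - int j\<bar>"
    using geodesic_ex[OF pM M(2)] by blast
  define c where "c i = (if i \<le> d x p then a i else b (i - d x p))" for i
  have c_end: "c 0 = x" "c (d x y) = y" "c (d x p) = p" unfolding c_def using a b ps
    by (auto simp: ps[symmetric])
  have cM: "c i \<in> M" if "i \<le> d x y" for i unfolding c_def using a(3) b(3) ps that by auto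
  have step: "d (c i) (c j) \<le> j - i" if ij: "i \<le> j" "j \<le> d x y" for i j
  proof (cases "j \<le> d x p \<or> d x p < i")
    case True
    then show ?thesis
    proof
      assume "j \<le> d x p"
      then show ?thesis using ij a(4)[of i j] by (simp add: c_def)
    next
      assume "d x p < i"
      moreover have "i - d x p \<le> d p y" "j - d x p \<le> d p y" using ij ps by linarith+
      ultimately show ?thesis using ij ps b(4)[of "i - d x p" "j - d x p"] by (simp add: c_def)
    qed
  next
    case False
    then have "d (c i) p = d x p - i"
      using ij ps a(4)[of i "d x p"] a(2) by (simp add: c_def)
    moreover have "j - d x p \<le> d p y" using ij ps by linarith
    then have "d p (c j) = j - d x p"
      using False b(4)[of 0 "j - d x p"] b(1) by (simp add: c_def)
    ultimately have "d (c i) p = d x p - i" "d p (c j) = j - d x p" by blast+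
    then show ?thesis using d_tri[of "c i" p "c j"] cM[of i] cM[of j] pM ij False by simp
  qed
  have eq: "d (c i) (c j) = j - i" if ij: "i \<le> j" "j \<le> d x y" for i j
  proof -
    have "d x y \<le> d x (c i) + (d (c i) (c j) + d (c j) y)"
      using d_tri[of x "c i" y] d_tri[of "c i" "c j" y] cM[of i] cM[of j] M ij by simp
    moreover have "d x (c i) \<le> i" "d (c j) y \<le> d x y - j"
      using step[of 0 i] step[of j "d x y"] ij c_end by auto
    ultimately show ?thesis using step[OF ij] ij by linarith
  qed
  have "c i \<in> seg x y" if "i \<le> d x y" for i
    using eq[of 0 i] eq[of i "d x y"] that c_end cM[OF that] by (simp add: seg_def)
  then show ?thesis using that c_end eq by blast
qed

lemma geodesic_param:
  assumes "x \<in> M" "y \<in> M"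
  obtains c where "c 0 = x" "c (d x y) = y" "\<And>i. i \<le> d x y \<Longrightarrow> c i \<in> seg x y"
    "\<And>i j. i \<le> j \<Longrightarrow> j \<le> d x y \<Longrightarrow> d (c i) (c j) = j - i"
  by (rule geodesic_through[OF assms end_in_seg(1)[OF assms]]) (rule that)

text \<open>A substitute for connectedness. On an integer path the changeover may happen between
  neighbours, which is the origin of the extra 1 in later distance bounds.\<close>

lemma discrete_switch:
  fixes n :: nat
  assumes "\<And>i. i \<le> n \<Longrightarrow> A i \<or> B i" "A 0" "B n"
  obtains i where "i \<le> n" "A i" "B i" | i where "i < n" "A i" "B (Suc i)"
proof (cases "\<exists>i<n. A i \<and> B (Suc i)")
  case True
  then show ?thesis using that(2) by blast
next
  case False
  have "A i" if "i \<le> n" for i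
    using that
  proof (induction i)
    case 0
    then show ?case using assms by simp
  next
    case (Suc i)
    then show ?case using assms(1)[of "Suc i"] False by auto
  qed
  then show ?thesis using that(1)[of n] assms(3) by blast
qed

section \<open>Gromov products and the four-point inequality\<close>

text \<open>Where a geodesic from \<open>x\<close> to \<open>y\<close> changes from following the
  side to \<open>w\<close> to following the other side, it is near both of them. The triangle
  inequality then bounds the distance from \<open>w\<close> by the Gromov product of
  \<open>x\<close> and \<open>y\<close> up to \<open>2 * \<delta> + 1\<close>.\<close>

lemma seg_near_gromov_product:
  assumes t: "thin \<delta>" and M: "x \<in> M" "y \<in> M" "w \<in> M"
  obtains p where "p \<in> seg x y" "2 * d w p + d x y \<le> d x w + d y w + (4 * \<delta> + 2)"
proof -
  obtain p where p: "p 0 = x" "p (d x y) = y" "\<And>i. i \<le> d x y \<Longrightarrow> p i \<in> seg x y"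
    "\<And>i. i \<le> d x y \<Longrightarrow> d x (p i) = i" "\<And>i. i < d x y \<Longrightarrow> d (p i) (p (Suc i)) = 1"
    using geodesic_path[OF M(1,2)] by blast
  have "\<exists>i\<le>d x y. \<exists>a\<in>seg x w. \<exists>b\<in>seg w y. d (p i) a \<le> \<delta> \<and> d (p i) b \<le> \<delta> + 1"
  proof (rule discrete_switch[of "d x y" "\<lambda>i. \<exists>a\<in>seg x w. d (p i) a \<le> \<delta>"
        "\<lambda>i. \<exists>a\<in>seg w y. d (p i) a \<le> \<delta>"])
    show "(\<exists>a\<in>seg x w. d (p i) a \<le> \<delta>) \<or> (\<exists>a\<in>seg w y. d (p i) a \<le> \<delta>)" if "i \<le> d x y" for i
      using thinD[OF t M p(3)[OF that]] by blast
    show "\<exists>a\<in>seg x w. d (p 0) a \<le> \<delta>"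
      using p(1) M by (intro bexI[of _ x]) (auto simp: end_in_seg)
    show "\<exists>a\<in>seg w y. d (p (d x y)) a \<le> \<delta>"
      using p(2) M by (intro bexI[of _ y]) (auto simp: end_in_seg)
  next
    fix i assume i: "i < d x y" "\<exists>a\<in>seg x w. d (p i) a \<le> \<delta>" "\<exists>a\<in>seg w y. d (p (Suc i)) a \<le> \<delta>"
    then obtain a b where ab: "a \<in> seg x w" "d (p i) a \<le> \<delta>" "b \<in> seg w y" "d (p (Suc i)) b \<le> \<delta>"
      by blast
    have "d (p i) b \<le> d (p i) (p (Suc i)) + d (p (Suc i)) b"
      using i ab p(3)[of i] p(3)[of "Suc i"] by (intro d_tri) (auto dest: segD)
    then have "d (p i) b \<le> \<delta> + 1" using ab p(5)[of i] i by simp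
    then show ?thesis using ab i by (meson less_imp_le)
  qed (meson le_add1 le_trans)
  then obtain i a b where i: "i \<le> d x y" "a \<in> seg x w" "b \<in> seg w y" "d (p i) a \<le> \<delta>" "d (p i) b \<le> \<delta> + 1"
    by blast
  let ?q = "p i"
  have inM: "?q \<in> M" "a \<in> M" "b \<in> M" using i p(3) by (auto dest: segD)
  have "d x a + d a w = d x w" "d w b + d b y = d w y" using i by (auto dest: segD)
  moreover have "d x y \<le> d x a + d a b + d b y" "d a b \<le> d ?q a + d ?q b"
    "d w ?q \<le> d a w + d ?q a" "d w ?q \<le> d w b + d ?q b"
    using d_tri[of x a y] d_tri[of a b y] d_tri[of a ?q b] d_tri[of w a ?q] d_tri[of w b ?q] M inM
    by (auto simp: d_sym)
  ultimately have "2 * d w ?q + d x y \<le> d x w + d y w + (4 * \<delta> + 2)"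
    using i d_sym[of y w] M by linarith
  then show ?thesis using that p(3) i by blast
qed

text \<open>A point of \<open>seg x z\<close> whose distance from \<open>w\<close> is the Gromov
  product up to an error lies within \<delta> of a side through \<open>y\<close>, and the distance
  from \<open>w\<close> to a side bounds the Gromov product of its ends from above.\<close>

lemma thin_imp_four_point:
  assumes t: "thin \<delta>"
  shows "four_point (6 * \<delta> + 2)"
  unfolding four_point_def
proof (intro ballI)
  fix x y z w assume M: "x \<in> M" "y \<in> M" "z \<in> M" "w \<in> M"
  obtain p where p: "p \<in> seg x z" "2 * d w p + d x z \<le> d x w + d z w + (4 * \<delta> + 2)"
    using seg_near_gromov_product[OF t M(1,3,4)] by blast
  obtain q where q: "q \<in> seg x y \<union> seg y z" "d p q \<le> \<delta>"
    using thinD[OF t M(1,3,2) p(1)] by blast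
  have inM: "p \<in> M" "q \<in> M" using p q by (auto dest: segD)
  have wq: "d w q \<le> d w p + \<delta>" using d_tri[of w p q] M inM q by simp
  have "d x w + d y w \<le> d x y + 2 * d w q" if "q \<in> seg x y"
    using d_tri[of x q w] d_tri[of y q w] M inM segD[OF that] d_sym[of q w] d_sym[of y q] by linarith
  moreover have "d y w + d z w \<le> d y z + 2 * d w q" if "q \<in> seg y z"
    using d_tri[of y q w] d_tri[of z q w] M inM segD[OF that] d_sym[of q w] d_sym[of z q] by linarith
  ultimately show "d x z + d y w \<le> max (d x y + d z w) (d y z + d x w) + (6 * \<delta> + 2)"
    using p q wq by fastforce
qed

section \<open>Stability of quasi-geodesics\<close>

text \<open>Each halving of the index range uses one thin triangle and costs \<delta>. The resulting
  bound is only logarithmic in the number of indices, but it starts the Morse argument.\<close>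

lemma quasi_path_log:
  assumes t: "thin \<delta>" and qp: "quasi_path k c n"
  shows "\<lbrakk>i \<le> j; j \<le> n; j \<le> i + 2 ^ m; p \<in> seg (c i) (c j)\<rbrakk> \<Longrightarrow> \<exists>l\<le>n. d p (c l) \<le> \<delta> * m + k"
proof (induction m arbitrary: i j p)
  case 0
  have inM: "c i \<in> M" "c j \<in> M" using 0 qp by (auto simp: quasi_path_def)
  have "d (c i) (c j) \<le> k * (j - i)" using qp 0 unfolding quasi_path_def by auto
  also have "\<dots> \<le> k * 1" using 0 by (intro mult_left_mono) auto
  finally have "d p (c j) \<le> k" using segD[OF 0(4)] by simp
  then show ?case using 0 by auto
next
  case (Suc m)
  define l where "l = min j (i + 2 ^ m)"
  have l: "i \<le> l" "l \<le> j" "l \<le> i + 2 ^ m" "j \<le> l + 2 ^ m" using Suc.prems by (auto simp: l_def)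
  have inM: "c i \<in> M" "c j \<in> M" "c l \<in> M" using Suc.prems l qp by (auto simp: quasi_path_def)
  obtain q where q: "q \<in> seg (c i) (c l) \<union> seg (c l) (c j)" "d p q \<le> \<delta>"
    using thinD[OF t inM Suc.prems(4)] by blast
  have "\<exists>l\<le>n. d q (c l) \<le> \<delta> * m + k"
    using q(1) Suc.IH[of i l q] Suc.IH[of l j q] l Suc.prems by auto
  then obtain l' where l': "l' \<le> n" "d q (c l') \<le> \<delta> * m + k" by blast
  have "d p (c l') \<le> d p q + d q (c l')"
    using l' q Suc.prems(4) qp by (intro d_tri) (auto dest: segD simp: quasi_path_def)
  then show ?case using l' q by (intro exI[of _ l']) auto
qed

text \<open>\<open>D\<close> stands for the largest distance from a point of the geodesic to the
  path, attained at \<open>p0\<close>. Going \<open>2 * D\<close> away from \<open>p0\<close> to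
  both sides and crossing over to the path gives a quadrilateral whose crossings stay at distance
  \<open>D\<close> from \<open>p0\<close>, while its fourth side spans at most
  \<open>6 * k * D\<close> indices. So \<open>D\<close> is bounded by a logarithm of itself.\<close>

lemma geodesic_near_quasi_path_bound:
  assumes t: "thin \<delta>" and qp: "quasi_path k c n"
    and D: "\<And>p. p \<in> seg (c 0) (c n) \<Longrightarrow> \<exists>i\<le>n. d p (c i) \<le> D"
    and p0: "p0 \<in> seg (c 0) (c n)" "\<And>i. i \<le> n \<Longrightarrow> D \<le> d p0 (c i)"
    and m: "6 * k * D \<le> 2 ^ m"
  shows "D \<le> \<delta> * (m + 2) + k"
proof -
  let ?x = "c 0" and ?y = "c n"
  have cM: "c i \<in> M" if "i \<le> n" for i using qp that by (simp add: quasi_path_def)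
  have p0M: "p0 \<in> M" and p0s: "d ?x p0 + d p0 ?y = d ?x ?y" using p0 by (auto dest: segD)
  have side: "\<exists>y'\<in>M. \<exists>i\<le>n. d y' p0 \<le> 2 * D \<and> d u y' + d y' p0 = d u p0 \<and> d y' (c i) \<le> D \<and>
       (\<forall>q\<in>seg y' (c i). D \<le> d p0 q)"
    if u: "u = ?x \<or> u = ?y" for u
  proof (cases "d u p0 \<le> 2 * D")
    case True
    \<comment> \<open>At most \<open>2 * D\<close> remains to the end \<open>u\<close>, so the end
      itself, which lies on the path, is taken. Points at distance 0 are not assumed to be equal,
      hence the detour through the triangle inequality.\<close>
    obtain i where i: "i \<le> n" "u = c i" using u by auto
    have "D \<le> d p0 q" if "q \<in> seg u (c i)" for q
    proof -
      have "d u q = 0" "q \<in> M" using segD[OF that] i cM by auto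
      then have "d p0 u \<le> d p0 q"
        using d_tri[of p0 q u] d_sym[of q u] p0M cM i by simp
      then show ?thesis using p0(2) i by fastforce
    qed
    then show ?thesis using True i cM u by (intro bexI[of _ u] exI[of _ i]) auto
  next
    case False
    have uM: "u \<in> M" using u cM by auto
    obtain y' where y': "y' \<in> seg p0 u" "d p0 y' = 2 * D"
      using seg_at[OF p0M uM, of "2 * D"] False d_sym[OF uM p0M] by auto
    have y'M: "y' \<in> M" using y' segD by blast
    have eq: "d u y' + d y' p0 = d u p0"
      using segD[OF y'(1)] d_sym[of u y'] d_sym[of y' p0] d_sym[of u p0] uM p0M by simp
    have "y' \<in> seg ?x ?y"
      using u
    proof
      assume "u = ?x"
      then show ?thesis
        using eq p0s d_tri[OF y'M p0M cM[of n]] d_tri[OF cM[of 0] y'M cM[of n]] y'M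
        unfolding seg_def by simp
    next
      assume "u = ?y"
      then show ?thesis
        using eq p0s d_tri[OF cM[of 0] p0M y'M] d_tri[OF cM[of 0] y'M cM[of n]] y'M
          d_sym[OF y'M cM[of n]] d_sym[OF y'M p0M] d_sym[OF p0M cM[of n]]
        unfolding seg_def by simp
    qed
    then obtain i where i: "i \<le> n" "d y' (c i) \<le> D" using D by blast
    have "D \<le> d p0 q" if "q \<in> seg y' (c i)" for q
    proof -
      have q: "q \<in> M" "d y' q \<le> D" using segD[OF that] i by auto
      then have "2 * D \<le> d p0 q + d q y'" using d_tri[of p0 q y'] y'(2) p0M y'M by simp
      then show ?thesis using q d_sym[of q y'] y'M by simp
    qed
    then show ?thesis
      using i y'M eq y'(2) d_sym[of y' p0] p0M by (intro bexI[of _ y'] exI[of _ i]) auto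
  qed
  obtain y' i where y': "y' \<in> M" "i \<le> n" "d y' p0 \<le> 2 * D" "d ?x y' + d y' p0 = d ?x p0"
    "d y' (c i) \<le> D" "\<forall>q\<in>seg y' (c i). D \<le> d p0 q"
    using side[of ?x] by blast
  obtain z' j where z': "z' \<in> M" "j \<le> n" "d z' p0 \<le> 2 * D" "d ?y z' + d z' p0 = d ?y p0"
    "d z' (c j) \<le> D" "\<forall>q\<in>seg z' (c j). D \<le> d p0 q"
    using side[of ?y] by blast
  have "d y' p0 + d p0 z' = d y' z'"
    using d_tri[OF y'(1) p0M z'(1)] d_tri[OF cM[of 0] y'(1) cM[of n]] d_tri[OF y'(1) z'(1) cM[of n]] p0s y'(4) z'(4)
      d_sym[OF p0M z'(1)] d_sym[OF z'(1) cM[of n]] d_sym[OF p0M cM[of n]] by simp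
  then have ps: "p0 \<in> seg y' z'" using p0M by (simp add: seg_def)
  have ciM: "c i \<in> M" and cjM: "c j \<in> M" using cM y' z' by auto
  obtain q1 where q1: "q1 \<in> seg y' (c i) \<union> seg (c i) z'" "d p0 q1 \<le> \<delta>"
    using thinD[OF t y'(1) z'(1) ciM ps] by blast
  show ?thesis
  proof (cases "q1 \<in> seg y' (c i)")
    case True
    then have "D \<le> \<delta>" using y'(6) q1 by fastforce
    then show ?thesis by simp
  next
    case False
    then have q1s: "q1 \<in> seg (c i) z'" using q1 by blast
    then have q1M: "q1 \<in> M" using segD by blast
    obtain q2 where q2: "q2 \<in> seg (c i) (c j) \<union> seg (c j) z'" "d q1 q2 \<le> \<delta>"
      using thinD[OF t ciM z'(1) cjM q1s] by blast
    have q2M: "q2 \<in> M" using segD q2 by blast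
    have p0q2: "d p0 q2 \<le> 2 * \<delta>" using d_tri[of p0 q1 q2] p0M q1M q2M q1 q2 by simp
    show ?thesis
    proof (cases "q2 \<in> seg (c j) z'")
      case True
      then have "D \<le> 2 * \<delta>" using z'(6) p0q2 seg_sym[OF cjM z'(1)] by fastforce
      then show ?thesis by simp
    next
      case False
      then have q2s: "q2 \<in> seg (c i) (c j)" using q2 by blast
      \<comment> \<open>At most \<open>D\<close> for each crossing and at most \<open>2 * D\<close>
        from \<open>p0\<close> to each of \<open>y'\<close> and \<open>z'\<close>.\<close>
      have dij: "d (c i) (c j) \<le> 6 * D"
        using d_tri[of "c i" y' "c j"] d_tri[of y' z' "c j"] d_tri[of y' p0 z'] y' z' ciM cjM p0M
          d_sym[of "c i" y'] d_sym[of p0 z'] by linarith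
      have bnd: "a \<le> b + 2 ^ m" if "b \<le> a" "d (c b) (c a) \<le> 6 * D" "a \<le> n" for a b
      proof -
        have "a - b \<le> k * d (c b) (c a)" using qp that unfolding quasi_path_def by auto
        also have "\<dots> \<le> k * (6 * D)" using that by simp
        finally show ?thesis using m by (simp add: algebra_simps)
      qed
      have "\<exists>l\<le>n. d q2 (c l) \<le> \<delta> * m + k"
      proof (cases "i \<le> j")
        case True
        then show ?thesis using quasi_path_log[OF t qp, of i j m q2] q2s bnd[of i j] dij z' by blast
      next
        case False
        then show ?thesis
          using quasi_path_log[OF t qp, of j i m q2] q2s bnd[of j i] dij y'(2)
          unfolding d_sym[OF ciM cjM] seg_sym[OF ciM cjM] by simp
      qed
      then obtain l where l: "l \<le> n" "d q2 (c l) \<le> \<delta> * m + k" by blast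
      have "D \<le> d p0 (c l)" using p0 l by simp
      also have "\<dots> \<le> d p0 q2 + d q2 (c l)" using l cM p0M q2M by (intro d_tri) auto
      finally show ?thesis using l p0q2 by (simp add: algebra_simps)
    qed
  qed
qed

text \<open>This turns the logarithmic self-bound of \<open>D\<close> into an absolute one: beyond
  \<open>R\<close> some number \<open>m\<close> of halvings suffices for the bisection, yet makes
  the resulting bound smaller than \<open>D\<close>.\<close>

lemma linear_less_power_two:
  fixes a b e :: nat
  obtains R where "\<And>D. D > R \<Longrightarrow> \<exists>m. a * D \<le> 2 ^ m \<and> b * (m + 2) + e < D"
proof -
  have "\<exists>R. \<forall>m\<ge>R. a * ((b + 1) * (m + 4) + e) \<le> 2 ^ m"
  proof -
    define A where "A = a * (b + 1)"
    define B where "B = a * ((b + 1) * 4 + e)"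
    have "m\<^sup>2 \<le> 2 ^ m" if "m \<ge> 4" for m :: nat
      using that
    proof (induction m rule: dec_induct)
      case (step m)
      have "4 * m \<le> m * m" using step(1) by simp
      then have "2 * m + 1 \<le> m * m" using step(1) by linarith
      then have "(Suc m)\<^sup>2 \<le> 2 * m\<^sup>2" by (simp add: power2_eq_square algebra_simps)
      then show ?case using step by simp
    qed simp
    moreover have "A * m + B \<le> m\<^sup>2" if "m \<ge> A + B + 1" for m
    proof -
      have "B * 1 \<le> B * m" using that by (intro mult_le_mono) auto
      then have "A * m + B \<le> A * m + B * m" by linarith
      also have "\<dots> = (A + B) * m" by (simp add: algebra_simps)
      also have "\<dots> \<le> m * m" using that by (intro mult_right_mono) auto
      finally show ?thesis by (simp add: power2_eq_square)
    qed
    ultimately have "A * m + B \<le> 2 ^ m" if "m \<ge> A + B + 4" for m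
      using that le_trans[of "A * m + B" "m\<^sup>2" "2 ^ m"] by simp
    then have "\<forall>m\<ge>A + B + 4. A * m + B \<le> 2 ^ m" by blast
    then show ?thesis unfolding A_def B_def by (auto simp: algebra_simps)
  qed
  then obtain R where R: "\<And>m. m \<ge> R \<Longrightarrow> a * ((b + 1) * (m + 4) + e) \<le> 2 ^ m" by blast
  show ?thesis
  proof (rule that[of "(b + 1) * (R + 3) + e"])
    fix D assume D: "D > (b + 1) * (R + 3) + e"
    \<comment> \<open>Essentially the largest \<open>m\<close> that the second inequality admits.
      Dividing by \<open>b + 1\<close> keeps the divisor positive when \<open>b = 0\<close>.\<close>
    define m where "m = (D - e) div (b + 1) - 3"
    have "R + 3 = ((b + 1) * (R + 3)) div (b + 1)"
      by (rule nonzero_mult_div_cancel_left[symmetric]) simp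
    also have "\<dots> \<le> (D - e) div (b + 1)" using D by (intro div_le_mono) linarith
    finally have "R + 3 \<le> (D - e) div (b + 1)" .
    then have m: "m \<ge> R" "(D - e) div (b + 1) = m + 3" by (auto simp: m_def)
    have "(b + 1) * (m + 3) + (D - e) mod (b + 1) = D - e" 
      using mult_div_mod_eq[of "b + 1" "D - e"] unfolding m(2) .
    moreover have "(D - e) mod (b + 1) < b + 1" by simp
    moreover have "(b + 1) * (m + 4) = (b + 1) * (m + 3) + (b + 1)" by (simp add: distrib_left)
    moreover have "b * (m + 2) + 1 \<le> (b + 1) * (m + 3)" by (simp add: distrib_left distrib_right)
    ultimately have "D \<le> (b + 1) * (m + 4) + e" "b * (m + 2) + e < D"
      using D by linarith+
    then show "\<exists>m. a * D \<le> 2 ^ m \<and> b * (m + 2) + e < D"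
      using R[OF m(1)] by (meson le_trans mult_le_mono2)
  qed
qed

lemma geodesic_near_quasi_path:
  assumes t: "thin \<delta>"
  obtains R where "\<And>c n p. quasi_path k c n \<Longrightarrow> p \<in> seg (c 0) (c n) \<Longrightarrow> \<exists>i\<le>n. d p (c i) \<le> R"
proof -
  obtain R where R: "\<And>D. D > R \<Longrightarrow> \<exists>m. 6 * k * D \<le> 2 ^ m \<and> \<delta> * (m + 2) + k < D"
    using linear_less_power_two by blast
  show ?thesis
  proof (rule that[of R])
    fix c n p assume qp: "quasi_path k c n" and p: "p \<in> seg (c 0) (c n)"
    define f where "f q = Min ((\<lambda>i. d q (c i)) ` {..n})" for q
    have f: "(\<exists>i\<le>n. d q (c i) = f q) \<and> (\<forall>i\<le>n. f q \<le> d q (c i))" for q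
    proof -
      have "f q \<in> (\<lambda>i. d q (c i)) ` {..n}" unfolding f_def by (intro Min_in) auto
      moreover have "f q \<le> d q (c i)" if "i \<le> n" for i
        unfolding f_def using that by (intro Min_le) auto
      ultimately show ?thesis by auto
    qed
    have bd: "f q \<le> d (c 0) (c n)" if "q \<in> seg (c 0) (c n)" for q
    proof -
      have "f q \<le> d q (c n)" using f[of q] by simp
      then show ?thesis using segD[OF that] by linarith
    qed
    have "\<exists>q. q \<in> seg (c 0) (c n) \<and> (\<forall>q'. q' \<in> seg (c 0) (c n) \<longrightarrow> f q' \<le> f q)"
      by (rule ex_has_greatest_nat[of _ p _ "Suc (d (c 0) (c n))"]) (use p bd in \<open>auto simp: less_Suc_eq_le\<close>)
    then obtain p0 where p0: "p0 \<in> seg (c 0) (c n)" "\<And>q. q \<in> seg (c 0) (c n) \<Longrightarrow> f q \<le> f p0" by blast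
    have "f p0 \<le> \<delta> * (m + 2) + k" if "6 * k * f p0 \<le> 2 ^ m" for m
    proof (rule geodesic_near_quasi_path_bound[OF t qp _ p0(1) _ that])
      show "\<exists>i\<le>n. d q (c i) \<le> f p0" if "q \<in> seg (c 0) (c n)" for q
        using f[of q] p0(2)[OF that] by auto
      show "f p0 \<le> d p0 (c i)" if "i \<le> n" for i using f that by blast
    qed
    then have "f p0 \<le> R" using R[of "f p0"] by (meson leD leI)
    then show "\<exists>i\<le>n. d p (c i) \<le> R" using f[of p] p0(2)[OF p] by (metis le_trans)
  qed
qed

text \<open>Every point of the geodesic is near the part of the path before \<open>m\<close> or the
  part after it. At the changeover one point is near some \<open>c i\<close> and \<open>c j\<close>
  with \<open>i \<le> m \<le> j\<close>, so \<open>j - i\<close> is bounded, and \<open>c m\<close>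
  is close to both.\<close>

lemma quasi_path_near_geodesic:
  assumes t: "thin \<delta>"
  obtains R where "\<And>c n i. quasi_path k c n \<Longrightarrow> i \<le> n \<Longrightarrow> \<exists>p\<in>seg (c 0) (c n). d (c i) p \<le> R"
proof -
  obtain R where R: "\<And>c n p. quasi_path k c n \<Longrightarrow> p \<in> seg (c 0) (c n) \<Longrightarrow> \<exists>i\<le>n. d p (c i) \<le> R"
    using geodesic_near_quasi_path[OF t] by blast
  show ?thesis
  proof (rule that[of "k * (k * (2 * R + 1)) + R"])
    fix c n m assume qp: "quasi_path k c n" and m: "m \<le> n"
    have cM: "c i \<in> M" if "i \<le> n" for i using qp that by (simp add: quasi_path_def)
    let ?L = "d (c 0) (c n)"
    obtain p where p: "p 0 = c 0" "p ?L = c n" "\<And>i. i \<le> ?L \<Longrightarrow> p i \<in> seg (c 0) (c n)"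
      "\<And>i. i \<le> ?L \<Longrightarrow> d (c 0) (p i) = i" "\<And>i. i < ?L \<Longrightarrow> d (p i) (p (Suc i)) = 1"
      using geodesic_path[OF cM[of 0] cM[of n]] by auto
    have pM: "p i \<in> M" if "i \<le> ?L" for i using p(3)[OF that] segD by blast
    have "\<exists>t\<le>?L. \<exists>i\<le>m. \<exists>j\<le>n. m \<le> j \<and> d (p t) (c i) \<le> R \<and> d (p t) (c j) \<le> R + 1"
    proof (rule discrete_switch[of ?L "\<lambda>t. \<exists>i\<le>m. d (p t) (c i) \<le> R" "\<lambda>t. \<exists>j\<le>n. m \<le> j \<and> d (p t) (c j) \<le> R"])
      show "(\<exists>i\<le>m. d (p t) (c i) \<le> R) \<or> (\<exists>j\<le>n. m \<le> j \<and> d (p t) (c j) \<le> R)" if "t \<le> ?L" for t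
        using R[OF qp p(3)[OF that]] by (meson linear)
      show "\<exists>i\<le>m. d (p 0) (c i) \<le> R" using p(1) cM[of 0] by (intro exI[of _ 0]) auto
      show "\<exists>j\<le>n. m \<le> j \<and> d (p ?L) (c j) \<le> R" using p(2) cM[of n] m by (intro exI[of _ n]) auto
    next
      fix t assume t: "t < ?L" "\<exists>i\<le>m. d (p t) (c i) \<le> R" "\<exists>j\<le>n. m \<le> j \<and> d (p (Suc t)) (c j) \<le> R"
      then obtain i j where ij: "i \<le> m" "d (p t) (c i) \<le> R" "j \<le> n" "m \<le> j" "d (p (Suc t)) (c j) \<le> R" by blast
      have "d (p t) (c j) \<le> d (p t) (p (Suc t)) + d (p (Suc t)) (c j)"
        using t ij pM cM by (intro d_tri) auto
      then have "d (p t) (c j) \<le> R + 1" using ij(5) p(5)[OF t(1)] by linarith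
      then show ?thesis using t(1) ij(1-4) by (meson less_imp_le)
    qed (meson le_add1 le_trans)
    then obtain t i j
      where t: "t \<le> ?L" "i \<le> m" "j \<le> n" "m \<le> j" "d (p t) (c i) \<le> R" "d (p t) (c j) \<le> R + 1" by blast
    have inM: "c i \<in> M" "c j \<in> M" "p t \<in> M" "c m \<in> M" using t m cM pM by auto
    have "j - i \<le> k * d (c i) (c j)" using qp t m unfolding quasi_path_def by auto
    also have "\<dots> \<le> k * (2 * R + 1)"
      using d_tri[of "c i" "p t" "c j"] inM t d_sym[of "c i" "p t"] by (intro mult_left_mono) auto
    finally have "m - i \<le> k * (2 * R + 1)" using t by linarith
    moreover have "d (c i) (c m) \<le> k * (m - i)" using qp t m unfolding quasi_path_def by auto
    ultimately have "d (c i) (c m) \<le> k * (k * (2 * R + 1))" by (meson le_trans mult_le_mono2)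
    then have "d (c m) (p t) \<le> k * (k * (2 * R + 1)) + R"
      using d_tri[of "c m" "c i" "p t"] inM t d_sym[of "c i" "c m"] d_sym[of "c i" "p t"] by simp
    then show "\<exists>p\<in>seg (c 0) (c n). d (c m) p \<le> k * (k * (2 * R + 1)) + R" using p(3) t by blast
  qed
qed

end

section \<open>Power-bounded operators and trees with finitely many types\<close>

text \<open>Gaussian elimination of one coordinate at a time, with pivot \<open>m\<close>. It serves
  to produce an annihilating polynomial.\<close>

lemma linear_dependence:
  fixes f :: "'k \<Rightarrow> 'i \<Rightarrow> real"
  assumes "finite I" "finite K" "card I < card K"
  shows "\<exists>c. (\<exists>k\<in>K. c k \<noteq> 0) \<and> (\<forall>i\<in>I. (\<Sum>k\<in>K. c k * f k i) = 0)"
  using assms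
proof (induction I arbitrary: K f rule: finite_induct)
  case empty
  then have "K \<noteq> {}" by auto
  then show ?case by (intro exI[of _ "\<lambda>_. 1"]) auto
next
  case (insert i I)
  show ?case
  proof (cases "\<forall>k\<in>K. f k i = 0")
    case True
    obtain c where "\<exists>k\<in>K. c k \<noteq> 0" "\<forall>i\<in>I. (\<Sum>k\<in>K. c k * f k i) = 0"
      using insert.IH[of K f] insert.prems insert.hyps by auto
    then show ?thesis using True by (intro exI[of _ c]) auto
  next
    case False
    then obtain m where m: "m \<in> K" "f m i \<noteq> 0" by blast
    define K' where "K' = K - {m}"
    have K': "finite K'" "m \<notin> K'" "K = insert m K'" using insert.prems m by (auto simp: K'_def)
    then have "card I < card K'" using insert.prems insert.hyps by auto
    then obtain c where c: "\<exists>k\<in>K'. c k \<noteq> 0"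
      "\<forall>j\<in>I. (\<Sum>k\<in>K'. c k * (f k j - f k i / f m i * f m j)) = 0"
      using insert.IH[of K' "\<lambda>k j. f k j - f k i / f m i * f m j"] K'(1) by auto
    define b where "b = - (\<Sum>k\<in>K'. c k * (f k i / f m i))"
    define c' where "c' = c(m := b)"
    have sum': "(\<Sum>k\<in>K. c' k * f k j) = b * f m j + (\<Sum>k\<in>K'. c k * f k j)" for j
    proof -
      have "(\<Sum>k\<in>K'. c' k * f k j) = (\<Sum>k\<in>K'. c k * f k j)"
        using K'(2) by (intro sum.cong) (auto simp: c'_def)
      then show ?thesis using K' by (simp add: c'_def)
    qed
    have "(\<Sum>k\<in>K. c' k * f k j) = (\<Sum>k\<in>K'. c k * (f k j - f k i / f m i * f m j))" for j
      unfolding sum' b_def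
      by (simp add: right_diff_distrib sum_subtractf sum_distrib_right mult.assoc)
    then have "\<forall>j\<in>insert i I. (\<Sum>k\<in>K. c' k * f k j) = 0" using c(2) m by simp
    moreover have "\<exists>k\<in>K. c' k \<noteq> 0" using c(1) K' unfolding c'_def by auto
    ultimately show ?thesis by blast
  qed
qed

text \<open>The operator acts on all functions, but it preserves the finite-dimensional space of
  those that factor through \<tau>. The setting is abstract because it is used twice: for the
  counting operator it yields the weights, for the Markov operator the mean of the drift.\<close>

locale bounded_operator =
  fixes P :: "('v \<Rightarrow> real) \<Rightarrow> 'v \<Rightarrow> real" and \<tau> :: "'v \<Rightarrow> 't"
  assumes finite_types: "finite (range \<tau>)"
    and linear: "P (\<lambda>x. a * u x + b * w x) = (\<lambda>x. a * P u x + b * P w x)"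
    and invariant: "(\<And>x y. \<tau> x = \<tau> y \<Longrightarrow> u x = u y) \<Longrightarrow> \<tau> x = \<tau> y \<Longrightarrow> P u x = P u y"
    and power_bounded: "(\<And>x y. \<tau> x = \<tau> y \<Longrightarrow> u x = u y) \<Longrightarrow> \<exists>C. \<forall>n. \<bar>(P ^^ n) u x\<bar> \<le> C"
begin

definition invar :: "('v \<Rightarrow> real) \<Rightarrow> bool" where
  "invar u \<longleftrightarrow> (\<forall>x y. \<tau> x = \<tau> y \<longrightarrow> u x = u y)"

text \<open>The polynomial \<open>q\<close> evaluated at the operator \<open>P\<close> and applied
  to \<open>u\<close>.\<close>

definition op :: "real poly \<Rightarrow> ('v \<Rightarrow> real) \<Rightarrow> 'v \<Rightarrow> real" where
  "op q u x = (\<Sum>k\<le>degree q. coeff q k * (P ^^ k) u x)"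

lemma invarD: "invar u \<Longrightarrow> \<tau> x = \<tau> y \<Longrightarrow> u x = u y"
  unfolding invar_def by blast

lemma invar_P: "invar u \<Longrightarrow> invar (P u)"
  unfolding invar_def using invariant by blast

lemma invar_pow: "invar u \<Longrightarrow> invar ((P ^^ k) u)"
  by (induction k) (auto intro: invar_P)

lemma invar_op:
  assumes "invar u"
  shows "invar (op q u)"
proof -
  have "op q u x = op q u y" if "\<tau> x = \<tau> y" for x y
    unfolding op_def using invarD[OF invar_pow[OF assms] that] by simp
  then show ?thesis unfolding invar_def by blast
qed

lemma P_zero: "P (\<lambda>x. 0) = (\<lambda>x. 0)"
  using linear[of 0 "\<lambda>x. 0" 0 "\<lambda>x. 0"] by simp

lemma P_sum: "finite K \<Longrightarrow> P (\<lambda>x. \<Sum>k\<in>K. c k * u k x) = (\<lambda>x. \<Sum>k\<in>K. c k * P (u k) x)"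
proof (induction K rule: finite_induct)
  case empty
  then show ?case by (simp add: P_zero)
next
  case (insert k K)
  then show ?case using linear[of "c k" "u k" 1 "\<lambda>x. \<Sum>k\<in>K. c k * u k x"] by simp
qed

lemma op_upto:
  assumes "degree q \<le> N"
  shows "op q u x = (\<Sum>k\<le>N. coeff q k * (P ^^ k) u x)"
  unfolding op_def using assms
  by (intro sum.mono_neutral_left) (auto simp: coeff_eq_0)

lemma op_pCons: "op (pCons a q) u = (\<lambda>x. a * u x + P (op q u) x)"
proof
  fix x
  have "op (pCons a q) u x = (\<Sum>k\<le>Suc (degree q). coeff (pCons a q) k * (P ^^ k) u x)"
    by (rule op_upto) (rule degree_pCons_le)
  also have "\<dots> = a * u x + (\<Sum>k\<le>degree q. coeff q k * P ((P ^^ k) u) x)"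
    by (subst sum.atMost_Suc_shift) simp
  also have "(\<Sum>k\<le>degree q. coeff q k * P ((P ^^ k) u) x) = P (op q u) x"
    using P_sum[of "{..degree q}" "coeff q" "\<lambda>k. (P ^^ k) u"] unfolding op_def[abs_def] by simp
  finally show "op (pCons a q) u x = a * u x + P (op q u) x" .
qed

lemma op_zero: "op 0 u = (\<lambda>x. 0)"
  by (rule ext) (simp add: op_def)

lemma op_add: "op (p + q) u = (\<lambda>x. op p u x + op q u x)"
proof
  fix x
  let ?N = "max (degree p) (degree q)"
  show "op (p + q) u x = op p u x + op q u x"
    using op_upto[of "p + q" ?N u x] op_upto[of p ?N u x] op_upto[of q ?N u x] degree_add_le_max[of p q]
    by (simp add: distrib_right sum.distrib)
qed

lemma op_smult: "op (smult a q) u = (\<lambda>x. a * op q u x)"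
proof
  fix x
  show "op (smult a q) u x = a * op q u x"
    using op_upto[of "smult a q" "degree q" u x] op_upto[of q "degree q" u x] degree_smult_le[of a q]
    by (simp add: sum_distrib_left mult.assoc)
qed

lemma op_mult: "op (p * q) u = op p (op q u)"
proof (induction p)
  case 0
  then show ?case by (simp add: op_zero)
next
  case (pCons a p)
  then show ?case by (simp add: op_add op_smult op_pCons)
qed

lemma op_linear_factor: "op [:-1, 1:] u = (\<lambda>x. P u x - u x)"
proof -
  have "op [:1:] u = u" by (simp add: op_pCons op_zero P_zero)
  then show ?thesis by (simp add: op_pCons[of "-1"])
qed

lemma pow_of_fixed_increment:
  assumes "P (\<lambda>x. P u x - u x) = (\<lambda>x. P u x - u x)"
  shows "(P ^^ n) u = (\<lambda>x. u x + real n * (P u x - u x))"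
proof (induction n)
  case (Suc n)
  have "(P ^^ Suc n) u = (\<lambda>x. P u x + real n * (P u x - u x))"
    using linear[of 1 u "real n" "\<lambda>x. P u x - u x"] assms Suc by simp
  then show ?case by (simp add: algebra_simps)
qed simp

text \<open>Power boundedness excludes nontrivial Jordan blocks at the eigenvalue \<open>1\<close>.\<close>

lemma op_linear_factor_power_kernel:
  assumes u: "invar u" and z: "op ([:-1, 1:] ^ e) u = (\<lambda>x. 0)"
  shows "P u = u \<or> e = 0 \<and> u = (\<lambda>x. 0)"
  using z
proof (induction e)
  case 0
  then show ?case by (simp add: one_pCons op_pCons op_zero P_zero)
next
  case (Suc e)
  define y where "y = op ([:-1, 1:] ^ (e - 1)) u"
  show ?case
  proof (cases e)
    case 0
    then have "op [:-1, 1:] u = (\<lambda>x. 0)" using Suc.prems by simp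
    then show ?thesis unfolding op_linear_factor by (auto simp: fun_eq_iff)
  next
    case (Suc e')
    have iy: "invar y" unfolding y_def by (rule invar_op[OF u])
    have dy: "op ([:-1, 1:] ^ e) u = (\<lambda>x. P y x - y x)"
      unfolding Suc y_def power_Suc op_mult op_linear_factor diff_Suc_1 ..
    have "op ([:-1, 1:] ^ Suc e) u = (\<lambda>x. P (\<lambda>x. P y x - y x) x - (P y x - y x))"
      unfolding power_Suc[of _ e] op_mult[of _ "_ ^ e"] dy op_linear_factor ..
    then have "(\<lambda>x. P (\<lambda>x. P y x - y x) x - (P y x - y x)) = (\<lambda>x. 0)" using Suc.prems by simp
    then have "P (\<lambda>x. P y x - y x) = (\<lambda>x. P y x - y x)" by (auto simp: fun_eq_iff)
    note pow = pow_of_fixed_increment[OF this]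
    have "P y x - y x = 0" for x
    proof (rule ccontr)
      assume ne: "P y x - y x \<noteq> 0"
      obtain C where C: "\<And>n. \<bar>(P ^^ n) y x\<bar> \<le> C"
        using power_bounded[of y x] iy unfolding invar_def by blast
      obtain n where n: "real n * \<bar>P y x - y x\<bar> > C + \<bar>y x\<bar>"
        using reals_Archimedean3[of "\<bar>P y x - y x\<bar>"] ne by auto
      have "real n * \<bar>P y x - y x\<bar> = \<bar>real n * (P y x - y x)\<bar>" by (simp add: abs_mult)
      then show False using C[of n] n unfolding pow by linarith
    qed
    then have "op ([:-1, 1:] ^ e) u = (\<lambda>x. 0)" using dy by simp
    then show ?thesis using Suc.IH Suc by auto
  qed
qed

text \<open>Some nonzero polynomial in \<open>P\<close> annihilates \<open>f\<close>. Write it as a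
  power of X - 1 times \<open>r\<close>, with \<open>a = r(1)\<close> nonzero. Power boundedness
  makes \<open>r(P) f\<close> a fixed vector, and division of \<open>r\<close> by X - 1 with
  remainder \<open>a\<close> expresses \<open>f\<close> by this fixed vector and a
  coboundary.\<close>

lemma mean_ergodic_decomposition:
  assumes f: "invar f"
  obtains E h where "invar E" "invar h" "P E = E" "\<And>x. f x = E x + h x - P h x"
proof -
  define rep where "rep t = (SOME x. \<tau> x = t)" for t
  have rep: "\<tau> (rep (\<tau> x)) = \<tau> x" for x
    unfolding rep_def by (rule someI[of _ x]) simp
  let ?K = "{..card (range \<tau>)}"
  have "\<exists>c. (\<exists>k\<in>?K. c k \<noteq> 0) \<and> (\<forall>t\<in>range \<tau>. (\<Sum>k\<in>?K. c k * (P ^^ k) f (rep t)) = 0)"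
    by (rule linear_dependence) (use finite_types in auto)
  then obtain c k0 where c: "k0 \<in> ?K" "c k0 \<noteq> 0" "\<And>t. t \<in> range \<tau> \<Longrightarrow> (\<Sum>k\<in>?K. c k * (P ^^ k) f (rep t)) = 0"
    by blast
  define q where "q = (\<Sum>k\<in>?K. monom (c k) k)"
  have coeff_q: "coeff q k = (if k \<in> ?K then c k else 0)" for k
    unfolding q_def coeff_sum coeff_monom by (simp add: sum.delta)
  have "degree q \<le> card (range \<tau>)" by (rule degree_le) (auto simp: coeff_q)
  then have "op q f x = (\<Sum>k\<in>?K. c k * (P ^^ k) f x)" for x
    by (simp add: op_upto coeff_q)
  moreover have "(\<Sum>k\<in>?K. c k * (P ^^ k) f x) = (\<Sum>k\<in>?K. c k * (P ^^ k) f (rep (\<tau> x)))" for x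
    by (intro sum.cong refl arg_cong2[where f = "(*)"] invarD[OF invar_pow[OF f]]) (simp add: rep)
  ultimately have q0: "op q f = (\<lambda>x. 0)" using c(3) by auto
  have qnz: "q \<noteq> 0" using c(1,2) coeff_q[of k0] by auto
  obtain r where r: "q = [:-1, 1:] ^ order 1 q * r" "\<not> [:-1, 1:] dvd r"
    using order_decomp[OF qnz, of 1] by blast
  define a where "a = poly r 1"
  have a: "a \<noteq> 0" using r(2) unfolding a_def by (simp add: poly_eq_0_iff_dvd)
  have "op ([:-1, 1:] ^ order 1 q) (op r f) = (\<lambda>x. 0)" using q0 r(1) op_mult by metis
  then have PE: "P (op r f) = op r f"
    using op_linear_factor_power_kernel[OF invar_op[OF f]] P_zero by metis
  define t where "t = synthetic_div r 1"
  have "r = [:-1, 1:] * t + [:a:]" unfolding t_def a_def by (rule synthetic_div_correct'[symmetric])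
  then have "op r f = (\<lambda>x. op [:-1, 1:] (op t f) x + op [:a:] f x)"
    using op_add[of "[:-1, 1:] * t" "[:a:]" f] unfolding op_mult by metis
  then have rf: "op r f x = P (op t f) x - op t f x + a * f x" for x
    by (simp add: op_linear_factor op_pCons[of a] op_zero P_zero)
  define E where "E x = op r f x / a" for x
  define h where "h x = op t f x / a" for x
  have scale: "P (\<lambda>x. u x / a) = (\<lambda>x. P u x / a)" for u
    using linear[of "1 / a" u 0 u] by simp
  show ?thesis
  proof (rule that[of E h])
    show "invar E" "invar h"
      unfolding E_def h_def invar_def by (metis invarD[OF invar_op[OF f]])+
    show "P E = E" unfolding E_def scale PE ..
    show "f x = E x + h x - P h x" for x
      unfolding E_def h_def scale rf using a by (simp add: field_simps)
  qed
qed

end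

section \<open>Weights in a tree with finitely many types\<close>

primrec desc :: "('v \<Rightarrow> 'v set) \<Rightarrow> nat \<Rightarrow> 'v \<Rightarrow> 'v set" where
  "desc ch 0 x = {x}"
| "desc ch (Suc n) x = (\<Union>g\<in>desc ch n x. ch g)"

text \<open>Types determine the types of the children and the increments towards them. By iteration
  they determine the whole subtree with its increments.\<close>

locale typed_tree =
  fixes ch :: "'v \<Rightarrow> 'v set" and \<tau> :: "'v \<Rightarrow> 't" and \<phi> :: "'v \<Rightarrow> real" and lam A :: real
  assumes finite_types: "finite (range \<tau>)"
    and finite_ch: "finite (ch x)"
    and children_iso: "\<tau> x = \<tau> y \<Longrightarrow>
      \<exists>\<beta>. bij_betw \<beta> (ch x) (ch y) \<and> (\<forall>c\<in>ch x. \<tau> (\<beta> c) = \<tau> c \<and> \<phi> (\<beta> c) - \<phi> y = \<phi> c - \<phi> x)"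
    and ch_disjoint: "x \<noteq> y \<Longrightarrow> ch x \<inter> ch y = {}"
    and lam_ge_1: "lam \<ge> 1"
    and growth: "real (card (desc ch n x)) \<le> A * lam ^ n"
begin

definition P :: "('v \<Rightarrow> real) \<Rightarrow> 'v \<Rightarrow> real" where
  "P u x = (\<Sum>c\<in>ch x. u c) / lam"

definition type_inv :: "('v \<Rightarrow> real) \<Rightarrow> bool" where
  "type_inv u \<longleftrightarrow> (\<forall>x y. \<tau> x = \<tau> y \<longrightarrow> u x = u y)"

lemma type_invD: "type_inv u \<Longrightarrow> \<tau> x = \<tau> y \<Longrightarrow> u x = u y"
  unfolding type_inv_def by blast

lemma lam_pos: "lam > 0" and lam_pow_pos: "lam ^ n > 0"
  using lam_ge_1 by auto

lemma lam_nonzero [simp]: "lam \<noteq> 0"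
  using lam_pos by simp

lemma A_ge_1: "A \<ge> 1"
  using growth[of 0 undefined] by simp

lemma finite_desc: "finite (desc ch n x)"
  by (induction n) (auto simp: finite_ch)

lemma sum_desc_Suc:
  fixes u :: "'v \<Rightarrow> real"
  shows "(\<Sum>g\<in>desc ch (Suc n) x. u g) = (\<Sum>g\<in>desc ch n x. \<Sum>c\<in>ch g. u c)"
  unfolding desc.simps
  by (rule sum.UNION_disjoint) (auto simp: finite_desc finite_ch ch_disjoint)

lemma P_pow: "(P ^^ n) u x = (\<Sum>g\<in>desc ch n x. u g) / lam ^ n"
proof (induction n arbitrary: u)
  case (Suc n)
  have "(P ^^ Suc n) u x = (P ^^ n) (P u) x" by (simp only: funpow_Suc_right o_apply)
  also have "\<dots> = (\<Sum>g\<in>desc ch (Suc n) x. u g) / lam ^ Suc n"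
    unfolding Suc sum_desc_Suc P_def by (simp add: sum_divide_distrib[symmetric])
  finally show ?case .
qed simp

lemma type_inv_finite_range:
  assumes "\<And>x y. \<tau> x = \<tau> y \<Longrightarrow> u x = u y"
  shows "finite (range u)"
proof -
  define s where "s t = u (SOME x. \<tau> x = t)" for t
  have "u x = s (\<tau> x)" for x
    unfolding s_def by (rule assms, rule someI2[of _ x]) auto
  then have "range u \<subseteq> s ` range \<tau>" by blast
  then show ?thesis using finite_types finite_surj by blast
qed

lemma type_inv_bounded:
  fixes u :: "'v \<Rightarrow> real"
  assumes "type_inv u"
  obtains C where "C \<ge> 0" "\<And>x. \<bar>u x\<bar> \<le> C"
proof -
  have fin: "finite (range u)" using assms by (intro type_inv_finite_range type_invD)
  show ?thesis
  proof (rule that[of "Max ((\<lambda>y. \<bar>y\<bar>) ` range u)"])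
    show b: "\<bar>u x\<bar> \<le> Max ((\<lambda>y. \<bar>y\<bar>) ` range u)" for x using fin by (intro Max_ge) auto
    show "0 \<le> Max ((\<lambda>y. \<bar>y\<bar>) ` range u)" by (rule order_trans[OF abs_ge_zero b[of undefined]])
  qed
qed

lemma type_inv_sum_children:
  assumes "type_inv u" "\<tau> x = \<tau> y"
  shows "(\<Sum>c\<in>ch x. u c) = (\<Sum>c\<in>ch y. u c)"
    "(\<Sum>c\<in>ch x. u c * (\<phi> c - \<phi> x)) = (\<Sum>c\<in>ch y. u c * (\<phi> c - \<phi> y))"
proof -
  obtain \<beta> where \<beta>: "bij_betw \<beta> (ch x) (ch y)" "\<And>c. c \<in> ch x \<Longrightarrow> \<tau> (\<beta> c) = \<tau> c"
    "\<And>c. c \<in> ch x \<Longrightarrow> \<phi> (\<beta> c) - \<phi> y = \<phi> c - \<phi> x"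
    using children_iso[OF assms(2)] by blast
  have u: "u (\<beta> c) = u c" if "c \<in> ch x" for c using type_invD[OF assms(1)] \<beta>(2)[OF that] by blast
  show "(\<Sum>c\<in>ch x. u c) = (\<Sum>c\<in>ch y. u c)"
    using sum.reindex_bij_betw[OF \<beta>(1), of u] u by simp
  show "(\<Sum>c\<in>ch x. u c * (\<phi> c - \<phi> x)) = (\<Sum>c\<in>ch y. u c * (\<phi> c - \<phi> y))"
    using sum.reindex_bij_betw[OF \<beta>(1), of "\<lambda>c. u c * (\<phi> c - \<phi> y)"] u \<beta>(3) by simp
qed

lemma type_inv_mult: "type_inv u \<Longrightarrow> type_inv w \<Longrightarrow> type_inv (\<lambda>x. u x * w x)"
  unfolding type_inv_def by metis

lemma type_inv_const: "type_inv (\<lambda>x. a)"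
  by (simp add: type_inv_def)

text \<open>Power boundedness is where the upper growth bound enters: \<open>P ^^ n\<close> sums
  over at most \<open>A * lam ^ n\<close> descendants and divides by \<open>lam ^ n\<close>.\<close>

sublocale counting: bounded_operator P \<tau>
proof
  fix u :: "'v \<Rightarrow> real" and x
  assume u: "\<And>x y. \<tau> x = \<tau> y \<Longrightarrow> u x = u y"
  then have "type_inv u" unfolding type_inv_def by blast
  then obtain C where C: "C \<ge> 0" "\<And>x. \<bar>u x\<bar> \<le> C" using type_inv_bounded by blast
  have "\<bar>(P ^^ n) u x\<bar> \<le> A * C" for n
  proof -
    have "\<bar>\<Sum>g\<in>desc ch n x. u g\<bar> \<le> (\<Sum>g\<in>desc ch n x. C)"
      by (rule order_trans[OF sum_abs sum_mono]) (rule C(2))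
    also have "\<dots> = real (card (desc ch n x)) * C" by simp
    also have "\<dots> \<le> A * lam ^ n * C" by (rule mult_right_mono[OF growth C(1)])
    finally show ?thesis unfolding P_pow abs_divide using lam_pow_pos[of n]
      by (simp add: divide_le_eq mult_ac)
  qed
  then show "\<exists>C. \<forall>n. \<bar>(P ^^ n) u x\<bar> \<le> C" by blast
next
  fix u :: "'v \<Rightarrow> real" and x y
  assume u: "\<And>x y. \<tau> x = \<tau> y \<Longrightarrow> u x = u y" and xy: "\<tau> x = \<tau> y"
  then have "type_inv u" unfolding type_inv_def by blast
  then show "P u x = P u y" unfolding P_def using type_inv_sum_children(1)[OF _ xy] by simp
next
  show "P (\<lambda>x. a * u x + b * w x) = (\<lambda>x. a * P u x + b * P w x)" for a b u w
    by (rule ext) (simp add: P_def sum.distrib sum_distrib_left[symmetric] add_divide_distrib)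
qed (rule finite_types)

lemma counting_inv: "counting.invar u \<longleftrightarrow> type_inv u"
  by (simp add: counting.invar_def type_inv_def)

text \<open>\<open>wt x\<close> is the Cesaro limit of \<open>card (desc ch n x) / lam ^ n\<close>.\<close>

definition weight_pair :: "('v \<Rightarrow> real) \<Rightarrow> ('v \<Rightarrow> real) \<Rightarrow> bool" where
  "weight_pair v h \<longleftrightarrow> type_inv v \<and> type_inv h \<and> P v = v \<and> (\<forall>x. 1 = v x + h x - P h x)"

definition wt :: "'v \<Rightarrow> real" where "wt = fst (SOME (v, h). weight_pair v h)"

definition wt_rest :: "'v \<Rightarrow> real" where "wt_rest = snd (SOME (v, h). weight_pair v h)"

lemma weight_pair_wt: "weight_pair wt wt_rest"
proof -
  obtain v h where "type_inv v" "type_inv h" "P v = v" "\<And>x. (1::real) = v x + h x - P h x"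
    using counting.mean_ergodic_decomposition[of "\<lambda>x. 1"] unfolding counting_inv
    using type_inv_const by blast
  then have "\<exists>p. case p of (v, h) \<Rightarrow> weight_pair v h" unfolding weight_pair_def by blast
  then show ?thesis unfolding wt_def wt_rest_def by (metis (mono_tags, lifting) someI_ex case_prod_beta')
qed

lemma wt_inv: "type_inv wt" and P_wt: "P wt = wt"
  using weight_pair_wt by (auto simp: weight_pair_def)

lemma wt_children: "(\<Sum>c\<in>ch x. wt c) = lam * wt x"
  using fun_cong[OF P_wt, of x] lam_pos by (simp add: P_def field_simps)

lemma wt_desc: "(\<Sum>g\<in>desc ch n x. wt g) = lam ^ n * wt x"
proof -
  have "(P ^^ n) wt = wt" by (induction n) (simp_all add: P_wt)
  then have "(\<Sum>g\<in>desc ch n x. wt g) / lam ^ n = wt x" using P_pow[of n wt x] by simp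
  then show ?thesis by (simp add: field_simps)
qed

text \<open>The decomposition of the constant 1 into \<open>wt\<close> and the coboundary of
  \<open>wt_rest\<close> telescopes, and the remainder stays bounded. Only averages are controlled
  this way, since single terms may oscillate periodically.\<close>

lemma counting_partial_sums:
  "\<exists>H\<ge>0. \<forall>n x. \<bar>(\<Sum>k<n. real (card (desc ch k x)) / lam ^ k) - real n * wt x\<bar> \<le> H"
proof -
  have inv: "type_inv wt_rest" and eq: "\<And>x. 1 = wt x + wt_rest x - P wt_rest x"
    using weight_pair_wt by (auto simp: weight_pair_def)
  obtain C where C: "C \<ge> 0" "\<And>x. \<bar>wt_rest x\<bar> \<le> C" using type_inv_bounded[OF inv] by blast
  have b: "\<bar>(P ^^ n) wt_rest x\<bar> \<le> A * C" for n x
  proof -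
    have "\<bar>\<Sum>g\<in>desc ch n x. wt_rest g\<bar> \<le> (\<Sum>g\<in>desc ch n x. C)"
      by (rule order_trans[OF sum_abs sum_mono]) (rule C(2))
    also have "\<dots> = real (card (desc ch n x)) * C" by simp
    also have "\<dots> \<le> A * lam ^ n * C" by (rule mult_right_mono[OF growth C(1)])
    finally show ?thesis unfolding P_pow abs_divide using lam_pow_pos[of n]
      by (simp add: divide_le_eq mult_ac)
  qed
  have step: "real (card (desc ch k x)) / lam ^ k = wt x + (P ^^ k) wt_rest x - (P ^^ Suc k) wt_rest x" for k x
  proof -
    have "real (card (desc ch k x)) = (\<Sum>g\<in>desc ch k x. 1)" by simp
    also have "\<dots> = (\<Sum>g\<in>desc ch k x. wt g + wt_rest g - P wt_rest g)" using eq by simp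
    also have "\<dots> = lam ^ k * wt x + (\<Sum>g\<in>desc ch k x. wt_rest g) - (\<Sum>g\<in>desc ch k x. P wt_rest g)"
      by (simp add: sum.distrib sum_subtractf wt_desc)
    finally have "real (card (desc ch k x)) / lam ^ k
        = wt x + (P ^^ k) wt_rest x - (P ^^ k) (P wt_rest) x"
      unfolding P_pow by (simp add: add_divide_distrib diff_divide_distrib)
    then show ?thesis by (simp only: funpow_Suc_right o_apply)
  qed
  have tel: "(\<Sum>k<n. real (card (desc ch k x)) / lam ^ k) = real n * wt x + (wt_rest x - (P ^^ n) wt_rest x)" for n x
    by (induction n) (simp_all add: step algebra_simps)
  have "\<bar>(\<Sum>k<n. real (card (desc ch k x)) / lam ^ k) - real n * wt x\<bar> \<le> C + A * C" for n x
    using tel[of x n] b[of n x] C(2)[of x] by linarith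
  then show ?thesis using C(1) A_ge_1 by (intro exI[of _ "C + A * C"]) auto
qed

lemma archimedean_bound:
  fixes a :: real
  assumes "\<And>n::nat. real n * a \<le> C"
  shows "a \<le> 0"
proof (rule ccontr)
  assume "\<not> a \<le> 0"
  then obtain n where "C < real n * a" using reals_Archimedean3[of a] by auto
  then show False using assms[of n] by simp
qed

lemma wt_nonneg: "wt x \<ge> 0"
proof -
  obtain H where H: "\<And>n x. \<bar>(\<Sum>k<n. real (card (desc ch k x)) / lam ^ k) - real n * wt x\<bar> \<le> H"
    using counting_partial_sums by blast
  have "real n * (- wt x) \<le> H" for n
  proof -
    have "0 \<le> (\<Sum>k<n. real (card (desc ch k x)) / lam ^ k)"
      using lam_pos by (intro sum_nonneg) auto
    then show ?thesis using H[of x n] by simp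
  qed
  then show ?thesis using archimedean_bound[of "- wt x" H] by simp
qed

lemma wt_pos:
  assumes "\<And>n. lam ^ n \<le> real (card (desc ch n x))"
  shows "wt x > 0"
proof -
  obtain H where H: "\<And>n x. \<bar>(\<Sum>k<n. real (card (desc ch k x)) / lam ^ k) - real n * wt x\<bar> \<le> H"
    using counting_partial_sums by blast
  have "real n * (1 - wt x) \<le> H" for n
  proof -
    have "(\<Sum>k<n. 1) \<le> (\<Sum>k<n. real (card (desc ch k x)) / lam ^ k)"
      using assms lam_pow_pos by (intro sum_mono) (simp add: le_divide_eq)
    then show ?thesis using H[of x n] by (simp add: algebra_simps abs_le_iff)
  qed
  then show ?thesis using archimedean_bound[of "1 - wt x" H] by simp
qed

lemma wt_zero_child: "wt x = 0 \<Longrightarrow> c \<in> ch x \<Longrightarrow> wt c = 0"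
  using wt_children[of x] sum_nonneg_eq_0_iff[OF finite_ch[of x], of wt] wt_nonneg by simp

lemma wt_zero_desc: "wt x = 0 \<Longrightarrow> g \<in> desc ch n x \<Longrightarrow> wt g = 0"
  by (induction n arbitrary: g) (auto intro: wt_zero_child)

lemma wt_bounds:
  obtains W w where "W > 0" "w > 0" "\<And>x. wt x \<le> W" "\<And>x. wt x > 0 \<Longrightarrow> w \<le> wt x"
proof -
  obtain C where C: "C \<ge> 0" "\<And>x. \<bar>wt x\<bar> \<le> C" using type_inv_bounded[OF wt_inv] by blast
  have fin: "finite (range wt)" using wt_inv by (intro type_inv_finite_range type_invD)
  define w where "w = Min (insert 1 {y \<in> range wt. y > 0})"
  have "w > 0" unfolding w_def using fin by (subst Min_gr_iff) auto
  moreover have "w \<le> wt x" if "wt x > 0" for x unfolding w_def using fin that by (intro Min_le) auto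
  moreover have "wt x \<le> C + 1" for x using C(2)[of x] by linarith
  ultimately show ?thesis using C(1) by (intro that[of "C + 1" w]) auto
qed

lemma card_desc_ge:
  obtains \<kappa> where "\<kappa> > 0" "\<And>n x. \<kappa> * wt x * lam ^ n \<le> real (card (desc ch n x))"
proof -
  obtain W where W: "W > 0" "\<And>x. wt x \<le> W" using wt_bounds by metis
  have "1 / W * wt x * lam ^ n \<le> real (card (desc ch n x))" for n x
  proof -
    have "lam ^ n * wt x \<le> (\<Sum>g\<in>desc ch n x. W)" unfolding wt_desc[symmetric] by (intro sum_mono W(2))
    then show ?thesis using W(1) by (simp add: divide_le_eq mult_ac)
  qed
  then show ?thesis using W(1) by (intro that[of "1 / W"]) auto
qed

text \<open>\<open>U x\<close> is the sum of \<open>card (desc ch k x) / lam ^ k\<close> over all \<open>k\<close>, so that \<open>P U = U - 1\<close>.\<close>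

lemma light_potential:
  obtains U :: "'v \<Rightarrow> real" and B \<theta> where "0 < \<theta>" "\<theta> < 1" "B \<ge> 1"
    "\<And>x. wt x = 0 \<Longrightarrow> 1 \<le> U x" "\<And>x. wt x = 0 \<Longrightarrow> U x \<le> B"
    "\<And>x. wt x = 0 \<Longrightarrow> (\<Sum>c\<in>ch x. U c) \<le> \<theta> * lam * U x"
proof -
  obtain H where H0: "H \<ge> 0" and
    H: "\<And>n x. \<bar>(\<Sum>k<n. real (card (desc ch k x)) / lam ^ k) - real n * wt x\<bar> \<le> H"
    using counting_partial_sums by blast
  define N where "N k x = (P ^^ k) (\<lambda>x. 1) x" for k x
  have N: "N k x = real (card (desc ch k x)) / lam ^ k" for k x unfolding N_def P_pow by simp
  have N0: "N k x \<ge> 0" for k x unfolding N using lam_pos by simp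
  have part: "(\<Sum>k<n. N k x) \<le> H" if "wt x = 0" for n x
    using H[where x = x and n = n] that unfolding N by simp
  define U where "U x = (\<Sum>k. N k x)" for x
  have summ: "summable (\<lambda>k. N k x)" if "wt x = 0" for x
    by (rule bounded_imp_summable[of _ H]) (use N0 part[OF that, of "Suc _"] in \<open>simp_all add: lessThan_Suc_atMost\<close>)
  have UH: "U x \<le> H" if "wt x = 0" for x
    unfolding U_def using summ[OF that] part[OF that] by (rule suminf_le_const)
  have PU: "P U x = U x - 1" if "wt x = 0" for x
  proof -
    have "(\<Sum>c\<in>ch x. U c) = (\<Sum>k. \<Sum>c\<in>ch x. N k c)"
      unfolding U_def using wt_zero_child[OF that] by (intro suminf_sum[symmetric] summ)
    also have "\<dots> = (\<Sum>k. lam * N (Suc k) x)"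
      by (intro suminf_cong) (use lam_pos in \<open>simp add: N_def P_def\<close>)
    also have "\<dots> = lam * (U x - N 0 x)"
      unfolding U_def suminf_split_head[OF summ[OF that], symmetric]
      by (rule suminf_mult) (rule iffD2[OF summable_Suc_iff summ[OF that]])
    finally show ?thesis by (simp add: P_def N_def)
  qed
  \<comment> \<open>As \<open>B\<close> bounds \<open>U\<close>, the loss of 1 in
    \<open>P U = U - 1\<close> is at least the proportion \<open>1 / B\<close> of \<open>U\<close>.
    The summand 2 keeps the contraction factor positive.\<close>
  define B where "B = H + 2"
  have B: "B \<ge> 2" using H0 by (simp add: B_def)
  show ?thesis
  proof (rule that[of "1 - 1 / B" B U])
    show "0 < 1 - 1 / B" "1 - 1 / B < 1" "B \<ge> 1" using B by (auto simp: field_simps)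
    fix x assume x: "wt x = 0"
    have "(\<Sum>k<1. N k x) \<le> U x" unfolding U_def by (rule sum_le_suminf[OF summ[OF x]]) (auto simp: N0)
    then show "1 \<le> U x" by (simp add: N)
    show UB: "U x \<le> B" using UH[OF x] by (simp add: B_def)
    have "(\<Sum>c\<in>ch x. U c) = lam * (U x - 1)" using PU[OF x] lam_pos by (simp add: P_def field_simps)
    also have "\<dots> \<le> lam * (U x - U x / B)" using UB B lam_pos by (intro mult_left_mono) (auto simp: divide_le_eq)
    finally show "(\<Sum>c\<in>ch x. U c) \<le> (1 - 1 / B) * lam * U x" by (simp add: algebra_simps)
  qed
qed

end

section \<open>Second moments along the weighted Markov chain\<close>

lemma square_split_le:
  fixes a b \<eta> :: real
  assumes "\<eta> > 0"
  shows "(a + b)\<^sup>2 \<le> (1 + \<eta>) * a\<^sup>2 + (1 + 1 / \<eta>) * b\<^sup>2"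
proof -
  have "0 \<le> (\<eta> * a - b)\<^sup>2 / \<eta>" using assms by simp
  also have "\<dots> = \<eta> * a\<^sup>2 + b\<^sup>2 / \<eta> - 2 * a * b"
    using assms by (simp add: power2_eq_square field_simps)
  finally show ?thesis by (simp add: power2_eq_square algebra_simps)
qed

lemma square_sum_le:
  fixes a b :: real
  shows "(a + b)\<^sup>2 \<le> 2 * a\<^sup>2 + 2 * b\<^sup>2"
  using square_split_le[of 1 a b] by simp

lemma square_le_of_abs_le:
  fixes a b :: real
  shows "\<bar>a\<bar> \<le> b \<Longrightarrow> a\<^sup>2 \<le> b\<^sup>2"
  by (metis abs_ge_zero order_trans power2_abs power_mono)

text \<open>A bounded increasing \<open>s\<close> gains at most \<open>\<epsilon> / 4\<close> after
  some index \<open>M\<close>. The quadratic terms therefore add up to at most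
  \<open>\<epsilon> / 2\<close> times n^2, and all other contributions are linear. It is applied to
  the second moment of the deviation as \<open>q\<close> and that of the mean as
  \<open>s\<close>.\<close>

lemma subquadratic_growth:
  fixes q s :: "nat \<Rightarrow> real"
  assumes step: "\<And>n. q (Suc n) \<le> q n + D + 2 * (real n)\<^sup>2 * (s (Suc n) - s n)"
    and mono: "\<And>n. s n \<le> s (Suc n)" and bdd: "\<And>n. s n \<le> C" and D: "D \<ge> 0" and e: "\<epsilon> > 0"
  shows "\<exists>N. \<forall>n\<ge>N. q n \<le> \<epsilon> * (real n)\<^sup>2"
proof -
  have incs: "incseq s" using mono by (intro incseq_SucI)
  then obtain l where l: "s \<longlonglongrightarrow> l" "\<And>i. s i \<le> l"
    using incseq_convergent[of s C] bdd by blast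
  obtain M where M: "\<And>n. n \<ge> M \<Longrightarrow> l - \<epsilon> / 4 < s n"
    using order_tendstoD(1)[OF l(1), of "l - \<epsilon> / 4"] e unfolding eventually_sequentially by auto
  have ind: "q n \<le> q M + D * real n + 2 * (real n)\<^sup>2 * (s n - s M)" if "n \<ge> M" for n
    using that
  proof (induction n rule: dec_induct)
    case (step n)
    have "2 * (real n)\<^sup>2 * (s (Suc n) - s M) \<le> 2 * (real (Suc n))\<^sup>2 * (s (Suc n) - s M)"
      using incseqD[OF incs, of M "Suc n"] step(1) by (intro mult_right_mono) (auto intro: power_mono)
    then show ?case using step(3) assms(1)[of n] by (simp add: algebra_simps)
  qed (use D in simp)
  obtain N1 where N1: "real N1 \<ge> 4 * (\<bar>q M\<bar> + D) / \<epsilon>" using real_arch_simple by blast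
  have "q n \<le> \<epsilon> * (real n)\<^sup>2" if n: "n \<ge> max M (N1 + 1)" for n
  proof -
    have n1: "real n \<ge> 1" "real n \<ge> real N1" using n by auto
    have "4 * (\<bar>q M\<bar> + D) \<le> \<epsilon> * real N1" using N1 e by (simp add: divide_le_eq mult.commute)
    also have "\<dots> \<le> \<epsilon> * real n" using n1 e by simp
    finally have "(\<bar>q M\<bar> + D) * real n \<le> \<epsilon> / 4 * real n * real n"
      using n1 by (intro mult_right_mono) auto
    moreover have "q M + D * real n \<le> (\<bar>q M\<bar> + D) * real n"
      using mult_left_mono[OF n1(1), of "\<bar>q M\<bar>"] by (simp add: algebra_simps)
    moreover have "2 * (real n)\<^sup>2 * (s n - s M) \<le> 2 * (real n)\<^sup>2 * (\<epsilon> / 4)"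
      using l(2)[of n] M[of M] by (intro mult_left_mono) auto
    moreover have "\<epsilon> / 4 * real n * real n = \<epsilon> / 4 * (real n)\<^sup>2"
      "2 * (real n)\<^sup>2 * (\<epsilon> / 4) = \<epsilon> / 2 * (real n)\<^sup>2"
      by (simp_all add: power2_eq_square)
    ultimately have "q n \<le> \<epsilon> / 4 * (real n)\<^sup>2 + \<epsilon> / 2 * (real n)\<^sup>2"
      using ind[of n] n by linarith
    also have "\<dots> \<le> \<epsilon> * (real n)\<^sup>2" using e by (simp add: algebra_simps)
    finally show ?thesis .
  qed
  then show ?thesis by blast
qed

lemma chebyshev_card:
  fixes f :: "'i \<Rightarrow> real"
  assumes "finite F" "t \<ge> 0"
  shows "real (card {g \<in> F. t \<le> \<bar>f g\<bar>}) * t\<^sup>2 \<le> (\<Sum>g\<in>F. (f g)\<^sup>2)"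
proof -
  have "real (card {g \<in> F. t \<le> \<bar>f g\<bar>}) * t\<^sup>2 = (\<Sum>g\<in>{g \<in> F. t \<le> \<bar>f g\<bar>}. t\<^sup>2)" by simp
  also have "\<dots> \<le> (\<Sum>g\<in>{g \<in> F. t \<le> \<bar>f g\<bar>}. (f g)\<^sup>2)"
    using assms(2) by (intro sum_mono) (auto simp: abs_le_square_iff[symmetric])
  also have "\<dots> \<le> (\<Sum>g\<in>F. (f g)\<^sup>2)" using assms(1) by (intro sum_mono2) auto
  finally show ?thesis .
qed

lemma eventually_linear_ge:
  fixes c t :: real
  assumes "t > 0"
  obtains N :: nat where "\<And>n. n \<ge> N \<Longrightarrow> c \<le> t * real n"
proof -
  obtain N :: nat where N: "real N \<ge> c / t" using real_arch_simple by blast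
  have "c \<le> t * real n" if "n \<ge> N" for n
  proof -
    have "c / t \<le> real n" using N that by simp
    then show ?thesis using assms by (simp add: divide_le_eq mult.commute)
  qed
  then show ?thesis using that by blast
qed

context typed_tree
begin

text \<open>The Doob transform of \<open>P\<close> by the harmonic function \<open>wt\<close>, a
  Markov operator on vertices of positive weight. At weight 0 the division yields 0, so
  \<open>Pw E = E\<close> forces \<open>E\<close> to vanish there.\<close>

definition Pw :: "('v \<Rightarrow> real) \<Rightarrow> 'v \<Rightarrow> real" where
  "Pw u x = (\<Sum>c\<in>ch x. wt c * u c) / (lam * wt x)"

definition drift :: "'v \<Rightarrow> real" where
  "drift x = (\<Sum>c\<in>ch x. wt c * (\<phi> c - \<phi> x)) / (lam * wt x)"

lemma Pw_bound:
  assumes "\<And>x. \<bar>u x\<bar> \<le> C"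
  shows "\<bar>Pw u x\<bar> \<le> C"
proof (cases "wt x = 0")
  case True
  then show ?thesis using assms[of x] by (simp add: Pw_def)
next
  case False
  then have pos: "lam * wt x > 0" using wt_nonneg[of x] lam_pos by simp
  have "\<bar>\<Sum>c\<in>ch x. wt c * u c\<bar> \<le> (\<Sum>c\<in>ch x. wt c * C)"
    by (rule order_trans[OF sum_abs sum_mono])
       (use assms wt_nonneg in \<open>auto simp: abs_mult intro!: mult_left_mono\<close>)
  also have "\<dots> = C * (lam * wt x)" by (simp add: sum_distrib_right[symmetric] wt_children)
  finally show ?thesis unfolding Pw_def abs_divide using pos by (simp add: divide_le_eq)
qed

sublocale weighted: bounded_operator Pw \<tau>
proof
  fix u :: "'v \<Rightarrow> real" and x
  assume "\<And>x y. \<tau> x = \<tau> y \<Longrightarrow> u x = u y"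
  then have "type_inv u" unfolding type_inv_def by blast
  then obtain C where C: "\<And>x. \<bar>u x\<bar> \<le> C" using type_inv_bounded by blast
  have "\<forall>x. \<bar>(Pw ^^ n) u x\<bar> \<le> C" for n by (induction n) (simp_all add: C Pw_bound)
  then show "\<exists>C. \<forall>n. \<bar>(Pw ^^ n) u x\<bar> \<le> C" by blast
next
  fix u :: "'v \<Rightarrow> real" and x y
  assume "\<And>x y. \<tau> x = \<tau> y \<Longrightarrow> u x = u y" and xy: "\<tau> x = \<tau> y"
  then have "type_inv u" unfolding type_inv_def by blast
  then show "Pw u x = Pw u y"
    unfolding Pw_def using type_inv_sum_children(1)[OF type_inv_mult[OF wt_inv] xy] type_invD[OF wt_inv xy] by simp
next
  show "Pw (\<lambda>x. a * u x + b * w x) = (\<lambda>x. a * Pw u x + b * Pw w x)" for a b u w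
    by (rule ext)
       (simp add: Pw_def sum.distrib sum_distrib_left add_divide_distrib distrib_left mult.left_commute)
qed (rule finite_types)

lemma weighted_inv: "weighted.invar u \<longleftrightarrow> type_inv u"
  by (simp add: weighted.invar_def type_inv_def)

lemma drift_inv: "type_inv drift"
  unfolding type_inv_def drift_def
  using type_inv_sum_children(2)[OF wt_inv] type_invD[OF wt_inv] by metis

definition drift_pair :: "('v \<Rightarrow> real) \<Rightarrow> ('v \<Rightarrow> real) \<Rightarrow> bool" where
  "drift_pair E h \<longleftrightarrow> type_inv E \<and> type_inv h \<and> Pw E = E \<and> (\<forall>x. drift x = E x + h x - Pw h x)"

lemma drift_pair_ex: "\<exists>E h. drift_pair E h"
  using weighted.mean_ergodic_decomposition[of drift] drift_inv
  unfolding weighted_inv drift_pair_def by metis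

lemma weighted_sum_children: "(\<Sum>c\<in>ch x. wt c * u c) = lam * wt x * Pw u x"
  by (cases "wt x = 0") (simp_all add: Pw_def wt_zero_child)

lemma drift_sum_children: "(\<Sum>c\<in>ch x. wt c * (\<phi> c - \<phi> x)) = lam * wt x * drift x"
  by (cases "wt x = 0") (simp_all add: drift_def wt_zero_child)

lemma increment_bound:
  obtains D where "D \<ge> 0" "\<And>x c. c \<in> ch x \<Longrightarrow> \<bar>\<phi> c - \<phi> x\<bar> \<le> D"
proof -
  define u where "u x = (\<Sum>c\<in>ch x. \<bar>\<phi> c - \<phi> x\<bar>)" for x
  have "type_inv u"
    unfolding type_inv_def
  proof (intro allI impI)
    fix x y assume "\<tau> x = \<tau> y"
    then obtain \<beta> where \<beta>: "bij_betw \<beta> (ch x) (ch y)" "\<And>c. c \<in> ch x \<Longrightarrow> \<phi> (\<beta> c) - \<phi> y = \<phi> c - \<phi> x"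
      using children_iso by blast
    show "u x = u y"
      unfolding u_def using sum.reindex_bij_betw[OF \<beta>(1), of "\<lambda>c. \<bar>\<phi> c - \<phi> y\<bar>"] \<beta>(2) by simp
  qed
  then obtain C where C: "C \<ge> 0" "\<And>x. \<bar>u x\<bar> \<le> C" using type_inv_bounded by blast
  have "\<bar>\<phi> c - \<phi> x\<bar> \<le> C" if "c \<in> ch x" for c x
  proof -
    have "\<bar>\<phi> c - \<phi> x\<bar> \<le> u x"
      unfolding u_def using that by (intro member_le_sum) (auto simp: finite_ch)
    then show ?thesis using C(2)[of x] by linarith
  qed
  then show ?thesis using that C(1) by blast
qed

text \<open>The process \<open>\<phi> g - n * E g + h g\<close> on the descendants of \<open>x\<close> at depth \<open>n\<close> is a martingale for the
  Markov chain with transition probabilities \<open>wt c / (lam * wt g)\<close>.\<close>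

definition moment :: "('v \<Rightarrow> real) \<Rightarrow> ('v \<Rightarrow> real) \<Rightarrow> 'v \<Rightarrow> nat \<Rightarrow> real" where
  "moment E h x n =
     (\<Sum>g\<in>desc ch n x. wt g * (\<phi> g - \<phi> x - real n * E g + h g)\<^sup>2) / lam ^ n"

definition mean_moment :: "('v \<Rightarrow> real) \<Rightarrow> 'v \<Rightarrow> nat \<Rightarrow> real" where
  "mean_moment E x n = (\<Sum>g\<in>desc ch n x. wt g * (E g)\<^sup>2) / lam ^ n"

text \<open>\<open>E\<close> is a martingale for the weighted chain, so its conditional variance is
  the gain of its second moment. As \<open>E\<close> is bounded, all these gains together stay
  bounded.\<close>

lemma mean_variance_children:
  assumes "drift_pair E h"
  shows "(\<Sum>c\<in>ch g. wt c * (E c - E g)\<^sup>2) = (\<Sum>c\<in>ch g. wt c * (E c)\<^sup>2) - lam * (wt g * (E g)\<^sup>2)"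
proof -
  have PE: "Pw E g = E g" using assms by (simp add: drift_pair_def)
  have "(\<Sum>c\<in>ch g. wt c * (E c - E g)\<^sup>2)
      = (\<Sum>c\<in>ch g. wt c * (E c)\<^sup>2 + (E g)\<^sup>2 * wt c - 2 * E g * (wt c * E c))"
    by (intro sum.cong refl) (simp add: power2_eq_square algebra_simps)
  also have "\<dots> = (\<Sum>c\<in>ch g. wt c * (E c)\<^sup>2) + (E g)\<^sup>2 * (\<Sum>c\<in>ch g. wt c)
      - 2 * E g * (\<Sum>c\<in>ch g. wt c * E c)"
    by (simp add: sum.distrib sum_subtractf sum_distrib_left)
  finally show ?thesis
    unfolding wt_children weighted_sum_children PE by (simp add: power2_eq_square algebra_simps)
qed

lemma mean_moment_mono:
  assumes "drift_pair E h"
  shows "mean_moment E x n \<le> mean_moment E x (Suc n)"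
proof -
  have "lam * (\<Sum>g\<in>desc ch n x. wt g * (E g)\<^sup>2) \<le> (\<Sum>g\<in>desc ch (Suc n) x. wt g * (E g)\<^sup>2)"
    unfolding sum_desc_Suc sum_distrib_left
  proof (rule sum_mono)
    fix g
    have "0 \<le> (\<Sum>c\<in>ch g. wt c * (E c - E g)\<^sup>2)" using wt_nonneg by (intro sum_nonneg) auto
    then show "lam * (wt g * (E g)\<^sup>2) \<le> (\<Sum>c\<in>ch g. wt c * (E c)\<^sup>2)"
      unfolding mean_variance_children[OF assms] by simp
  qed
  then show ?thesis
    unfolding mean_moment_def using lam_pow_pos[of n] lam_pos by (simp add: field_simps)
qed

lemma mean_moment_bounded:
  assumes "drift_pair E h"
  obtains C where "\<And>n. mean_moment E x n \<le> C"
proof -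
  obtain C where C: "C \<ge> 0" "\<And>x. \<bar>E x\<bar> \<le> C" using type_inv_bounded assms unfolding drift_pair_def by metis
  have "mean_moment E x n \<le> C\<^sup>2 * wt x" for n
  proof -
    have "(\<Sum>g\<in>desc ch n x. wt g * (E g)\<^sup>2) \<le> (\<Sum>g\<in>desc ch n x. wt g * C\<^sup>2)"
      by (intro sum_mono mult_left_mono square_le_of_abs_le C wt_nonneg)
    also have "\<dots> = C\<^sup>2 * wt x * lam ^ n"
      unfolding sum_distrib_right[symmetric] wt_desc by (simp add: mult_ac)
    finally show ?thesis unfolding mean_moment_def using lam_pow_pos[of n] by (simp add: divide_le_eq)
  qed
  then show ?thesis using that by blast
qed

text \<open>The martingale increment \<Delta> has weighted mean 0, so the cross term drops out. It
  is the sum of a part bounded by \<open>D\<close> and of \<open>real n\<close> times the change of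
  \<open>E\<close>, and the second part contributes n^2 times the gain in the second moment of
  \<open>E\<close>.\<close>

lemma moment_children:
  assumes dp: "drift_pair E h"
    and D: "\<And>c. c \<in> ch g \<Longrightarrow> \<bar>\<phi> c - \<phi> g - E c + h c - h g\<bar> \<le> D"
  shows "(\<Sum>c\<in>ch g. wt c * (\<phi> c - a - real (Suc n) * E c + h c)\<^sup>2)
    \<le> lam * (wt g * (\<phi> g - a - real n * E g + h g)\<^sup>2) + lam * wt g * (2 * D\<^sup>2)
       + 2 * (real n)\<^sup>2 * ((\<Sum>c\<in>ch g. wt c * (E c)\<^sup>2) - lam * (wt g * (E g)\<^sup>2))"
proof -
  define y where "y = \<phi> g - a - real n * E g + h g"
  define \<Delta> where "\<Delta> c = \<phi> c - \<phi> g - E c + h c - h g - real n * (E c - E g)" for c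
  have PE: "Pw E g = E g" and dr: "drift g = E g + h g - Pw h g" using dp by (simp_all add: drift_pair_def)
  have "(\<Sum>c\<in>ch g. wt c * \<Delta> c) = (\<Sum>c\<in>ch g. wt c * (\<phi> c - \<phi> g) + wt c * h c
      - (1 + real n) * (wt c * E c) + (real n * E g - h g) * wt c)"
    by (intro sum.cong refl) (simp add: \<Delta>_def algebra_simps)
  also have "\<dots> = (\<Sum>c\<in>ch g. wt c * (\<phi> c - \<phi> g)) + (\<Sum>c\<in>ch g. wt c * h c)
      - (1 + real n) * (\<Sum>c\<in>ch g. wt c * E c) + (real n * E g - h g) * (\<Sum>c\<in>ch g. wt c)"
    by (simp add: sum.distrib sum_subtractf sum_distrib_left)
  also have "\<dots> = 0"
    unfolding wt_children drift_sum_children unfolding weighted_sum_children PE dr by (simp add: algebra_simps)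
  finally have zero: "(\<Sum>c\<in>ch g. wt c * \<Delta> c) = 0" .
  have "(\<Sum>c\<in>ch g. wt c * (\<phi> c - a - real (Suc n) * E c + h c)\<^sup>2)
      = (\<Sum>c\<in>ch g. wt c * (y + \<Delta> c)\<^sup>2)"
    by (intro sum.cong refl arg_cong2[where f = "(*)"] arg_cong[where f = "\<lambda>t. t\<^sup>2"])
       (simp add: y_def \<Delta>_def algebra_simps)
  also have "\<dots> = (\<Sum>c\<in>ch g. y\<^sup>2 * wt c + 2 * y * (wt c * \<Delta> c) + wt c * (\<Delta> c)\<^sup>2)"
    by (intro sum.cong refl) (simp add: power2_eq_square algebra_simps)
  also have "\<dots> = y\<^sup>2 * (\<Sum>c\<in>ch g. wt c) + 2 * y * (\<Sum>c\<in>ch g. wt c * \<Delta> c) + (\<Sum>c\<in>ch g. wt c * (\<Delta> c)\<^sup>2)"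
    by (simp add: sum.distrib sum_distrib_left)
  also have "\<dots> = lam * (wt g * y\<^sup>2) + (\<Sum>c\<in>ch g. wt c * (\<Delta> c)\<^sup>2)"
    unfolding zero wt_children by simp
  also have "(\<Sum>c\<in>ch g. wt c * (\<Delta> c)\<^sup>2)
      \<le> (\<Sum>c\<in>ch g. (2 * D\<^sup>2) * wt c + 2 * (real n)\<^sup>2 * (wt c * (E c - E g)\<^sup>2))"
  proof (rule sum_mono)
    fix c assume c: "c \<in> ch g"
    have "(\<Delta> c)\<^sup>2 \<le> 2 * (\<phi> c - \<phi> g - E c + h c - h g)\<^sup>2 + 2 * (- (real n * (E c - E g)))\<^sup>2"
      unfolding \<Delta>_def using square_sum_le[of "\<phi> c - \<phi> g - E c + h c - h g" "- (real n * (E c - E g))"] by simp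
    also have "\<dots> \<le> 2 * D\<^sup>2 + 2 * (real n)\<^sup>2 * (E c - E g)\<^sup>2"
      using square_le_of_abs_le[OF D[OF c]] by (simp add: power_mult_distrib)
    finally have "wt c * (\<Delta> c)\<^sup>2 \<le> wt c * (2 * D\<^sup>2 + 2 * (real n)\<^sup>2 * (E c - E g)\<^sup>2)"
      using wt_nonneg by (intro mult_left_mono)
    then show "wt c * (\<Delta> c)\<^sup>2 \<le> (2 * D\<^sup>2) * wt c + 2 * (real n)\<^sup>2 * (wt c * (E c - E g)\<^sup>2)"
      by (simp add: algebra_simps)
  qed
  also have "\<dots> = (2 * D\<^sup>2) * (\<Sum>c\<in>ch g. wt c) + 2 * (real n)\<^sup>2 * (\<Sum>c\<in>ch g. wt c * (E c - E g)\<^sup>2)"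
    by (simp add: sum.distrib sum_distrib_left)
  finally show ?thesis
    unfolding wt_children mean_variance_children[OF dp] y_def by (simp add: mult_ac)
qed

lemma moment_step:
  assumes dp: "drift_pair E h"
  obtains D where "D \<ge> 0"
    "\<And>x n. moment E h x (Suc n) \<le> moment E h x n + D + 2 * (real n)\<^sup>2 * (mean_moment E x (Suc n) - mean_moment E x n)"
proof -
  obtain D1 where D1: "D1 \<ge> 0" "\<And>x c. c \<in> ch x \<Longrightarrow> \<bar>\<phi> c - \<phi> x\<bar> \<le> D1" using increment_bound by blast
  obtain CE where CE: "CE \<ge> 0" "\<And>x. \<bar>E x\<bar> \<le> CE" using type_inv_bounded dp unfolding drift_pair_def by metis
  obtain Ch where Ch: "Ch \<ge> 0" "\<And>x. \<bar>h x\<bar> \<le> Ch" using type_inv_bounded dp unfolding drift_pair_def by metis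
  obtain W where W: "W > 0" "\<And>x. wt x \<le> W" using wt_bounds by metis
  define D where "D = D1 + CE + 2 * Ch"
  have D: "\<bar>\<phi> c - \<phi> g - E c + h c - h g\<bar> \<le> D" if "c \<in> ch g" for c g
    using D1(2)[OF that] CE(2)[of c] Ch(2)[of c] Ch(2)[of g] unfolding D_def by linarith
  have "moment E h x (Suc n) \<le> moment E h x n + W * (2 * D\<^sup>2)
      + 2 * (real n)\<^sup>2 * (mean_moment E x (Suc n) - mean_moment E x n)" for x n
  proof -
    let ?Q = "\<lambda>n. \<Sum>g\<in>desc ch n x. wt g * (\<phi> g - \<phi> x - real n * E g + h g)\<^sup>2"
    let ?S = "\<lambda>n. \<Sum>g\<in>desc ch n x. wt g * (E g)\<^sup>2"
    have "?Q (Suc n) \<le> (\<Sum>g\<in>desc ch n x. lam * (wt g * (\<phi> g - \<phi> x - real n * E g + h g)\<^sup>2)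
        + lam * wt g * (2 * D\<^sup>2) + 2 * (real n)\<^sup>2 * ((\<Sum>c\<in>ch g. wt c * (E c)\<^sup>2) - lam * (wt g * (E g)\<^sup>2)))"
      unfolding sum_desc_Suc by (intro sum_mono moment_children[OF dp] D)
    also have "\<dots> = lam * ?Q n + 2 * D\<^sup>2 * lam * (\<Sum>g\<in>desc ch n x. wt g) + 2 * (real n)\<^sup>2 * (?S (Suc n) - lam * ?S n)"
      unfolding sum_desc_Suc[of "\<lambda>g. wt g * (E g)\<^sup>2"]
      by (simp add: sum.distrib sum_subtractf sum_distrib_left right_diff_distrib mult_ac)
    also have "\<dots> \<le> lam * ?Q n + 2 * D\<^sup>2 * lam * (lam ^ n * W) + 2 * (real n)\<^sup>2 * (?S (Suc n) - lam * ?S n)"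
      unfolding wt_desc using W lam_pos by (intro add_mono mult_left_mono order_refl) auto
    finally have "?Q (Suc n) / lam ^ Suc n
        \<le> (lam * ?Q n + 2 * D\<^sup>2 * lam * (lam ^ n * W) + 2 * (real n)\<^sup>2 * (?S (Suc n) - lam * ?S n)) / lam ^ Suc n"
      by (rule divide_right_mono) (rule less_imp_le[OF lam_pow_pos])
    also have "\<dots> = ?Q n / lam ^ n + W * (2 * D\<^sup>2) + 2 * (real n)\<^sup>2 * (?S (Suc n) / lam ^ Suc n - ?S n / lam ^ n)"
      by (simp add: add_divide_distrib diff_divide_distrib right_diff_distrib)
    finally show ?thesis unfolding moment_def mean_moment_def .
  qed
  then show ?thesis using that[of "W * (2 * D\<^sup>2)"] W(1) by simp
qed

lemma weighted_moment_le:
  assumes dp: "drift_pair E h"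
  obtains C where "C \<ge> 0" "\<And>x n. (\<Sum>g\<in>desc ch n x. wt g * (\<phi> g - \<phi> x - real n * E g)\<^sup>2)
      \<le> (2 * moment E h x n + C) * lam ^ n"
proof -
  obtain Ch where Ch: "Ch \<ge> 0" "\<And>x. \<bar>h x\<bar> \<le> Ch" using type_inv_bounded dp unfolding drift_pair_def by metis
  obtain W where W: "W > 0" "\<And>x. wt x \<le> W" using wt_bounds by metis
  have "(\<Sum>g\<in>desc ch n x. wt g * (\<phi> g - \<phi> x - real n * E g)\<^sup>2)
      \<le> (2 * moment E h x n + W * (2 * Ch\<^sup>2)) * lam ^ n" for x n
  proof -
    have "(\<Sum>g\<in>desc ch n x. wt g * (\<phi> g - \<phi> x - real n * E g)\<^sup>2)
        \<le> (\<Sum>g\<in>desc ch n x. 2 * (wt g * (\<phi> g - \<phi> x - real n * E g + h g)\<^sup>2) + 2 * Ch\<^sup>2 * wt g)"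
    proof (rule sum_mono)
      fix g
      have "(\<phi> g - \<phi> x - real n * E g)\<^sup>2 \<le> 2 * (\<phi> g - \<phi> x - real n * E g + h g)\<^sup>2 + 2 * (- h g)\<^sup>2"
        using square_sum_le[of "\<phi> g - \<phi> x - real n * E g + h g" "- h g"] by simp
      also have "\<dots> \<le> 2 * (\<phi> g - \<phi> x - real n * E g + h g)\<^sup>2 + 2 * Ch\<^sup>2"
        using square_le_of_abs_le[OF Ch(2)[of g]] by simp
      finally have "wt g * (\<phi> g - \<phi> x - real n * E g)\<^sup>2
          \<le> wt g * (2 * (\<phi> g - \<phi> x - real n * E g + h g)\<^sup>2 + 2 * Ch\<^sup>2)"
        using wt_nonneg by (intro mult_left_mono)
      then show "wt g * (\<phi> g - \<phi> x - real n * E g)\<^sup>2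
          \<le> 2 * (wt g * (\<phi> g - \<phi> x - real n * E g + h g)\<^sup>2) + 2 * Ch\<^sup>2 * wt g"
        by (simp add: algebra_simps)
    qed
    also have "\<dots> = 2 * (moment E h x n * lam ^ n) + 2 * Ch\<^sup>2 * (lam ^ n * wt x)"
      by (simp add: sum.distrib sum_distrib_left[symmetric] wt_desc moment_def)
    also have "\<dots> \<le> 2 * (moment E h x n * lam ^ n) + 2 * Ch\<^sup>2 * (lam ^ n * W)"
      using W lam_pow_pos[of n] by (intro add_mono mult_left_mono order_refl) auto
    finally show ?thesis by (simp add: algebra_simps)
  qed
  then show ?thesis using that[of "W * (2 * Ch\<^sup>2)"] W(1) by simp
qed

text \<open>A weak law of large numbers available while \<open>E\<close> may still vary. It is the
  tool for proving later that it does not.\<close>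

lemma weighted_deviation_subquadratic:
  assumes dp: "drift_pair E h" and e: "\<epsilon> > 0"
  shows "\<exists>N. \<forall>n\<ge>N. (\<Sum>g\<in>desc ch n x. wt g * (\<phi> g - \<phi> x - real n * E g)\<^sup>2) \<le> \<epsilon> * (real n)\<^sup>2 * lam ^ n"
proof -
  obtain D where D: "D \<ge> 0"
    "\<And>x n. moment E h x (Suc n) \<le> moment E h x n + D + 2 * (real n)\<^sup>2 * (mean_moment E x (Suc n) - mean_moment E x n)"
    using moment_step[OF dp] by blast
  obtain C where C: "\<And>n. mean_moment E x n \<le> C" using mean_moment_bounded[OF dp] by blast
  obtain N where N: "\<And>n. n \<ge> N \<Longrightarrow> moment E h x n \<le> \<epsilon> / 4 * (real n)\<^sup>2"
    using subquadratic_growth[OF D(2) mean_moment_mono[OF dp] C D(1), of "\<epsilon> / 4"] e by auto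
  obtain K where K: "K \<ge> 0" "\<And>x n. (\<Sum>g\<in>desc ch n x. wt g * (\<phi> g - \<phi> x - real n * E g)\<^sup>2)
      \<le> (2 * moment E h x n + K) * lam ^ n"
    using weighted_moment_le[OF dp] by blast
  obtain N1 where N1: "real N1 \<ge> 2 * K / \<epsilon>" using real_arch_simple by blast
  have "(\<Sum>g\<in>desc ch n x. wt g * (\<phi> g - \<phi> x - real n * E g)\<^sup>2) \<le> \<epsilon> * (real n)\<^sup>2 * lam ^ n"
    if n: "n \<ge> max N (N1 + 1)" for n
  proof -
    have n1: "real n \<ge> 1" "real n \<ge> real N1" using n by auto
    have "2 * K \<le> \<epsilon> * real N1" using N1 e by (simp add: divide_le_eq mult.commute)
    also have "\<dots> \<le> \<epsilon> * (real n)\<^sup>2"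
      using n1 e mult_mono[OF n1(2) n1(1)] by (simp add: power2_eq_square)
    finally have "2 * moment E h x n + K \<le> \<epsilon> * (real n)\<^sup>2" using N[of n] n by simp
    then show ?thesis using K(2)[of x n] lam_pow_pos[of n] by (meson less_imp_le mult_right_mono order_trans)
  qed
  then show ?thesis by blast
qed

lemma linear_recursion_bound:
  fixes t :: "nat \<Rightarrow> real"
  assumes "0 \<le> \<theta>" "\<theta> < 1" "C \<ge> 0" "\<And>n. t (Suc n) \<le> \<theta> * t n + C * (real n + 1)"
  obtains K where "K \<ge> 0" "\<And>n. t n \<le> K * (real n + 1)"
proof -
  define K where "K = max \<bar>t 0\<bar> (C / (1 - \<theta>))"
  have K0: "K \<ge> 0" by (simp add: K_def le_max_iff_disj)
  have "C / (1 - \<theta>) \<le> K" by (simp add: K_def)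
  then have CK: "C \<le> (1 - \<theta>) * K" using assms(2) by (simp add: divide_le_eq mult.commute)
  have "t n \<le> K * (real n + 1)" for n
  proof (induction n)
    case 0
    then show ?case by (simp add: K_def)
  next
    case (Suc n)
    have "C * (real n + 1) \<le> (1 - \<theta>) * K * (real n + 1)" using CK by (intro mult_right_mono) auto
    then have "t (Suc n) \<le> \<theta> * (K * (real n + 1)) + (1 - \<theta>) * K * (real n + 1)"
      using assms(4)[of n] mult_left_mono[OF Suc assms(1)] by linarith
    also have "\<dots> = K * (real n + 1)" by (simp add: algebra_simps)
    also have "\<dots> \<le> K * (real (Suc n) + 1)" using K0 by (intro mult_left_mono) auto
    finally show ?case .
  qed
  then show ?thesis using that K0 by blast
qed

text \<open>Light descendants are left out because a fixed vector of \<open>Pw\<close> is 0 on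
  them.\<close>

definition constant_below :: "('v \<Rightarrow> real) \<Rightarrow> 'v \<Rightarrow> real \<Rightarrow> bool" where
  "constant_below E x e \<longleftrightarrow> (\<forall>n. \<forall>g\<in>desc ch n x. wt g > 0 \<longrightarrow> E g = e)"

text \<open>For a constant mean the quantity \<open>mean_moment\<close> is stationary, so the
  quadratic term in the recursion for \<open>moment\<close> disappears. The least positive weight
  turns the weighted sum into an unweighted one.\<close>

lemma heavy_deviation_linear:
  assumes dp: "drift_pair E h" and const: "constant_below E x e"
  obtains C where "C \<ge> 0" "\<And>n. (\<Sum>g\<in>desc ch n x. if wt g > 0 then (\<phi> g - \<phi> x - real n * e)\<^sup>2 else 0)
      \<le> C * (real n + 1) * lam ^ n"
proof -
  obtain D where D: "D \<ge> 0"
    "\<And>x n. moment E h x (Suc n) \<le> moment E h x n + D + 2 * (real n)\<^sup>2 * (mean_moment E x (Suc n) - mean_moment E x n)"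
    using moment_step[OF dp] by blast
  have "mean_moment E x n = e\<^sup>2 * wt x" for n
  proof -
    have "(\<Sum>g\<in>desc ch n x. wt g * (E g)\<^sup>2) = (\<Sum>g\<in>desc ch n x. wt g * e\<^sup>2)"
      using const wt_nonneg unfolding constant_below_def
      by (intro sum.cong refl) (metis less_eq_real_def mult_zero_left)
    then show ?thesis
      unfolding mean_moment_def by (simp add: sum_distrib_right[symmetric] wt_desc)
  qed
  then have step: "moment E h x (Suc n) \<le> moment E h x n + D" for n using D(2)[of x n] by simp
  have m: "moment E h x n \<le> moment E h x 0 + real n * D" for n
  proof (induction n)
    case (Suc n)
    then show ?case using step[of n] by (simp add: algebra_simps)
  qed simp
  obtain K where K: "K \<ge> 0" "\<And>x n. (\<Sum>g\<in>desc ch n x. wt g * (\<phi> g - \<phi> x - real n * E g)\<^sup>2)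
      \<le> (2 * moment E h x n + K) * lam ^ n"
    using weighted_moment_le[OF dp] by blast
  obtain w where w: "w > 0" "\<And>x. wt x > 0 \<Longrightarrow> w \<le> wt x" using wt_bounds by metis
  define C where "C = (2 * \<bar>moment E h x 0\<bar> + 2 * D + K) / w"
  have "(\<Sum>g\<in>desc ch n x. if wt g > 0 then (\<phi> g - \<phi> x - real n * e)\<^sup>2 else 0)
      \<le> C * (real n + 1) * lam ^ n" for n
  proof -
    have "w * (\<Sum>g\<in>desc ch n x. if wt g > 0 then (\<phi> g - \<phi> x - real n * e)\<^sup>2 else 0)
        \<le> (\<Sum>g\<in>desc ch n x. wt g * (\<phi> g - \<phi> x - real n * E g)\<^sup>2)"
      unfolding sum_distrib_left
      by (intro sum_mono)
         (use const w wt_nonneg in \<open>auto simp: constant_below_def intro!: mult_right_mono\<close>)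
    also have "\<dots> \<le> (2 * moment E h x n + K) * lam ^ n" by (rule K)
    also have "\<dots> \<le> (w * C * (real n + 1)) * lam ^ n"
    proof (rule mult_right_mono)
      have "(2 * \<bar>moment E h x 0\<bar> + 2 * D + K) * (real n + 1) = 2 * \<bar>moment E h x 0\<bar> + 2 * D + K
          + 2 * (real n * \<bar>moment E h x 0\<bar>) + 2 * (real n * D) + real n * K"
        by (simp add: algebra_simps)
      moreover have "real n * \<bar>moment E h x 0\<bar> \<ge> 0" "real n * K \<ge> 0" using K(1) by simp_all
      ultimately have "2 * moment E h x n + K \<le> (2 * \<bar>moment E h x 0\<bar> + 2 * D + K) * (real n + 1)"
        using m[of n] D(1) by linarith
      then show "2 * moment E h x n + K \<le> w * C * (real n + 1)" using w(1) by (simp add: C_def)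
    qed (use lam_pos in simp)
    finally have "w * (\<Sum>g\<in>desc ch n x. if wt g > 0 then (\<phi> g - \<phi> x - real n * e)\<^sup>2 else 0)
        \<le> w * (C * (real n + 1) * lam ^ n)" by (simp only: mult.assoc)
    then show ?thesis using w(1) by (rule mult_left_le_imp_le)
  qed
  moreover have "C \<ge> 0" using w(1) K(1) D(1) by (simp add: C_def)
  ultimately show ?thesis using that by blast
qed

text \<open>Multiplied by the potential \<open>U\<close>, the squared deviation contracts in passing
  from light vertices to their children, up to an arbitrarily small loss from expanding the square.
  Heavy vertices feed in an amount that is already known to be linear, so the total grows linearly
  as well.\<close>

lemma light_deviation_linear:
  assumes heavy: "\<And>n. (\<Sum>g\<in>desc ch n x. if wt g > 0 then (\<phi> g - \<phi> x - real n * e)\<^sup>2 else 0)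
      \<le> C * (real n + 1) * lam ^ n" and C: "C \<ge> 0"
  obtains K where "K \<ge> 0" "\<And>n. (\<Sum>g\<in>desc ch n x. if wt g = 0 then (\<phi> g - \<phi> x - real n * e)\<^sup>2 else 0)
      \<le> K * (real n + 1) * lam ^ n"
proof -
  obtain U B \<theta> where U: "0 < \<theta>" "\<theta> < 1" "B \<ge> 1"
    "\<And>x. wt x = 0 \<Longrightarrow> 1 \<le> U x" "\<And>x. wt x = 0 \<Longrightarrow> U x \<le> B"
    "\<And>x. wt x = 0 \<Longrightarrow> (\<Sum>c\<in>ch x. U c) \<le> \<theta> * lam * U x"
    using light_potential by metis
  obtain D1 where D1: "D1 \<ge> 0" "\<And>x c. c \<in> ch x \<Longrightarrow> \<bar>\<phi> c - \<phi> x\<bar> \<le> D1" using increment_bound by blast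
  define D where "D = D1 + \<bar>e\<bar>"
  define a where "a n g = \<phi> g - \<phi> x - real n * e" for n g
  have step: "\<bar>a (Suc n) c - a n g\<bar> \<le> D" if "c \<in> ch g" for c g n
    using D1(2)[OF that] unfolding a_def D_def by (simp add: algebra_simps)
  \<comment> \<open>Chosen so that \<open>\<theta> * (1 + \<eta>)\<close> is the midpoint between
    \<theta> and 1: expanding the square uses up half of the available contraction.\<close>
  define \<eta> where "\<eta> = (1 - \<theta>) / (2 * \<theta>)"
  have \<eta>: "\<eta> > 0" using U(1,2) by (simp add: \<eta>_def)
  have \<theta>': "\<theta> * (1 + \<eta>) = (1 + \<theta>) / 2" using U(1) by (simp add: \<eta>_def field_simps)
  define L where "L = (1 + 1 / \<eta>) * D\<^sup>2"
  have L: "L \<ge> 0" using \<eta> by (simp add: L_def)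
  define F where "F n g = (if wt g = 0 then U g * (a n g)\<^sup>2 else 0)" for n g
  define H where "H n g = (if wt g > 0 then (a n g)\<^sup>2 else 0)" for n g
  have H0: "H n g \<ge> 0" for n g by (simp add: H_def)
  have F0: "F n g \<ge> 0" for n g using U(4)[of g] by (auto simp: F_def)
  have cardch: "real (card (ch g)) \<le> A * lam" for g using growth[of 1 g] by simp
  have rec: "(\<Sum>c\<in>ch g. F (Suc n) c) \<le> (1 + \<theta>) / 2 * lam * F n g
      + 2 * A * B * lam * H n g + (\<theta> * lam * B * L + 2 * A * B * lam * D\<^sup>2)" for n g
  proof (cases "wt g = 0")
    case True
    have "(\<Sum>c\<in>ch g. F (Suc n) c) \<le> (\<Sum>c\<in>ch g. U c * ((1 + \<eta>) * (a n g)\<^sup>2 + L))"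
    proof (rule sum_mono)
      fix c assume c: "c \<in> ch g"
      have "(a (Suc n) c)\<^sup>2 \<le> (1 + \<eta>) * (a n g)\<^sup>2 + (1 + 1 / \<eta>) * (a (Suc n) c - a n g)\<^sup>2"
        using square_split_le[OF \<eta>, of "a n g" "a (Suc n) c - a n g"] by simp
      also have "\<dots> \<le> (1 + \<eta>) * (a n g)\<^sup>2 + L"
        unfolding L_def using \<eta> by (intro add_left_mono mult_left_mono square_le_of_abs_le step[OF c]) auto
      finally show "F (Suc n) c \<le> U c * ((1 + \<eta>) * (a n g)\<^sup>2 + L)"
        using U(4)[OF wt_zero_child[OF True c]] wt_zero_child[OF True c]
        by (auto simp: F_def intro!: mult_left_mono)
    qed
    also have "\<dots> = (\<Sum>c\<in>ch g. U c) * ((1 + \<eta>) * (a n g)\<^sup>2 + L)" by (simp add: sum_distrib_right)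
    also have "\<dots> \<le> (\<theta> * lam * U g) * ((1 + \<eta>) * (a n g)\<^sup>2 + L)"
      using \<eta> L by (intro mult_right_mono U(6)[OF True]) auto
    also have "\<dots> = \<theta> * (1 + \<eta>) * lam * (U g * (a n g)\<^sup>2) + \<theta> * lam * U g * L" by (simp add: algebra_simps)
    also have "\<dots> \<le> (1 + \<theta>) / 2 * lam * F n g + \<theta> * lam * B * L"
      unfolding \<theta>' using True U(1) U(5)[OF True] L lam_pos
      by (auto simp: F_def intro!: mult_right_mono mult_left_mono)
    also have "\<dots> \<le> (1 + \<theta>) / 2 * lam * F n g
      + 2 * A * B * lam * H n g + (\<theta> * lam * B * L + 2 * A * B * lam * D\<^sup>2)"
      using A_ge_1 U(3) lam_pos H0 by simp
    finally show ?thesis .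
  next
    case False
    then have pos: "wt g > 0" using wt_nonneg[of g] by simp
    have "(\<Sum>c\<in>ch g. F (Suc n) c) \<le> (\<Sum>c\<in>ch g. B * (2 * H n g + 2 * D\<^sup>2))"
    proof (rule sum_mono)
      fix c assume c: "c \<in> ch g"
      have "(a (Suc n) c)\<^sup>2 \<le> 2 * (a n g)\<^sup>2 + 2 * (a (Suc n) c - a n g)\<^sup>2"
        using square_sum_le[of "a n g" "a (Suc n) c - a n g"] by simp
      also have "\<dots> \<le> 2 * H n g + 2 * D\<^sup>2"
        using square_le_of_abs_le[OF step[OF c]] pos by (simp add: H_def)
      finally have le: "(a (Suc n) c)\<^sup>2 \<le> 2 * H n g + 2 * D\<^sup>2" .
      show "F (Suc n) c \<le> B * (2 * H n g + 2 * D\<^sup>2)"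
      proof (cases "wt c = 0")
        case True
        then show ?thesis using U(3) U(4)[OF True] U(5)[OF True] le
          by (auto simp: F_def intro!: mult_mono)
      next
        case False
        then show ?thesis using U(3) H0[of n g] by (simp add: F_def)
      qed
    qed
    also have "\<dots> = real (card (ch g)) * (B * (2 * H n g + 2 * D\<^sup>2))" by simp
    also have "\<dots> \<le> A * lam * (B * (2 * H n g + 2 * D\<^sup>2))"
      using U(3) H0[of n g] by (intro mult_right_mono cardch) auto
    also have "\<dots> = 2 * A * B * lam * H n g + 2 * A * B * lam * D\<^sup>2" by (simp add: algebra_simps)
    also have "\<dots> \<le> (1 + \<theta>) / 2 * lam * F n g
      + 2 * A * B * lam * H n g + (\<theta> * lam * B * L + 2 * A * B * lam * D\<^sup>2)"
      using U(1,3) lam_pos L F0[of n g] by simp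
    finally show ?thesis .
  qed
  define t where "t n = (\<Sum>g\<in>desc ch n x. F n g) / lam ^ n" for n
  define M where "M = \<theta> * lam * B * L + 2 * A * B * lam * D\<^sup>2"
  have M: "M \<ge> 0" using U(1,3) L A_ge_1 lam_pos by (simp add: M_def)
  define R where "R = 2 * A * B * C + M * A / lam"
  have R: "R \<ge> 0" using U(3) A_ge_1 C M lam_pos by (simp add: R_def)
  have "t (Suc n) \<le> (1 + \<theta>) / 2 * t n + R * (real n + 1)" for n
  proof -
    have "(\<Sum>g\<in>desc ch (Suc n) x. F (Suc n) g)
        \<le> (\<Sum>g\<in>desc ch n x. (1 + \<theta>) / 2 * lam * F n g + 2 * A * B * lam * H n g + M)"
      unfolding sum_desc_Suc M_def by (intro sum_mono rec)
    also have "\<dots> = (1 + \<theta>) / 2 * lam * (\<Sum>g\<in>desc ch n x. F n g)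
        + 2 * A * B * lam * (\<Sum>g\<in>desc ch n x. H n g) + M * real (card (desc ch n x))"
      by (simp only: sum.distrib sum_distrib_left[symmetric] sum_constant) (simp add: mult.commute)
    also have "\<dots> \<le> (1 + \<theta>) / 2 * lam * (\<Sum>g\<in>desc ch n x. F n g)
        + 2 * A * B * lam * (C * (real n + 1) * lam ^ n) + M * (A * lam ^ n)"
      using heavy[of n] growth[of n x] A_ge_1 U(3) lam_pos M unfolding H_def a_def
      by (intro add_mono mult_left_mono order_refl) auto
    finally have "t (Suc n) \<le> ((1 + \<theta>) / 2 * lam * (\<Sum>g\<in>desc ch n x. F n g)
        + 2 * A * B * lam * (C * (real n + 1) * lam ^ n) + M * (A * lam ^ n)) / lam ^ Suc n"
      unfolding t_def using lam_pow_pos[of "Suc n"] by (intro divide_right_mono) auto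
    also have "\<dots> = (1 + \<theta>) / 2 * t n + 2 * A * B * C * (real n + 1) + M * A / lam"
      unfolding t_def by (simp add: add_divide_distrib mult_ac)
    also have "\<dots> \<le> (1 + \<theta>) / 2 * t n + 2 * A * B * C * (real n + 1) + M * A / lam * (real n + 1)"
      using M A_ge_1 lam_pos by (simp add: mult_le_cancel_left1 distrib_left)
    finally show ?thesis unfolding R_def by (simp add: distrib_right)
  qed
  then obtain K where K: "K \<ge> 0" "\<And>n. t n \<le> K * (real n + 1)"
    using linear_recursion_bound[of "(1 + \<theta>) / 2" R t] U(1,2) R by auto
  have "(\<Sum>g\<in>desc ch n x. if wt g = 0 then (\<phi> g - \<phi> x - real n * e)\<^sup>2 else 0)
      \<le> K * (real n + 1) * lam ^ n" for n
  proof -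
    have "(\<Sum>g\<in>desc ch n x. if wt g = 0 then (\<phi> g - \<phi> x - real n * e)\<^sup>2 else 0) \<le> (\<Sum>g\<in>desc ch n x. F n g)"
      unfolding F_def a_def using U(4) by (intro sum_mono) (auto simp: mult_le_cancel_right1)
    also have "\<dots> = t n * lam ^ n" by (simp add: t_def)
    also have "\<dots> \<le> K * (real n + 1) * lam ^ n" using lam_pow_pos[of n] by (intro mult_right_mono K) auto
    finally show ?thesis .
  qed
  then show ?thesis using that K(1) by blast
qed

lemma deviation_linear:
  assumes dp: "drift_pair E h" and const: "constant_below E x e"
  obtains C where "C \<ge> 0" "\<And>n. (\<Sum>g\<in>desc ch n x. (\<phi> g - \<phi> x - real n * e)\<^sup>2) \<le> C * (real n + 1) * lam ^ n"
proof -
  obtain C where C: "C \<ge> 0" "\<And>n. (\<Sum>g\<in>desc ch n x. if wt g > 0 then (\<phi> g - \<phi> x - real n * e)\<^sup>2 else 0)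
      \<le> C * (real n + 1) * lam ^ n"
    using heavy_deviation_linear[OF assms] by blast
  obtain K where K: "K \<ge> 0" "\<And>n. (\<Sum>g\<in>desc ch n x. if wt g = 0 then (\<phi> g - \<phi> x - real n * e)\<^sup>2 else 0)
      \<le> K * (real n + 1) * lam ^ n"
    using light_deviation_linear[OF C(2,1)] by blast
  have "(\<Sum>g\<in>desc ch n x. (\<phi> g - \<phi> x - real n * e)\<^sup>2) \<le> (C + K) * (real n + 1) * lam ^ n" for n
  proof -
    have "(\<Sum>g\<in>desc ch n x. (\<phi> g - \<phi> x - real n * e)\<^sup>2)
        = (\<Sum>g\<in>desc ch n x. (if wt g > 0 then (\<phi> g - \<phi> x - real n * e)\<^sup>2 else 0)
            + (if wt g = 0 then (\<phi> g - \<phi> x - real n * e)\<^sup>2 else 0))"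
      using wt_nonneg by (intro sum.cong refl) (auto simp: less_le)
    also have "\<dots> \<le> C * (real n + 1) * lam ^ n + K * (real n + 1) * lam ^ n"
      unfolding sum.distrib by (intro add_mono C K)
    finally show ?thesis by (simp add: algebra_simps)
  qed
  then show ?thesis using that[of "C + K"] C(1) K(1) by simp
qed

text \<open>The maximum principle: \<open>E x\<close> is a weighted average of values at the
  children, none of which exceeds it.\<close>

lemma harmonic_max_child:
  assumes PE: "Pw E = E" and max: "\<And>y. wt y > 0 \<Longrightarrow> E y \<le> E x" and c: "c \<in> ch x" "wt c > 0"
  shows "E c = E x"
proof -
  have "(\<Sum>c\<in>ch x. wt c * (E x - E c)) = E x * (\<Sum>c\<in>ch x. wt c) - (\<Sum>c\<in>ch x. wt c * E c)"
    by (simp add: right_diff_distrib sum_subtractf sum_distrib_right mult.commute[of "E x"])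
  also have "\<dots> = 0"
    unfolding wt_children weighted_sum_children PE by simp
  finally have z: "(\<Sum>c\<in>ch x. wt c * (E x - E c)) = 0" .
  have "wt c * (E x - E c) \<ge> 0" for c
    using max[of c] wt_nonneg[of c] by (cases "wt c = 0") auto
  then have "wt c * (E x - E c) = 0"
    using z sum_nonneg_eq_0_iff[OF finite_ch[of x], of "\<lambda>c. wt c * (E x - E c)"] c(1) by simp
  then show ?thesis using c(2) by simp
qed

lemma harmonic_max_desc:
  assumes PE: "Pw E = E" and max: "\<And>y. wt y > 0 \<Longrightarrow> E y \<le> E x"
  shows "g \<in> desc ch n x \<Longrightarrow> wt g > 0 \<Longrightarrow> E g = E x"
proof (induction n arbitrary: g)
  case (Suc n)
  then obtain y where y: "y \<in> desc ch n x" "g \<in> ch y" by auto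
  have "wt y > 0" using wt_zero_child[OF _ y(2)] Suc.prems(2) wt_nonneg[of y] by (cases "wt y = 0") auto
  then have "E y = E x" using Suc.IH[OF y(1)] by simp
  then show ?case using harmonic_max_child[OF PE _ y(2) Suc.prems(2)] max by simp
qed simp

lemma harmonic_min_desc:
  assumes PE: "Pw E = E" and min: "\<And>y. wt y > 0 \<Longrightarrow> E x \<le> E y" and g: "g \<in> desc ch n x" "wt g > 0"
  shows "E g = E x"
proof -
  have "Pw (\<lambda>y. - E y) = (\<lambda>y. - E y)"
    by (rule ext) (simp add: Pw_def sum_negf fun_cong[OF PE, unfolded Pw_def])
  then have "- E g = - E x" using harmonic_max_desc[of "\<lambda>y. - E y" x g n] min g by simp
  then show ?thesis by simp
qed

lemma type_inv_gap:
  fixes E :: "'v \<Rightarrow> real"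
  assumes "type_inv E"
  obtains \<eta> where "\<eta> > 0" "\<And>y. E y < e \<Longrightarrow> E y \<le> e - \<eta>"
proof -
  have fin: "finite (range E)" using assms by (intro type_inv_finite_range type_invD)
  define \<eta> where "\<eta> = Min (insert 1 ((\<lambda>z. e - z) ` {z \<in> range E. z < e}))"
  have "\<eta> > 0" unfolding \<eta>_def using fin by (subst Min_gr_iff) auto
  moreover have "\<eta> \<le> e - E y" if "E y < e" for y
    unfolding \<eta>_def using fin that by (intro Min_le) auto
  ultimately show ?thesis using that[of \<eta>] by (simp add: le_diff_eq add.commute)
qed

text \<open>Chebyshev's inequality: a second moment of order \<open>j\<close> against the squared
  threshold of order j^2 leaves a proportion of order 1/j.\<close>

lemma deviation_rare:
  assumes dp: "drift_pair E h" and const: "constant_below E x e"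
    and t: "t > 0" and \<epsilon>: "\<epsilon> > 0"
  shows "\<exists>J. \<forall>j\<ge>J. real (card {g \<in> desc ch j x. t * real j \<le> \<bar>\<phi> g - \<phi> x - real j * e\<bar>}) \<le> \<epsilon> * lam ^ j"
proof -
  obtain C where C: "C \<ge> 0" "\<And>n. (\<Sum>g\<in>desc ch n x. (\<phi> g - \<phi> x - real n * e)\<^sup>2) \<le> C * (real n + 1) * lam ^ n"
    using deviation_linear[OF dp const] by blast
  obtain J where J: "\<And>j. j \<ge> J \<Longrightarrow> 2 * C \<le> (\<epsilon> * t\<^sup>2) * real j"
    using eventually_linear_ge[of "\<epsilon> * t\<^sup>2" "2 * C"] \<epsilon> t by auto
  have "real (card {g \<in> desc ch j x. t * real j \<le> \<bar>\<phi> g - \<phi> x - real j * e\<bar>}) \<le> \<epsilon> * lam ^ j"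
    if j: "j \<ge> max J 1" for j
  proof -
    let ?k = "real (card {g \<in> desc ch j x. t * real j \<le> \<bar>\<phi> g - \<phi> x - real j * e\<bar>})"
    have pos: "(t * real j)\<^sup>2 > 0" using t j by simp
    have "?k * (t * real j)\<^sup>2 \<le> C * (real j + 1) * lam ^ j"
      using chebyshev_card[OF finite_desc, of "t * real j"] t C(2)[of j]
        by (meson less_imp_le mult_nonneg_nonneg of_nat_0_le_iff order_trans)
    also have "\<dots> \<le> (2 * C * real j) * lam ^ j"
    proof (rule mult_right_mono)
      have "C * (real j + 1) \<le> C * (2 * real j)" using C(1) j by (intro mult_left_mono) auto
      then show "C * (real j + 1) \<le> 2 * C * real j" by simp
    qed (use lam_pos in simp)
    also have "\<dots> \<le> (\<epsilon> * t\<^sup>2 * real j * real j) * lam ^ j"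
      using J[of j] j lam_pos by (intro mult_right_mono) auto
    also have "\<dots> = (\<epsilon> * lam ^ j) * (t * real j)\<^sup>2" by (simp add: power2_eq_square)
    finally show ?thesis using pos by (rule mult_right_le_imp_le)
  qed
  then show ?thesis by blast
qed

lemma deviation_typical:
  assumes dp: "drift_pair E h" and const: "constant_below E x e"
    and t: "t > 0" and x: "wt x > 0"
  obtains c J where "c > 0"
    "\<And>j. j \<ge> J \<Longrightarrow> c * lam ^ j \<le> real (card {g \<in> desc ch j x. \<bar>\<phi> g - \<phi> x - real j * e\<bar> < t * real j})"
proof -
  obtain \<kappa> where \<kappa>: "\<kappa> > 0" "\<And>n x. \<kappa> * wt x * lam ^ n \<le> real (card (desc ch n x))" using card_desc_ge by blast
  \<comment> \<open>Half of the guaranteed number of descendants; the other half covers the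
    exceptional ones.\<close>
  define c where "c = \<kappa> * wt x / 2"
  have c: "c > 0" using \<kappa> x by (simp add: c_def)
  obtain J where J: "\<And>j. j \<ge> J \<Longrightarrow>
      real (card {g \<in> desc ch j x. t * real j \<le> \<bar>\<phi> g - \<phi> x - real j * e\<bar>}) \<le> c * lam ^ j"
    using deviation_rare[OF dp const t c] by blast
  have "c * lam ^ j \<le> real (card {g \<in> desc ch j x. \<bar>\<phi> g - \<phi> x - real j * e\<bar> < t * real j})" if "j \<ge> J" for j
  proof -
    let ?bad = "{g \<in> desc ch j x. t * real j \<le> \<bar>\<phi> g - \<phi> x - real j * e\<bar>}"
    let ?ok = "{g \<in> desc ch j x. \<bar>\<phi> g - \<phi> x - real j * e\<bar> < t * real j}"
    have "desc ch j x = ?bad \<union> ?ok" by auto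
    moreover have "card (?bad \<union> ?ok) = card ?bad + card ?ok"
      using finite_desc[of j x] by (intro card_Un_disjoint) auto
    ultimately have "real (card (desc ch j x)) = real (card ?bad) + real (card ?ok)" by simp
    moreover have "\<kappa> * wt x * lam ^ j = c * lam ^ j + c * lam ^ j" by (simp add: c_def)
    ultimately show ?thesis using J[OF that] \<kappa>(2)[of x j] by linarith
  qed
  then show ?thesis using that c by blast
qed

end

section \<open>Cayley graphs\<close>

locale cayley = group G for G (structure) +
  fixes S
  assumes gen: "finite_symmetric_generating_set G S"
begin

abbreviation "len \<equiv> word_length G S"
abbreviation "ev \<equiv> word_eval G"

lemma S_finite: "finite S" and S_carrier: "S \<subseteq> carrier G" and S_inv: "s \<in> S \<Longrightarrow> inv s \<in> S"
  and S_gen: "ev ` lists S = carrier G"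
  using gen by (auto simp: finite_symmetric_generating_set_def)

lemma ev_closed: "set w \<subseteq> carrier G \<Longrightarrow> ev w \<in> carrier G"
  by (induction w) (auto simp: word_eval_def)

lemma ev_Nil [simp]: "ev [] = \<one>"
  by (simp add: word_eval_def)

lemma ev_Cons: "ev (s # w) = s \<otimes> ev w"
  by (simp add: word_eval_def)

lemma ev_append: "set u \<subseteq> carrier G \<Longrightarrow> set v \<subseteq> carrier G \<Longrightarrow> ev (u @ v) = ev u \<otimes> ev v"
  by (induction u) (auto simp: ev_Cons ev_closed m_assoc)

lemma lists_carrier: "w \<in> lists S \<Longrightarrow> set w \<subseteq> carrier G"
  using S_carrier by auto

lemma ev_lists: "w \<in> lists S \<Longrightarrow> ev w \<in> carrier G"
  by (intro ev_closed lists_carrier)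

lemma len_word:
  assumes "g \<in> carrier G"
  shows "\<exists>w\<in>lists S. ev w = g \<and> length w = len g"
proof -
  have "g \<in> ev ` lists S" using assms S_gen by simp
  then obtain w where "w \<in> lists S" "ev w = g" by (rule imageE) simp
  then show ?thesis
    unfolding word_length_def
    using LeastI[of "\<lambda>n. \<exists>w\<in>lists S. ev w = g \<and> length w = n" "length w"] by blast
qed

lemma len_le: "w \<in> lists S \<Longrightarrow> len (ev w) \<le> length w"
  unfolding word_length_def
  by (rule Least_le[of "\<lambda>n. \<exists>v\<in>lists S. ev v = ev w \<and> length v = n"]) auto

lemma len_one [simp]: "len \<one> = 0"
  using len_le[of "[]"] by simp

lemma len_gen: "s \<in> S \<Longrightarrow> len s \<le> 1"
  using len_le[of "[s]"] S_carrier by (auto simp: ev_Cons)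

lemma len_mult: "g \<in> carrier G \<Longrightarrow> h \<in> carrier G \<Longrightarrow> len (g \<otimes> h) \<le> len g + len h"
proof -
  assume g: "g \<in> carrier G" and h: "h \<in> carrier G"
  obtain u v where uv: "u \<in> lists S" "ev u = g" "length u = len g" "v \<in> lists S" "ev v = h" "length v = len h"
    using len_word[OF g] len_word[OF h] by blast
  then have "ev (u @ v) = g \<otimes> h" using lists_carrier by (simp add: ev_append)
  then show ?thesis using len_le[of "u @ v"] uv by simp
qed

lemma ev_inverse: "w \<in> lists S \<Longrightarrow> rev (map (m_inv G) w) \<in> lists S \<and> ev (rev (map (m_inv G) w)) = inv (ev w)"
proof (induction w)
  case (Cons s w)
  then have w: "w \<in> lists S" "s \<in> S" by auto
  then have inw: "rev (map (m_inv G) w) \<in> lists S" "ev (rev (map (m_inv G) w)) = inv (ev w)"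
    using Cons.IH by auto
  have sc: "s \<in> carrier G" using S_carrier w by auto
  have "ev (rev (map (m_inv G) w) @ [inv s]) = inv (ev w) \<otimes> inv s"
    using ev_append[OF lists_carrier[OF inw(1)], of "[inv s]"] sc by (simp add: inw(2) ev_Cons)
  then show ?case using inw(1) w S_inv sc ev_lists[OF w(1)] by (simp add: ev_Cons inv_mult_group)
qed simp

lemma len_inv [simp]: "g \<in> carrier G \<Longrightarrow> len (inv g) = len g"
proof -
  have le: "len (inv h) \<le> len h" if h: "h \<in> carrier G" for h
  proof -
    obtain w where w: "w \<in> lists S" "ev w = h" "length w = len h" using len_word[OF h] by blast
    then show ?thesis using ev_inverse[OF w(1)] len_le[of "rev (map (m_inv G) w)"] by simp
  qed
  assume "g \<in> carrier G"
  then show ?thesis using le[of g] le[of "inv g"] by simp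
qed

lemma len_eq_0: "g \<in> carrier G \<Longrightarrow> len g = 0 \<Longrightarrow> g = \<one>"
  using len_word[of g] by auto

lemma finite_len_ball: "finite {g \<in> carrier G. len g \<le> n}"
proof -
  have "{g \<in> carrier G. len g \<le> n} \<subseteq> ev ` {w. set w \<subseteq> S \<and> length w \<le> n}"
  proof
    fix g assume "g \<in> {g \<in> carrier G. len g \<le> n}"
    then have "g \<in> carrier G" "len g \<le> n" by auto
    then obtain w where "w \<in> lists S" "ev w = g" "length w \<le> n" using len_word[of g] by metis
    then show "g \<in> ev ` {w. set w \<subseteq> S \<and> length w \<le> n}" by auto
  qed
  then show ?thesis using finite_lists_length_le[OF S_finite] finite_surj by blast
qed

abbreviation "dst \<equiv> word_dist G S"

lemma dst_translate: "g \<in> carrier G \<Longrightarrow> x \<in> carrier G \<Longrightarrow> y \<in> carrier G \<Longrightarrow> dst (g \<otimes> x) (g \<otimes> y) = dst x y"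
  unfolding word_dist_def by (simp add: inv_mult_group m_assoc inv_solve_left[symmetric])
     (simp add: m_assoc[symmetric])

lemma dst_one: "x \<in> carrier G \<Longrightarrow> dst \<one> x = len x"
  by (simp add: word_dist_def)

lemma dst_right_mult: "x \<in> carrier G \<Longrightarrow> h \<in> carrier G \<Longrightarrow> dst x (x \<otimes> h) = len h"
  by (simp add: word_dist_def m_assoc[symmetric])

lemma dst_sym: "x \<in> carrier G \<Longrightarrow> y \<in> carrier G \<Longrightarrow> dst x y = dst y x"
  unfolding word_dist_def using len_inv[of "inv x \<otimes> y"] by (simp add: inv_mult_group)

lemma dst_tri:
  assumes "x \<in> carrier G" "y \<in> carrier G" "z \<in> carrier G"
  shows "dst x z \<le> dst x y + dst y z"
proof -
  have "inv x \<otimes> z = (inv x \<otimes> y) \<otimes> (inv y \<otimes> z)"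
    using assms by (simp add: m_assoc) (simp add: m_assoc[symmetric])
  then show ?thesis unfolding word_dist_def using len_mult[of "inv x \<otimes> y" "inv y \<otimes> z"] assms by simp
qed

lemma dst_prefix:
  assumes w: "w \<in> lists S" "length w = len (ev w)" and ij: "i \<le> j" "j \<le> length w"
  shows "dst (ev (take i w)) (ev (take j w)) = j - i"
proof -
  have c: "set w \<subseteq> carrier G" using w lists_carrier by blast
  have tc: "ev (take k w) \<in> carrier G" for k using c set_take_subset[of k w] by (intro ev_closed) auto
  have le: "dst (ev (take a w)) (ev (take b w)) \<le> b - a" if "a \<le> b" "b \<le> length w" for a b
  proof -
    define v where "v = take (b - a) (drop a w)"
    have v: "take b w = take a w @ v" unfolding v_def using that by (metis le_add_diff_inverse take_add)
    have vS: "v \<in> lists S" using w(1) unfolding v_def by (auto dest: in_set_takeD in_set_dropD)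
    have "ev (take b w) = ev (take a w) \<otimes> ev v"
      unfolding v using c set_take_subset[of a w] lists_carrier[OF vS] by (intro ev_append) auto
    then have "dst (ev (take a w)) (ev (take b w)) = len (ev v)"
      using dst_right_mult[OF tc ev_lists[OF vS]] by simp
    also have "\<dots> \<le> length v" by (rule len_le[OF vS])
    finally show ?thesis by (simp add: v_def)
  qed
  have "length w = dst (ev (take 0 w)) (ev (take (length w) w))"
    using w dst_one[OF ev_lists[OF w(1)]] by simp
  also have "\<dots> \<le> dst (ev (take 0 w)) (ev (take i w))
      + (dst (ev (take i w)) (ev (take j w)) + dst (ev (take j w)) (ev (take (length w) w)))"
    by (rule order_trans[OF dst_tri[OF tc tc tc] add_left_mono[OF dst_tri[OF tc tc tc]]])
  also have "\<dots> \<le> i + (dst (ev (take i w)) (ev (take j w)) + (length w - j))"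
    using le[of 0 i] le[of j "length w"] ij by simp
  finally show ?thesis using le[OF ij] ij by linarith
qed

sublocale nat_geodesic "carrier G" dst
proof
  fix x y assume x: "x \<in> carrier G" and y: "y \<in> carrier G"
  obtain w where w: "w \<in> lists S" "ev w = inv x \<otimes> y" "length w = len (inv x \<otimes> y)"
    using len_word[of "inv x \<otimes> y"] x y by auto
  have tc: "ev (take k w) \<in> carrier G" for k
    using lists_carrier[OF w(1)] set_take_subset[of k w] by (intro ev_closed) auto
  define p where "p i = x \<otimes> ev (take i w)" for i
  have n: "dst x y = length w" using w by (simp add: word_dist_def)
  have d: "dst (p i) (p j) = j - i" if "i \<le> j" "j \<le> length w" for i j
    unfolding p_def using dst_translate[OF x tc tc] dst_prefix[OF w(1) _ that] w by simp
  have pc: "p i \<in> carrier G" for i unfolding p_def using x tc by simp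
  have dd: "int (dst (p i) (p j)) = \<bar>int i - int j\<bar>" if "i \<le> length w" "j \<le> length w" for i j
  proof (cases "i \<le> j")
    case True
    then show ?thesis using d[of i j] that by simp
  next
    case False
    then show ?thesis using d[of j i] that dst_sym[OF pc pc, of i j] by simp
  qed
  have "p 0 = x" using x by (simp add: p_def)
  moreover have "p (dst x y) = y" unfolding n p_def using w x y by (simp add: m_assoc[symmetric])
  ultimately show "\<exists>p. p 0 = x \<and> p (dst x y) = y \<and> (\<forall>i\<le>dst x y. p i \<in> carrier G) \<and>
      (\<forall>i\<le>dst x y. \<forall>j\<le>dst x y. int (dst (p i) (p j)) = \<bar>int i - int j\<bar>)"
    using pc dd n by (intro exI[of _ p]) simp
qed (auto simp: dst_sym dst_tri, simp add: word_dist_def)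

lemma split_len:
  assumes "g \<in> carrier G" "k \<le> len g"
  obtains a b where "a \<in> carrier G" "b \<in> carrier G" "g = a \<otimes> b" "len a = k" "len b = len g - k"
proof -
  obtain p where p: "p \<in> seg \<one> g" "dst \<one> p = k"
    using seg_at[of \<one> g k] assms dst_one by auto
  then have pc: "p \<in> carrier G" "len p + dst p g = len g" "len p = k"
    using segD[OF p(1)] dst_one assms(1) by auto
  show ?thesis
    using pc assms(1) by (intro that[of p "inv p \<otimes> g"]) (auto simp: word_dist_def m_assoc[symmetric])
qed

text \<open>Hyperbolicity speaks of three given geodesics, \<open>thin\<close> of arbitrary points
  of an interval. A geodesic chosen to pass through \<open>p\<close> connects the two.\<close>

lemma thin_of_hyperbolic:
  assumes "cayley_hyperbolic G S \<delta>"
  shows "thin \<delta>"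
  unfolding thin_def
proof (intro ballI)
  fix x y z p assume M: "x \<in> carrier G" "y \<in> carrier G" "z \<in> carrier G" and p: "p \<in> seg x y"
  have geo: "cayley_geodesic G S u v (dst u v) c"
    if "u \<in> carrier G" "v \<in> carrier G" "c 0 = u" "c (dst u v) = v" "\<And>i. i \<le> dst u v \<Longrightarrow> c i \<in> seg u v"
      "\<And>i j. i \<le> j \<Longrightarrow> j \<le> dst u v \<Longrightarrow> dst (c i) (c j) = j - i" for u v c
  proof -
    have cM: "c i \<in> carrier G" if "i \<le> dst u v" for i
      using \<open>\<And>i. i \<le> dst u v \<Longrightarrow> c i \<in> seg u v\<close>[OF that] segD by blast
    have "int (dst (c i) (c j)) = \<bar>int i - int j\<bar>" if "i \<le> dst u v" "j \<le> dst u v" for i j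
      using that cM dst_sym[of "c i" "c j"] \<open>\<And>i j. i \<le> j \<Longrightarrow> j \<le> dst u v \<Longrightarrow> dst (c i) (c j) = j - i\<close>
      by (cases "i \<le> j") auto
    then show ?thesis unfolding cayley_geodesic_def using that(3,4) cM by blast
  qed
  obtain c where c: "c 0 = x" "c (dst x y) = y" "c (dst x p) = p" "\<And>i. i \<le> dst x y \<Longrightarrow> c i \<in> seg x y"
    "\<And>i j. i \<le> j \<Longrightarrow> j \<le> dst x y \<Longrightarrow> dst (c i) (c j) = j - i"
    using geodesic_through[OF M(1,2) p] by blast
  obtain q where q: "q 0 = x" "q (dst x z) = z" "\<And>i. i \<le> dst x z \<Longrightarrow> q i \<in> seg x z"
    "\<And>i j. i \<le> j \<Longrightarrow> j \<le> dst x z \<Longrightarrow> dst (q i) (q j) = j - i"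
    using geodesic_param[OF M(1,3)] by blast
  obtain r where r: "r 0 = y" "r (dst y z) = z" "\<And>i. i \<le> dst y z \<Longrightarrow> r i \<in> seg y z"
    "\<And>i j. i \<le> j \<Longrightarrow> j \<le> dst y z \<Longrightarrow> dst (r i) (r j) = j - i"
    using geodesic_param[OF M(2,3)] by blast
  have "(\<exists>j\<le>dst x z. dst (c (dst x p)) (q j) \<le> \<delta>) \<or> (\<exists>k\<le>dst y z. dst (c (dst x p)) (r k) \<le> \<delta>)"
    using assms[unfolded cayley_hyperbolic_def, rule_format, OF geo[OF M(1,2) c(1,2,4,5)]
        geo[OF M(1,3) q] geo[OF M(2,3) r], of "dst x p"] segD[OF p] by simp
  then show "\<exists>q\<in>seg x z \<union> seg z y. dst p q \<le> \<delta>"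
    unfolding c(3) using q(3) r(3) seg_sym[OF M(2,3)] by blast
qed

end

section \<open>Change of the generating set\<close>

lemma cayley_bilipschitz:
  assumes "cayley G S" "cayley G T"
  obtains k where "k \<ge> 1" "\<And>g. g \<in> carrier G \<Longrightarrow> word_length G S g \<le> k * word_length G T g"
    "\<And>g. g \<in> carrier G \<Longrightarrow> word_length G T g \<le> k * word_length G S g"
proof -
  have half: "\<exists>k. \<forall>g\<in>carrier G. word_length G S g \<le> k * word_length G T g"
    if "cayley G S" "cayley G T" for S T
  proof -
    interpret S: cayley G S by fact
    interpret T: cayley G T by fact
    define k where "k = (\<Sum>t\<in>T. word_length G S t)"
    have k: "word_length G S t \<le> k" if "t \<in> T" for t
      unfolding k_def using that T.S_finite by (intro member_le_sum) auto
    have "word_length G S (word_eval G w) \<le> k * length w" if "w \<in> lists T" for w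
      using that
    proof (induction w)
      case (Cons t w)
      have "word_length G S (t \<otimes>\<^bsub>G\<^esub> word_eval G w) \<le> word_length G S t + word_length G S (word_eval G w)"
        using Cons T.S_carrier T.ev_lists by (intro S.len_mult) auto
      then show ?case using Cons k[of t] by (simp add: S.ev_Cons)
    qed simp
    then show ?thesis using T.len_word by metis
  qed
  obtain a where a: "\<forall>g\<in>carrier G. word_length G S g \<le> a * word_length G T g" using half[OF assms] by blast
  obtain b where b: "\<forall>g\<in>carrier G. word_length G T g \<le> b * word_length G S g" using half[OF assms(2,1)] by blast
  show ?thesis
  proof (rule that[of "a + b + 1"])
    fix g assume g: "g \<in> carrier G"
    show "word_length G S g \<le> (a + b + 1) * word_length G T g"
      using a g by (meson le_add1 le_trans mult_le_mono1)
    show "word_length G T g \<le> (a + b + 1) * word_length G S g"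
      using b g by (meson le_add1 le_add2 le_trans mult_le_mono1)
  qed simp
qed

lemma geodesic_imp_quasi_path:
  fixes G (structure)
  assumes S: "cayley G S" and T: "cayley G T"
    and k: "\<And>g. g \<in> carrier G \<Longrightarrow> word_length G S g \<le> k * word_length G T g"
    "\<And>g. g \<in> carrier G \<Longrightarrow> word_length G T g \<le> k * word_length G S g"
    and c: "\<And>i. i \<le> n \<Longrightarrow> c i \<in> carrier G" "\<And>i j. i \<le> j \<Longrightarrow> j \<le> n \<Longrightarrow> word_dist G T (c i) (c j) = j - i"
  shows "nat_geodesic.quasi_path (carrier G) (word_dist G S) k c n"
proof -
  interpret S: cayley G S by (rule S)
  show ?thesis
    unfolding S.quasi_path_def
  proof (intro conjI allI impI)
    fix i j assume ij: "i \<le> n" "j \<le> n" "i \<le> j"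
    have "inv (c i) \<otimes> c j \<in> carrier G" using c(1) ij by simp
    then show "S.dst (c i) (c j) \<le> k * (j - i)" "j - i \<le> k * S.dst (c i) (c j)"
      using k[of "inv (c i) \<otimes> c j"] c(2)[of i j] ij unfolding word_dist_def by auto
  qed (rule c(1))
qed

text \<open>Geodesics of \<open>T\<close> are quasi-paths for \<open>S\<close>. A point on a side of
  a \<open>T\<close>-triangle is moved to the \<open>S\<close>-geodesic with the same ends
  (\<open>R1\<close>), across the thin \<open>S\<close>-triangle (\<delta>), and back to a
  \<open>T\<close>-geodesic (\<open>R2\<close>). The factor \<open>k\<close> converts this
  \<open>S\<close>-distance into a \<open>T\<close>-distance.\<close>

lemma thin_change_generators:
  assumes S: "cayley G S" and T: "cayley G T"
    and thin: "nat_geodesic.thin (carrier G) (word_dist G S) \<delta>"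
  obtains \<delta>' where "nat_geodesic.thin (carrier G) (word_dist G T) \<delta>'"
proof -
  interpret S: cayley G S by (rule S)
  interpret T: cayley G T by (rule T)
  obtain k where k: "k \<ge> 1" "\<And>g. g \<in> carrier G \<Longrightarrow> S.len g \<le> k * T.len g"
    "\<And>g. g \<in> carrier G \<Longrightarrow> T.len g \<le> k * S.len g"
    using cayley_bilipschitz[OF S T] by blast
  have qp: "S.quasi_path k c n"
    if "\<And>i. i \<le> n \<Longrightarrow> c i \<in> carrier G" "\<And>i j. i \<le> j \<Longrightarrow> j \<le> n \<Longrightarrow> T.dst (c i) (c j) = j - i" for c n
    by (rule geodesic_imp_quasi_path[OF S T k(2,3) that])
  obtain R1 where R1: "\<And>c n i. S.quasi_path k c n \<Longrightarrow> i \<le> n \<Longrightarrow> \<exists>p\<in>S.seg (c 0) (c n). S.dst (c i) p \<le> R1"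
    using S.quasi_path_near_geodesic[OF thin] by blast
  obtain R2 where R2: "\<And>c n p. S.quasi_path k c n \<Longrightarrow> p \<in> S.seg (c 0) (c n) \<Longrightarrow> \<exists>i\<le>n. S.dst p (c i) \<le> R2"
    using S.geodesic_near_quasi_path[OF thin] by blast
  have onT: "\<exists>q\<in>T.seg u v. S.dst p q \<le> R2" if uv: "u \<in> carrier G" "v \<in> carrier G"
    and p: "p \<in> S.seg u v" for u v p
  proof -
    obtain c where c: "c 0 = u" "c (T.dst u v) = v" "\<And>i. i \<le> T.dst u v \<Longrightarrow> c i \<in> T.seg u v"
      "\<And>i j. i \<le> j \<Longrightarrow> j \<le> T.dst u v \<Longrightarrow> T.dst (c i) (c j) = j - i"
      using T.geodesic_param[OF uv] by blast
    then have "S.quasi_path k c (T.dst u v)"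
      by (intro qp) (blast dest: T.segD)+
    then show ?thesis using R2[of c "T.dst u v" p] p c by auto
  qed
  have "T.thin (k * (R1 + \<delta> + R2))"
    unfolding T.thin_def
  proof (intro ballI)
    fix x y z p assume M: "x \<in> carrier G" "y \<in> carrier G" "z \<in> carrier G" and p: "p \<in> T.seg x y"
    obtain c where c: "c 0 = x" "c (T.dst x y) = y" "c (T.dst x p) = p" "\<And>i. i \<le> T.dst x y \<Longrightarrow> c i \<in> T.seg x y"
      "\<And>i j. i \<le> j \<Longrightarrow> j \<le> T.dst x y \<Longrightarrow> T.dst (c i) (c j) = j - i"
      using T.geodesic_through[OF M(1,2) p] by blast
    then have "S.quasi_path k c (T.dst x y)"
      by (intro qp) (blast dest: T.segD)+
    then obtain p1 where p1: "p1 \<in> S.seg x y" "S.dst p p1 \<le> R1"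
      using R1[of c "T.dst x y" "T.dst x p"] c T.segD[OF p] by auto
    obtain p2 where p2: "p2 \<in> S.seg x z \<union> S.seg z y" "S.dst p1 p2 \<le> \<delta>"
      using S.thinD[OF thin M p1(1)] by blast
    obtain p3 where p3: "p3 \<in> T.seg x z \<union> T.seg z y" "S.dst p2 p3 \<le> R2"
      using p2(1) onT[OF M(1,3)] onT[OF M(3,2)] by blast
    have inM: "p \<in> carrier G" "p1 \<in> carrier G" "p2 \<in> carrier G" "p3 \<in> carrier G"
      using p p1 p2 p3 S.segD T.segD by blast+
    have "S.dst p p3 \<le> R1 + \<delta> + R2"
      using S.dst_tri[of p p1 p3] S.dst_tri[of p1 p2 p3] inM p1 p2 p3 by simp
    moreover have "T.dst p p3 \<le> k * S.dst p p3"
      unfolding word_dist_def using inM by (intro k(3)) auto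
    ultimately have "T.dst p p3 \<le> k * (R1 + \<delta> + R2)" by (meson le_trans mult_le_mono2)
    then show "\<exists>q\<in>T.seg x z \<union> T.seg z y. T.dst p q \<le> k * (R1 + \<delta> + R2)" using p3 by blast
  qed
  then show ?thesis using that by blast
qed

section \<open>Inserting short elements without cancellation\<close>

context cayley
begin

lemma four_pointD:
  assumes "four_point D" "x \<in> carrier G" "y \<in> carrier G" "z \<in> carrier G" "w \<in> carrier G"
  shows "dst x z + dst y w \<le> max (dst x y + dst z w) (dst y z + dst x w) + D"
  using assms unfolding four_point_def by blast

lemma dst_to_one: "x \<in> carrier G \<Longrightarrow> dst x \<one> = len x"
  using dst_sym[of x \<one>] dst_one[of x] by simp

lemma dst_inv_mult: "x \<in> carrier G \<Longrightarrow> y \<in> carrier G \<Longrightarrow> dst x y = len (inv x \<otimes> y)"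
  by (simp add: word_dist_def)

text \<open>If no short \<open>y\<close> removes the overlap of \<open>y \<otimes> b\<close> with
  \<open>x\<close>, then any two such translates of \<open>b\<close> overlap with each other. If the
  point \<open>p\<close> on the way from \<open>b\<close> to \<open>w \<otimes> b\<close> that
  realizes the Gromov product were within \<open>r\<close> of the identity, moving it to the
  identity would produce two translates without overlap. So \<open>p\<close> is far out, that is,
  \<open>w\<close> almost fixes the direction of \<open>b\<close>.\<close>

lemma almost_fixed_point:
  assumes t: "thin \<delta>"
    and small: "\<And>R. \<exists>x\<in>carrier G. \<exists>b\<in>carrier G. \<forall>y\<in>carrier G. len y \<le> R \<longrightarrow>
      dst x (y \<otimes> b) + (6 * \<delta> + 2) < len x + len (y \<otimes> b)"
  shows "\<exists>b\<in>carrier G. \<forall>w\<in>carrier G. len w \<le> r \<longrightarrow>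
    2 * r + dst b (w \<otimes> b) \<le> len b + len (w \<otimes> b) + (4 * \<delta> + 2)"
proof -
  note fp = thin_imp_four_point[OF t]
  \<comment> \<open>The radius is \<open>2 * r\<close> because \<open>inv p \<otimes> w\<close>
    below can have that length.\<close>
  obtain x b where xb: "x \<in> carrier G" "b \<in> carrier G"
    "\<And>y. y \<in> carrier G \<Longrightarrow> len y \<le> 2 * r \<Longrightarrow> dst x (y \<otimes> b) + (6 * \<delta> + 2) < len x + len (y \<otimes> b)"
    using small[of "2 * r"] by blast
  have prod: "dst (y \<otimes> b) (y' \<otimes> b) < len (y \<otimes> b) + len (y' \<otimes> b)"
    if y: "y \<in> carrier G" "len y \<le> 2 * r" "y' \<in> carrier G" "len y' \<le> 2 * r" for y y'
  proof -
    have c: "y \<otimes> b \<in> carrier G" "y' \<otimes> b \<in> carrier G" using y xb by auto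
    have "dst (y \<otimes> b) (y' \<otimes> b) + dst x \<one>
        \<le> max (dst (y \<otimes> b) x + dst (y' \<otimes> b) \<one>) (dst x (y' \<otimes> b) + dst (y \<otimes> b) \<one>) + (6 * \<delta> + 2)"
      by (rule four_pointD[OF fp]) (use c xb in auto)
    then show ?thesis
      using xb(3)[OF y(1,2)] xb(3)[OF y(3,4)] dst_sym[OF c(1) xb(1)] dst_to_one[OF c(1)] dst_to_one[OF c(2)]
        dst_to_one[OF xb(1)] by linarith
  qed
  have "2 * r + dst b (w \<otimes> b) \<le> len b + len (w \<otimes> b) + (4 * \<delta> + 2)"
    if w: "w \<in> carrier G" "len w \<le> r" for w
  proof -
    have wb: "w \<otimes> b \<in> carrier G" using w xb by simp
    obtain p where p: "p \<in> seg b (w \<otimes> b)"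
      "2 * dst \<one> p + dst b (w \<otimes> b) \<le> dst b \<one> + dst (w \<otimes> b) \<one> + (4 * \<delta> + 2)"
      using seg_near_gromov_product[OF t xb(2) wb one_closed] by blast
    have pc: "p \<in> carrier G" and ps: "dst b p + dst p (w \<otimes> b) = dst b (w \<otimes> b)" using segD[OF p(1)] by auto
    have "r < len p"
    proof (rule ccontr)
      assume "\<not> r < len p"
      then have lp: "len (inv p) \<le> 2 * r" "len (inv p \<otimes> w) \<le> 2 * r"
        using len_mult[of "inv p" w] w pc by auto
      have "dst (inv p \<otimes> b) (inv p \<otimes> w \<otimes> b) = dst b (w \<otimes> b)"
        using dst_translate[of "inv p" b "w \<otimes> b"] pc xb wb w by (simp add: m_assoc)
      moreover have "len (inv p \<otimes> b) = dst b p" "len (inv p \<otimes> w \<otimes> b) = dst p (w \<otimes> b)"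
        using dst_inv_mult[OF pc xb(2)] dst_sym[OF pc xb(2)] dst_inv_mult[OF pc wb] pc xb w
          by (simp_all add: m_assoc)
      ultimately show False using prod[of "inv p" "inv p \<otimes> w"] lp pc w ps by simp
    qed
    then show ?thesis using p(2) dst_one[OF pc] dst_to_one[OF xb(2)] dst_to_one[OF wb] by linarith
  qed
  then show ?thesis using xb(2) by blast
qed

text \<open>If all short elements almost fix \<open>b\<close>, the Busemann function \<open>horo b\<close> is a quasimorphism on a large
  ball with boundedly many elements in each level set. An infinite group of this kind has an element \<open>g\<close> with
  \<open>horo b g\<close> large, and the powers of \<open>g\<close> then come boundedly close to every element.\<close>

definition horo :: "'a \<Rightarrow> 'a \<Rightarrow> int" where
  "horo b g = int (dst g b) - int (len b)"

lemma horo_abs_le: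
  assumes "b \<in> carrier G" "g \<in> carrier G"
  shows "\<bar>horo b g\<bar> \<le> int (len g)"
  using dst_tri[of g \<one> b] dst_tri[of \<one> g b] assms dst_one[of b] dst_one[of g] dst_to_one[of g]
  unfolding horo_def by simp

context
  fixes r :: nat and b D c
  assumes fp: "four_point D" and b: "b \<in> carrier G"
    and fixed: "\<And>w. w \<in> carrier G \<Longrightarrow> len w \<le> r \<Longrightarrow> 2 * r + dst b (w \<otimes> b) \<le> len b + len (w \<otimes> b) + c"
begin

text \<open>With \<open>b' = inv g \<otimes> b\<close> the defect is the difference at
  \<open>h\<close> of the Busemann functions of \<open>b'\<close> and \<open>b\<close>. Since
  \<open>g\<close> almost fixes \<open>b\<close>, the geodesics to these points separate only beyond
  the reach of \<open>h\<close>, and the four-point inequality leaves an error of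
  \<open>D\<close>.\<close>

lemma horo_mult:
  assumes g: "g \<in> carrier G" "len g \<le> r" and h: "h \<in> carrier G" "len h + c \<le> r"
  shows "\<bar>horo b (g \<otimes> h) - horo b g - horo b h\<bar> \<le> int D"
proof -
  define b' where "b' = inv g \<otimes> b"
  have b': "b' \<in> carrier G" using g b by (simp add: b'_def)
  have eq: "dst (g \<otimes> h) b = dst h b'" "dst g b = len b'"
    using dst_translate[of g h b'] dst_inv_mult[OF g(1) b] g h b b' unfolding b'_def
    by (simp_all add: m_assoc[symmetric])
  have near: "2 * r + dst b b' \<le> len b + len b' + c"
    using fixed[of "inv g"] g by (simp add: b'_def)
  have "dst h b' + dst b \<one> \<le> max (dst h b + dst b' \<one>) (dst b b' + dst h \<one>) + D"
    "dst h b + dst b' \<one> \<le> max (dst h b' + dst b \<one>) (dst b' b + dst h \<one>) + D"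
    by (rule four_pointD[OF fp]; use h b b' in simp)+
  moreover have "len b \<le> len h + dst h b" "len b' \<le> len h + dst h b'"
    using dst_tri[of \<one> h b] dst_tri[of \<one> h b'] h b b' by (auto simp: dst_one)
  moreover have "dst b' b = dst b b'" using b b' by (rule dst_sym[OF _ _, symmetric])
  ultimately show ?thesis
    unfolding horo_def eq using near h(2) dst_to_one[OF b] dst_to_one[OF b'] dst_to_one[OF h(1)] by linarith
qed

text \<open>An element of small Busemann value moves a point \<open>p\<close> far out on the way to
  \<open>b\<close> by at most \<open>K + 2 * D\<close>. Conjugation by \<open>p\<close> therefore
  maps all of them injectively into one ball, whose size is independent of \<rho>.\<close>

lemma horo_card:
  assumes r: "\<rho> + K + 2 * D + c \<le> r"
  shows "card {g \<in> carrier G. len g \<le> \<rho> \<and> \<bar>horo b g\<bar> \<le> int K} \<le> card {g \<in> carrier G. len g \<le> K + 2 * D}"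
proof -
  define T where "T = \<rho> + K + 2 * D"
  have "T \<le> len b" using fixed[of \<one>] b r by (simp add: T_def)
  then obtain p where p: "p \<in> seg \<one> b" "dst \<one> p = T"
    using seg_at[of \<one> b T] b dst_one[OF b] by auto
  have pc: "p \<in> carrier G" and lp: "len p = T" and pb: "T + dst p b = len b"
    using segD[OF p(1)] p(2) dst_one b by auto
  have "inv p \<otimes> g \<otimes> p \<in> {g \<in> carrier G. len g \<le> K + 2 * D}"
    if g: "g \<in> carrier G" "len g \<le> \<rho>" "\<bar>horo b g\<bar> \<le> int K" for g
  proof -
    have gp: "g \<otimes> p \<in> carrier G" using g pc by simp
    have "\<bar>horo b (g \<otimes> p) - horo b g - horo b p\<bar> \<le> int D"
      using g pc lp r unfolding T_def by (intro horo_mult) auto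
    then have h1: "dst (g \<otimes> p) b + T \<le> len b + K + D"
      using g(3) pb unfolding horo_def by linarith
    have "dst \<one> (g \<otimes> p) + dst g b \<le> max (dst \<one> g + dst (g \<otimes> p) b) (dst g (g \<otimes> p) + dst \<one> b) + D"
      by (rule four_pointD[OF fp]) (use g gp b in auto)
    then have h2: "len (g \<otimes> p) \<le> T + K + D"
      using h1 g(2,3) dst_one[OF gp] dst_one[OF g(1)] dst_one[OF b] dst_right_mult[OF g(1) pc] lp
      unfolding horo_def T_def by linarith
    have "dst p (g \<otimes> p) + dst b \<one> \<le> max (dst p b + dst (g \<otimes> p) \<one>) (dst b (g \<otimes> p) + dst p \<one>) + D"
      by (rule four_pointD[OF fp]) (use pc gp b in auto)
    then have "dst p (g \<otimes> p) \<le> K + 2 * D"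
      using h1 h2 dst_to_one[OF b] dst_to_one[OF gp] dst_to_one[OF pc] lp pb dst_sym[OF b gp] by linarith
    then show ?thesis using dst_inv_mult[OF pc gp] g pc by (simp add: m_assoc)
  qed
  moreover have "inj_on (\<lambda>g. inv p \<otimes> g \<otimes> p) (carrier G)"
    using pc by (intro inj_onI) simp
  ultimately show ?thesis
    by (intro card_inj_on_le[of "\<lambda>g. inv p \<otimes> g \<otimes> p"] finite_len_ball) (auto elim: inj_on_subset)
qed

text \<open>Of \<open>g\<close> and its inverse, one has a Busemann value of sign opposite to that
  of \<open>x\<close> and of size above \<open>D\<close>. Multiplying by it lowers the absolute
  value by at least 1, and since a jump is at most \<open>L + D = K\<close>, values above
  \<open>K\<close> do not pass 0.\<close>

lemma horo_descent:
  assumes g: "g \<in> carrier G" "len g \<le> L" "\<bar>horo b g\<bar> > 2 * int D" and K: "K = L + D"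
  shows "\<lbrakk>x \<in> carrier G; \<bar>horo b x\<bar> \<le> int (K + k); len x + L * k + L + c \<le> r\<rbrakk> \<Longrightarrow>
    \<exists>n::int. \<bar>horo b (g [^] n \<otimes> x)\<bar> \<le> int K \<and> len (g [^] n \<otimes> x) \<le> len x + L * k"
proof (induction k arbitrary: x)
  case 0
  then show ?case by (intro exI[of _ "0::int"]) simp
next
  case (Suc k)
  show ?case
  proof (cases "\<bar>horo b x\<bar> \<le> int K")
    case True
    then show ?thesis using Suc.prems by (intro exI[of _ "0::int"]) simp
  next
    case False
    have Lr: "L + c \<le> r" using Suc.prems(3) by linarith
    have "horo b (g \<otimes> inv g) = 0" using g b by (simp add: horo_def dst_one)
    then have inv_g: "\<bar>horo b g + horo b (inv g)\<bar> \<le> int D"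
      using horo_mult[of g "inv g"] g Lr by simp
    have "\<exists>e::int. (e = 1 \<or> e = -1) \<and> (horo b x > 0 \<longrightarrow> horo b (g [^] e) < - int D) \<and>
        (horo b x < 0 \<longrightarrow> horo b (g [^] e) > int D)"
    proof (cases "(horo b x > 0) = (horo b g < 0)")
      case True
      then show ?thesis using g by (intro exI[of _ 1]) (auto simp: int_pow_1)
    next
      case False
      then show ?thesis using g inv_g by (intro exI[of _ "-1"]) (auto simp: int_pow_neg int_pow_1)
    qed
    then obtain e :: int where e: "e = 1 \<or> e = -1" "horo b x > 0 \<longrightarrow> horo b (g [^] e) < - int D"
      "horo b x < 0 \<longrightarrow> horo b (g [^] e) > int D" by blast
    define s where "s = g [^] e"
    have s: "s \<in> carrier G" "len s \<le> L" using e(1) g unfolding s_def by (auto simp: int_pow_neg int_pow_1)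
    have sx: "s \<otimes> x \<in> carrier G" "len (s \<otimes> x) \<le> L + len x" using len_mult[of s x] s Suc.prems by auto
    have "\<bar>horo b (s \<otimes> x) - horo b s - horo b x\<bar> \<le> int D"
      using s Suc.prems Lr by (intro horo_mult) auto
    moreover have "\<bar>horo b s\<bar> \<le> int L" using horo_abs_le[OF b s(1)] s(2) by linarith
    ultimately have "\<bar>horo b (s \<otimes> x)\<bar> \<le> int (K + k)"
      using False Suc.prems(2) e(2,3) unfolding s_def[symmetric] K by linarith
    then obtain n :: int
      where n: "\<bar>horo b (g [^] n \<otimes> (s \<otimes> x))\<bar> \<le> int K" "len (g [^] n \<otimes> (s \<otimes> x)) \<le> len (s \<otimes> x) + L * k"
      using Suc.IH[OF sx(1)] Suc.prems(3) sx(2) by fastforce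
    have "g [^] n \<otimes> (s \<otimes> x) = g [^] (n + e) \<otimes> x"
      using g s Suc.prems unfolding s_def by (simp add: int_pow_mult m_assoc)
    then show ?thesis using n sx(2) by (intro exI[of _ "n + e"]) simp
  qed
qed

end

lemma finite_imp_elementary:
  assumes "finite (carrier G)"
  shows "elementary G"
proof -
  define H where "H = generate G (carrier G \<inter> {\<one>})"
  have "subgroup H G" unfolding H_def by (intro generate_is_subgroup) auto
  moreover have "cyclic_group (G\<lparr>carrier := H\<rparr>)"
    using cyclic_group_generated[of \<one>] unfolding subgroup_generated_def H_def .
  moreover have "finite (rcosets H)"
    by (rule finite_subset[of _ "Pow (carrier G)"])
       (use assms rcosets_subset_PowG[OF \<open>subgroup H G\<close>] in auto)
  ultimately show ?thesis unfolding elementary_def by blast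
qed

lemma almost_fixed_imp_elementary:
  assumes fp: "four_point D"
    and fixed: "\<And>r. \<exists>b\<in>carrier G. \<forall>w\<in>carrier G. len w \<le> r \<longrightarrow> 2 * r + dst b (w \<otimes> b) \<le> len b + len (w \<otimes> b) + c"
  shows "elementary G"
proof (cases "finite (carrier G)")
  case True
  then show ?thesis by (rule finite_imp_elementary)
next
  case False
  define ball where "ball n = {g \<in> carrier G. len g \<le> n}" for n
  have fin_ball: "finite (ball n)" for n unfolding ball_def by (rule finite_len_ball)
  define K0 where "K0 = 2 * D"
  \<comment> \<open>More elements than \<open>horo_card\<close> allows for values up to
    \<open>K0\<close>, so the ball of radius \<open>L\<close> must contain an element of larger
    value.\<close>
  obtain A where A: "A \<subseteq> carrier G" "finite A" "card A = Suc (card (ball (K0 + 2 * D)))"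
    using infinite_arbitrarily_large[OF False] by metis
  define L where "L = Max (len ` A)"
  have AL: "A \<subseteq> ball L" using A unfolding ball_def L_def by auto
  have large: "card (ball (K0 + 2 * D)) < card (ball L)"
    using card_mono[OF fin_ball AL] A(3) by simp
  define good where "good r b \<longleftrightarrow> b \<in> carrier G \<and>
    (\<forall>w\<in>carrier G. len w \<le> r \<longrightarrow> 2 * r + dst b (w \<otimes> b) \<le> len b + len (w \<otimes> b) + c)" for r b
  have ex_good: "\<exists>b. good r b" for r using fixed[of r] unfolding good_def by blast
  \<comment> \<open>The point \<open>b\<close> changes with \<open>r\<close>, but the cyclic
    subgroup must not. Because the ball is finite, one \<open>g\<close> works for arbitrarily large
    \<open>r\<close>.\<close>
  have "\<exists>g\<in>ball L. \<forall>r0. \<exists>r\<ge>r0. \<exists>b. good r b \<and> \<bar>horo b g\<bar> > int K0"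
  proof (rule ccontr)
    assume "\<not> ?thesis"
    then have "\<forall>g\<in>ball L. \<exists>r0. \<forall>r\<ge>r0. \<forall>b. good r b \<longrightarrow> \<bar>horo b g\<bar> \<le> int K0"
      by (metis not_le)
    then obtain r0 where r0: "\<And>g r b. g \<in> ball L \<Longrightarrow> r \<ge> r0 g \<Longrightarrow> good r b \<Longrightarrow> \<bar>horo b g\<bar> \<le> int K0"
      by metis
    define r where "r = Max (r0 ` ball L) + (L + K0 + 2 * D + c)"
    obtain b where b: "good r b" using ex_good by blast
    have "r0 g \<le> r" if "g \<in> ball L" for g
      using Max_ge[of "r0 ` ball L" "r0 g"] that fin_ball unfolding r_def by (simp add: trans_le_add1)
    then have "ball L \<subseteq> {g \<in> carrier G. len g \<le> L \<and> \<bar>horo b g\<bar> \<le> int K0}"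
      using r0 b unfolding ball_def by auto
    then have "card (ball L) \<le> card {g \<in> carrier G. len g \<le> L \<and> \<bar>horo b g\<bar> \<le> int K0}"
      by (intro card_mono finite_subset[OF _ fin_ball[of L]]) (auto simp: ball_def)
    also have "\<dots> \<le> card (ball (K0 + 2 * D))"
      unfolding ball_def
      by (rule horo_card[OF fp, of b r c]) (use b in \<open>auto simp: good_def r_def\<close>)
    finally show False using large by simp
  qed
  then obtain g where g: "g \<in> carrier G" "len g \<le> L"
    and g_good: "\<And>r0. \<exists>r\<ge>r0. \<exists>b. good r b \<and> \<bar>horo b g\<bar> > int K0" unfolding ball_def by blast
  define H where "H = generate G (carrier G \<inter> {g})"
  have H: "subgroup H G" unfolding H_def by (intro generate_is_subgroup) auto
  have cyc: "cyclic_group (G\<lparr>carrier := H\<rparr>)"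
    using cyclic_group_generated[of g] unfolding subgroup_generated_def H_def .
  have "g \<in> H" unfolding H_def using g by (intro generate.incl) auto
  then have pow_H: "g [^] n \<in> H" for n :: int by (rule subgroup_int_pow_closed[OF H])
  define K where "K = L + D"
  have "finite (rcosets H)"
  proof (rule ccontr)
    assume "infinite (rcosets H)"
    then obtain F where F: "F \<subseteq> rcosets H" "finite F" "card F = Suc (card (ball (K + 2 * D)))"
      using infinite_arbitrarily_large by metis
    have "\<forall>X\<in>F. \<exists>x\<in>carrier G. X = H #> x" using F(1) unfolding RCOSETS_def by auto
    then obtain rep where rep: "\<And>X. X \<in> F \<Longrightarrow> rep X \<in> carrier G \<and> X = H #> rep X" by metis
    define m where "m = Max (len ` rep ` F)"
    have m: "len (rep X) \<le> m" if "X \<in> F" for X unfolding m_def using F(2) that by (intro Max_ge) auto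
    \<comment> \<open>The descent starting from \<open>rep X\<close> takes at most \<open>m\<close>
      steps, each of length at most \<open>L\<close>.\<close>
    define \<rho> where "\<rho> = m + L * m"
    obtain r b where rb: "r \<ge> \<rho> + K + 2 * D + c + L" "good r b" "\<bar>horo b g\<bar> > int K0"
      using g_good by blast
    have fixed': "2 * r + dst b (w \<otimes> b) \<le> len b + len (w \<otimes> b) + c" if "w \<in> carrier G" "len w \<le> r" for w
      using rb(2) that unfolding good_def by blast
    have bc: "b \<in> carrier G" using rb(2) by (simp add: good_def)
    have "\<exists>y\<in>X. y \<in> carrier G \<and> len y \<le> \<rho> \<and> \<bar>horo b y\<bar> \<le> int K" if X: "X \<in> F" for X
    proof -
      let ?x = "rep X"
      have x: "?x \<in> carrier G" using rep X by blast
      have "\<bar>horo b ?x\<bar> \<le> int (K + m)" using horo_abs_le[OF bc x] m[OF X] by simp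
      moreover have "len ?x + L * m + L + c \<le> r" using m[OF X] rb(1) unfolding \<rho>_def by simp
      moreover have "\<bar>horo b g\<bar> > 2 * int D" using rb(3) by (simp add: K0_def)
      ultimately obtain n :: int
        where n: "\<bar>horo b (g [^] n \<otimes> ?x)\<bar> \<le> int K" "len (g [^] n \<otimes> ?x) \<le> len ?x + L * m"
        using horo_descent[OF fp bc fixed' g _ K_def x, of m] by blast
      have "g [^] n \<otimes> ?x \<in> H #> ?x" using pow_H unfolding r_coset_def by blast
      then show ?thesis using n rep[OF X] m[OF X] g x unfolding \<rho>_def
        by (intro bexI[of _ "g [^] n \<otimes> ?x"]) auto
    qed
    then obtain f where f: "\<And>X. X \<in> F \<Longrightarrow> f X \<in> X \<and> f X \<in> carrier G \<and> len (f X) \<le> \<rho> \<and> \<bar>horo b (f X)\<bar> \<le> int K"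
      by metis
    have "inj_on f F"
    proof (rule inj_onI)
      fix X Y assume XY: "X \<in> F" "Y \<in> F" "f X = f Y"
      then have "X \<inter> Y \<noteq> {}" using f[of X] f[of Y] by auto
      then show "X = Y" using rcos_disjoint[OF H] XY F(1) unfolding pairwise_def disjnt_def by blast
    qed
    then have "card F \<le> card {y \<in> carrier G. len y \<le> \<rho> \<and> \<bar>horo b y\<bar> \<le> int K}"
      using f by (intro card_inj_on_le[of f] finite_subset[OF _ finite_len_ball[of \<rho>]]) auto
    also have "\<dots> \<le> card (ball (K + 2 * D))"
      unfolding ball_def
      by (rule horo_card[OF fp bc fixed']) (use rb(1) in auto)
    finally show False using F(3) by simp
  qed
  then show ?thesis using H cyc unfolding elementary_def by blast
qed

text \<open>The length of \<open>a \<otimes> y \<otimes> b\<close> is the distance between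
  \<open>inv a\<close> and \<open>y \<otimes> b\<close>, so lack of cancellation means a small
  overlap of these two points. The additional loss \<open>R\<close> accounts for comparing
  \<open>y \<otimes> b\<close> with \<open>b\<close>.\<close>

lemma insert_without_cancellation:
  assumes t: "thin \<delta>" and ne: "\<not> elementary G"
  obtains R C where "\<And>a b. a \<in> carrier G \<Longrightarrow> b \<in> carrier G \<Longrightarrow>
    \<exists>y\<in>carrier G. len y \<le> R \<and> len a + len b \<le> len (a \<otimes> y \<otimes> b) + C"
proof -
  have "\<not> (\<forall>R. \<exists>x\<in>carrier G. \<exists>b\<in>carrier G. \<forall>y\<in>carrier G. len y \<le> R \<longrightarrow>
      dst x (y \<otimes> b) + (6 * \<delta> + 2) < len x + len (y \<otimes> b))"
    using almost_fixed_imp_elementary[OF thin_imp_four_point[OF t] almost_fixed_point[OF t]] ne by blast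
  then obtain R where R: "\<And>x b. x \<in> carrier G \<Longrightarrow> b \<in> carrier G \<Longrightarrow>
      \<exists>y\<in>carrier G. len y \<le> R \<and> len x + len (y \<otimes> b) \<le> dst x (y \<otimes> b) + (6 * \<delta> + 2)"
    by (meson not_le)
  have "\<exists>y\<in>carrier G. len y \<le> R \<and> len a + len b \<le> len (a \<otimes> y \<otimes> b) + (6 * \<delta> + 2 + R)"
    if ab: "a \<in> carrier G" "b \<in> carrier G" for a b
  proof -
    obtain y where y: "y \<in> carrier G" "len y \<le> R" "len (inv a) + len (y \<otimes> b) \<le> dst (inv a) (y \<otimes> b) + (6 * \<delta> + 2)"
      using R[of "inv a" b] ab by auto
    have "b = inv y \<otimes> (y \<otimes> b)" using y ab by (simp add: m_assoc[symmetric])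
    then have "len b \<le> len y + len (y \<otimes> b)" using len_mult[of "inv y" "y \<otimes> b"] y ab by simp
    moreover have "dst (inv a) (y \<otimes> b) = len (a \<otimes> y \<otimes> b)" using y ab by (simp add: word_dist_def m_assoc)
    ultimately show ?thesis using y ab by (intro bexI[of _ y]) auto
  qed
  then show ?thesis using that by blast
qed

end

section \<open>Purely exponential growth of spheres\<close>

lemma pow_bounded_imp_le_one:
  fixes x M :: real
  assumes "\<And>k::nat. x ^ k \<le> M"
  shows "x \<le> 1"
proof (rule ccontr)
  assume "\<not> x \<le> 1"
  then obtain k where "M < x ^ k" using real_arch_pow[of x M] by auto
  then show False using assms[of k] by simp
qed

text \<open>By definition the infimum of the n-th roots gives the lower bound, and by
  submultiplicativity every larger \<mu> bounds the growth up to a factor. Near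
  supermultiplicativity yields \<open>c n ^ k \<le> L ^ k * c (k * n)\<close>. Comparing the two as
  \<open>k\<close> grows leaves \<open>c n \<le> L * \<mu> ^ n\<close> for all \<mu> above the
  infimum, hence also for the infimum.\<close>

lemma purely_exponential_growth:
  fixes \<gamma> :: "nat \<Rightarrow> real"
  assumes ge1: "\<And>n. 1 \<le> \<gamma> n"
    and sub: "\<And>n m. \<gamma> (n + m) \<le> \<gamma> n * \<gamma> m"
    and super: "\<And>n m. \<gamma> n * \<gamma> (m + C) \<le> K * \<gamma> (n + m)"
  obtains lam A where "lam \<ge> 1" "\<And>n. lam ^ n \<le> \<gamma> n" "\<And>n. \<gamma> n \<le> A * lam ^ n"
proof -
  define R where "R = {root n (\<gamma> n) |n. n \<ge> 1}"
  define lam where "lam = Inf R"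
  have R1: "x \<ge> 1" if "x \<in> R" for x using that ge1 unfolding R_def by (auto simp: real_root_ge_1_iff)
  have R_ne: "R \<noteq> {}" unfolding R_def by auto
  have bdd: "bdd_below R" using R1 by (intro bdd_belowI) auto
  have lam1: "lam \<ge> 1" unfolding lam_def using R_ne R1 by (intro cInf_greatest) auto
  have lower: "lam ^ n \<le> \<gamma> n" for n
  proof (cases "n = 0")
    case False
    then have "lam \<le> root n (\<gamma> n)" unfolding lam_def by (intro cInf_lower bdd) (auto simp: R_def)
    then have "lam ^ n \<le> root n (\<gamma> n) ^ n" using lam1 by (intro power_mono) auto
    also have "\<dots> = \<gamma> n" using False ge1[of n] by (intro real_root_pow_pos2) auto
    finally show ?thesis .
  qed (use ge1 in simp)
  define L where "L = max K 1"
  have L: "L \<ge> 1" "K \<le> L" by (auto simp: L_def)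
  define c where "c n = \<gamma> (n + C)" for n
  have c1: "c n \<ge> 1" for n unfolding c_def by (rule ge1)
  have cmul: "c n * c m \<le> L * c (n + m)" for n m
  proof -
    have "c n * c m \<le> K * c (n + m)" using super[of "n + C" m] unfolding c_def by (simp add: add_ac)
    also have "\<dots> \<le> L * c (n + m)" using L(2) c1[of "n + m"] by (intro mult_right_mono) auto
    finally show ?thesis .
  qed
  have cpow: "c n ^ k \<le> L ^ k * c (k * n)" for n k
  proof (induction k)
    case 0
    then show ?case using c1[of 0] by simp
  next
    case (Suc k)
    have "c n ^ Suc k \<le> c n * (L ^ k * c (k * n))"
      using Suc c1[of n] by (simp add: mult_left_mono)
    also have "\<dots> = L ^ k * (c n * c (k * n))" by simp
    also have "\<dots> \<le> L ^ k * (L * c (n + k * n))" using L(1) by (intro mult_left_mono cmul) auto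
    finally show ?case by (simp add: mult_ac)
  qed
  have upper: "c n \<le> L * \<mu> ^ n" if \<mu>: "\<mu> > lam" for \<mu> n
  proof -
    obtain p where p: "p \<ge> 1" "root p (\<gamma> p) < \<mu>"
      using cInf_lessD[OF R_ne, of \<mu>] \<mu> unfolding lam_def R_def by auto
    have \<mu>1: "\<mu> \<ge> 1" using lam1 \<mu> by simp
    have "\<gamma> p = root p (\<gamma> p) ^ p" using p(1) ge1[of p] by (intro real_root_pow_pos2[symmetric]) auto
    also have "\<dots> \<le> \<mu> ^ p" using p ge1[of p] by (intro power_mono real_root_ge_zero) auto
    finally have gp: "\<gamma> p \<le> \<mu> ^ p" .
    define M where "M = (\<Sum>r<p. \<gamma> r)"
    have M: "\<gamma> r \<le> M" if "r < p" for r
      unfolding M_def using that ge1 by (intro member_le_sum) (auto intro: order_trans[OF zero_le_one])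
    have M0: "M \<ge> 0" using M[of 0] ge1[of 0] p(1) by simp
    have "\<gamma> (q * p + r) \<le> M * \<mu> ^ (q * p + r)" if r: "r < p" for q r
    proof (induction q)
      case 0
      have "M * 1 \<le> M * \<mu> ^ r" using M0 \<mu>1 by (intro mult_left_mono) auto
      then show ?case using M[OF r] by simp
    next
      case (Suc q)
      have "\<gamma> (Suc q * p + r) \<le> \<gamma> p * \<gamma> (q * p + r)" using sub[of p "q * p + r"] by (simp add: add_ac)
      also have "\<dots> \<le> \<mu> ^ p * (M * \<mu> ^ (q * p + r))"
        using gp Suc ge1[of "q * p + r"] \<mu>1 by (intro mult_mono) auto
      also have "\<dots> = M * \<mu> ^ (Suc q * p + r)" by (simp add: power_add mult_ac)
      finally show ?case .
    qed
    then have g: "\<gamma> k \<le> M * \<mu> ^ k" for k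
      using p(1) div_mult_mod_eq[of k p] mod_less_divisor[of p k] by (metis less_le_trans zero_less_one)
    have "(c n / (L * \<mu> ^ n)) ^ k \<le> M * \<mu> ^ C" for k
    proof -
      have "c n ^ k \<le> L ^ k * (M * \<mu> ^ (k * n + C))"
        using cpow[of n k] g[of "k * n + C"] L(1) unfolding c_def
        by (meson mult_left_mono order_trans zero_le_power zero_le_one)
      also have "\<dots> = (M * \<mu> ^ C) * (L * \<mu> ^ n) ^ k"
        by (simp add: power_add power_mult_distrib power_mult[symmetric] mult_ac)
      finally show ?thesis using L(1) \<mu>1 by (simp add: power_divide divide_le_eq)
    qed
    then have "c n / (L * \<mu> ^ n) \<le> 1" by (rule pow_bounded_imp_le_one)
    then show ?thesis using L(1) \<mu>1 by (simp add: divide_le_eq)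
  qed
  have cle: "c n \<le> L * lam ^ n" for n
  proof (rule LIMSEQ_le_const)
    show "(\<lambda>i. L * (lam + inverse (real (Suc i))) ^ n) \<longlonglongrightarrow> L * lam ^ n"
      using LIMSEQ_inverse_real_of_nat_add[of lam] by (intro tendsto_intros)
    show "\<exists>N. \<forall>i\<ge>N. c n \<le> L * (lam + inverse (real (Suc i))) ^ n" by (intro exI allI impI upper) simp
  qed
  define A where "A = L + (\<Sum>n<C. \<gamma> n)"
  have s0: "(\<Sum>n<C. \<gamma> n) \<ge> 0" using ge1 by (intro sum_nonneg) (auto intro: order_trans[OF zero_le_one])
  have A0: "A \<ge> 0" using s0 L by (simp add: A_def)
  have "\<gamma> n \<le> A * lam ^ n" for n
  proof (cases "n < C")
    case True
    then have "\<gamma> n \<le> (\<Sum>n<C. \<gamma> n)"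
      using ge1 by (intro member_le_sum) (auto intro: order_trans[OF zero_le_one])
    also have "\<dots> \<le> A * 1" using L by (simp add: A_def)
    also have "\<dots> \<le> A * lam ^ n" using A0 lam1 by (intro mult_left_mono) auto
    finally show ?thesis .
  next
    case False
    then have "\<gamma> n \<le> L * lam ^ (n - C)" using cle[of "n - C"] by (simp add: c_def)
    also have "\<dots> \<le> A * lam ^ n"
      using A0 lam1 L s0 by (intro mult_mono power_increasing) (auto simp: A_def)
    finally show ?thesis .
  qed
  then show ?thesis using that lam1 lower by blast
qed

context cayley
begin

abbreviation "sphere n \<equiv> word_sphere G S n"

lemma sphere_iff: "g \<in> sphere n \<longleftrightarrow> g \<in> carrier G \<and> len g = n"
  by (simp add: word_sphere_def)

lemma finite_sphere: "finite (sphere n)"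
  by (rule finite_subset[OF _ finite_len_ball[of n]]) (auto simp: sphere_iff)

lemma card_sphere_add_le: "card (sphere (n + m)) \<le> card (sphere n) * card (sphere m)"
proof -
  have "sphere (n + m) \<subseteq> (\<lambda>(a, b). a \<otimes> b) ` (sphere n \<times> sphere m)"
  proof
    fix g assume g: "g \<in> sphere (n + m)"
    then obtain a b where "a \<in> carrier G" "b \<in> carrier G" "g = a \<otimes> b" "len a = n" "len b = len g - n"
      using split_len[of g n] by (auto simp: sphere_iff)
    then show "g \<in> (\<lambda>(a, b). a \<otimes> b) ` (sphere n \<times> sphere m)" using g
      by (intro rev_image_eqI[of "(a, b)"]) (auto simp: sphere_iff)
  qed
  then have "card (sphere (n + m)) \<le> card (sphere n \<times> sphere m)"
    using finite_sphere by (intro surj_card_le) auto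
  then show ?thesis by (simp add: card_cartesian_product)
qed

lemma sphere_nonempty:
  assumes "infinite (carrier G)"
  shows "sphere n \<noteq> {}"
proof -
  have "\<not> carrier G \<subseteq> {g \<in> carrier G. len g \<le> n}" using assms finite_len_ball finite_subset by blast
  then obtain g where g: "g \<in> carrier G" "n \<le> len g"
    by (metis (mono_tags, lifting) linear mem_Collect_eq subsetI)
  then obtain a where "a \<in> carrier G" "len a = n" by (metis split_len)
  then show ?thesis by (auto simp: sphere_iff)
qed

text \<open>The points \<open>x\<close> and \<open>p\<close> have the same distance from the
  identity and nearly the same distance from \<open>x \<otimes> w\<close>, and both almost lie
  between these two. In a hyperbolic space such points are close.\<close>

lemma prefix_near:
  assumes fp: "four_point D" and xw: "x \<in> carrier G" "w \<in> carrier G" "len x + len w \<le> len (x \<otimes> w) + C"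
    and p: "p \<in> seg \<one> (x \<otimes> w)" "len p = len x"
  shows "dst x p \<le> C + D"
proof -
  define g where "g = x \<otimes> w"
  have g: "g \<in> carrier G" using xw by (simp add: g_def)
  have pc: "p \<in> carrier G" "len p + dst p g = len g" using segD[OF p(1)] dst_one g
    unfolding g_def[symmetric] by auto
  have "dst x p + dst g \<one> \<le> max (dst x g + dst p \<one>) (dst g p + dst x \<one>) + D"
    by (rule four_pointD[OF fp]) (use xw g pc in auto)
  moreover have "dst x g = len w" unfolding g_def using xw(1,2) by (rule dst_right_mult)
  ultimately show ?thesis
    using xw(3) pc p(2) dst_sym[OF pc(1) g] dst_to_one[OF g] dst_to_one[OF pc(1)] dst_to_one[OF xw(1)]
    unfolding g_def[symmetric] by simp
qed

text \<open>Cut a geodesic to \<open>a \<otimes> y \<otimes> b\<close> at length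
  \<open>n + m\<close>. The cut point determines \<open>(a, b)\<close> up to boundedly many choices,
  as \<open>a\<close> is near the point at distance \<open>n\<close> on the way to it. The shift by
  \<open>C\<close> makes up for the length lost in the insertion, so that the cut is
  possible.\<close>

lemma card_sphere_supermult:
  assumes fp: "four_point D"
    and ins: "\<And>a b. a \<in> carrier G \<Longrightarrow> b \<in> carrier G \<Longrightarrow>
      \<exists>y\<in>carrier G. len y \<le> R \<and> len a + len b \<le> len (a \<otimes> y \<otimes> b) + C"
  obtains K where "\<And>n m. card (sphere n) * card (sphere (m + C)) \<le> K * card (sphere (n + m))"
proof -
  define B where "B k = {g \<in> carrier G. len g \<le> k}" for k
  have finB: "finite (B k)" for k unfolding B_def by (rule finite_len_ball)
  have "card (sphere n) * card (sphere (m + C))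
      \<le> (card (B (C + R + D)) * card (B (R + C)) * card (B R)) * card (sphere (n + m))" for n m
  proof -
    have "\<exists>p. p \<in> seg \<one> g \<and> len p = n" if "g \<in> sphere (n + m)" for g
    proof -
      have "g \<in> carrier G" "n \<le> dst \<one> g" using that by (auto simp: sphere_iff dst_one)
      then obtain p where "p \<in> seg \<one> g" "dst \<one> p = n" using seg_at[of \<one> g n] by auto
      then show ?thesis using segD dst_one by metis
    qed
    then obtain \<alpha> where \<alpha>: "\<And>g. g \<in> sphere (n + m) \<Longrightarrow> \<alpha> g \<in> seg \<one> g \<and> len (\<alpha> g) = n" by metis
    \<comment> \<open>The decoding map: \<open>z\<close> corrects the prefix
      \<open>\<alpha> g\<close> to \<open>a\<close>, \<open>u\<close> restores the part cut off, and
      \<open>y\<close> is the inserted element.\<close>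
    define F where "F = (\<lambda>(g, z, u, y). (\<alpha> g \<otimes> z, inv y \<otimes> (inv (\<alpha> g \<otimes> z) \<otimes> (g \<otimes> u))))"
    let ?dom = "sphere (n + m) \<times> B (C + R + D) \<times> B (R + C) \<times> B R"
    have "sphere n \<times> sphere (m + C) \<subseteq> F ` ?dom"
    proof (clarify)
      fix a b assume "a \<in> sphere n" "b \<in> sphere (m + C)"
      then have ab: "a \<in> carrier G" "len a = n" "b \<in> carrier G" "len b = m + C" by (auto simp: sphere_iff)
      obtain y where y: "y \<in> carrier G" "len y \<le> R" "len a + len b \<le> len (a \<otimes> y \<otimes> b) + C"
        using ins[OF ab(1,3)] by blast
      define h where "h = a \<otimes> (y \<otimes> b)"
      have hc: "h \<in> carrier G" using ab y by (simp add: h_def)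
      have lh: "n + m \<le> len h" "len h \<le> n + R + m + C" "len a + len (y \<otimes> b) \<le> len h + (C + R)"
        using y ab len_mult[of a "y \<otimes> b"] len_mult[of y b] by (auto simp: h_def m_assoc)
      obtain g where g: "g \<in> seg \<one> h" "dst \<one> g = n + m" using seg_at[of \<one> h "n + m"] hc lh(1)
        by (auto simp: dst_one)
      have gc: "g \<in> carrier G" "len g + dst g h = len h" "len g = n + m"
        using segD[OF g(1)] g(2) dst_one hc by auto
      have gs: "g \<in> sphere (n + m)" using gc by (simp add: sphere_iff)
      have a1: "\<alpha> g \<in> carrier G" "len (\<alpha> g) = n" "len (\<alpha> g) + dst (\<alpha> g) g = len g"
        using \<alpha>[OF gs] segD[of "\<alpha> g" \<one> g] dst_one gc(1) by auto
      have "len (\<alpha> g) + dst (\<alpha> g) h = len h"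
        using dst_tri[of "\<alpha> g" g h] dst_tri[of \<one> "\<alpha> g" h] a1 gc hc by (auto simp: dst_one)
      then have "\<alpha> g \<in> seg \<one> (a \<otimes> (y \<otimes> b))" using a1 hc unfolding h_def[symmetric]
        by (simp add: seg_def dst_one)
      then have near: "dst a (\<alpha> g) \<le> C + R + D"
        using lh(3) ab y a1(2) unfolding h_def by (intro prefix_near[OF fp]) auto
      define z where "z = inv (\<alpha> g) \<otimes> a"
      define u where "u = inv g \<otimes> h"
      have z: "z \<in> B (C + R + D)" "\<alpha> g \<otimes> z = a"
        using near dst_sym[OF ab(1) a1(1)] a1(1) ab(1) unfolding z_def B_def word_dist_def
          by (auto simp: m_assoc[symmetric])
      have u: "u \<in> B (R + C)" "g \<otimes> u = h"
        using gc lh(2) hc unfolding u_def B_def word_dist_def by (auto simp: m_assoc[symmetric])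
      have "inv a \<otimes> h = y \<otimes> b" unfolding h_def using ab y by (simp add: m_assoc[symmetric])
      then have "inv y \<otimes> (inv a \<otimes> h) = b" using ab y by (simp add: m_assoc[symmetric])
      then have "F (g, z, u, y) = (a, b)" unfolding F_def by (simp add: z(2) u(2))
      moreover have "(g, z, u, y) \<in> ?dom" using gs z u y by (simp add: B_def)
      ultimately show "(a, b) \<in> F ` ?dom" by (metis image_eqI)
    qed
    moreover have "finite ?dom" using finite_sphere finB by blast
    ultimately have "card (sphere n \<times> sphere (m + C)) \<le> card ?dom" by (metis surj_card_le)
    then show ?thesis by (simp add: card_cartesian_product mult_ac)
  qed
  then show ?thesis using that by blast
qed

lemma sphere_growth:
  assumes fp: "four_point D" and inf: "infinite (carrier G)"
    and ins: "\<And>a b. a \<in> carrier G \<Longrightarrow> b \<in> carrier G \<Longrightarrow>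
      \<exists>y\<in>carrier G. len y \<le> R \<and> len a + len b \<le> len (a \<otimes> y \<otimes> b) + C"
  obtains lam A :: real
    where "lam \<ge> 1" "\<And>n. lam ^ n \<le> real (card (sphere n))" "\<And>n. real (card (sphere n)) \<le> A * lam ^ n"
proof -
  obtain K where K: "\<And>n m. card (sphere n) * card (sphere (m + C)) \<le> K * card (sphere (n + m))"
    using card_sphere_supermult[OF fp ins] by blast
  have "1 \<le> real (card (sphere n))" for n
    using sphere_nonempty[OF inf, of n] finite_sphere[of n] by (simp add: Suc_le_eq card_gt_0_iff)
  moreover have "real (card (sphere (n + m))) \<le> real (card (sphere n)) * real (card (sphere m))" for n m
    using card_sphere_add_le[of n m] by (metis of_nat_le_iff of_nat_mult)
  moreover have "real (card (sphere n)) * real (card (sphere (m + C))) \<le> real K * real (card (sphere (n + m)))" for n m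
    using K[of n m] by (metis of_nat_le_iff of_nat_mult)
  ultimately show ?thesis
    using purely_exponential_growth[of "\<lambda>n. real (card (sphere n))" C "real K"] that by blast
qed

end

section \<open>Normal forms and states of a combable function\<close>

lemma deterministic_awalk_unique:
  assumes wf: "wf_digraph \<Gamma>"
    and det: "\<forall>e\<in>arcs \<Gamma>. \<forall>f\<in>arcs \<Gamma>. tail \<Gamma> e = tail \<Gamma> f \<and> lab e = lab f \<longrightarrow> e = f"
  shows "\<lbrakk>pre_digraph.awalk \<Gamma> u p v; pre_digraph.awalk \<Gamma> u q w; map lab p = map lab q\<rbrakk> \<Longrightarrow> p = q"
proof (induction p arbitrary: u q)
  case (Cons e p)
  interpret wf_digraph \<Gamma> by (rule wf)
  from Cons.prems(3) obtain f q' where q: "q = f # q'" "lab f = lab e" "map lab q' = map lab p"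
    by (cases q) auto
  have e: "e \<in> arcs \<Gamma>" "u = tail \<Gamma> e" "awalk (head \<Gamma> e) p v" using Cons.prems(1) by (auto simp: awalk_Cons_iff)
  have f: "f \<in> arcs \<Gamma>" "u = tail \<Gamma> f" "awalk (head \<Gamma> f) q' w" using Cons.prems(2) unfolding q(1)
    by (auto simp: awalk_Cons_iff)
  have "e = f" using det e f q(2) by metis
  then show ?case using Cons.IH[OF e(3)] f(3) q by simp
qed simp

text \<open>This eliminates the digraph. The state \<open>q x\<close> is the final vertex of the
  path that reads the normal form of \<open>x\<close>. Equal states admit the same continuations and
  give equal increments, since an increment is the sum over the vertices visited by the
  continuation.\<close>

lemma combable_normal_form:
  fixes G (structure)
  assumes S: "cayley G S" and comb: "combing G S L" and wc: "weakly_combable G S L \<phi>"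
  obtains nf :: "'a \<Rightarrow> 'a list" and q :: "'a \<Rightarrow> nat" where
    "finite (q ` carrier G)"
    "\<And>x. x \<in> carrier G \<Longrightarrow> nf x \<in> lists S \<and> word_eval G (nf x) = x \<and> length (nf x) = word_length G S x"
    "\<And>x u v. x \<in> carrier G \<Longrightarrow> nf x = u @ v \<Longrightarrow> nf (word_eval G u) = u"
    "\<And>x x' v. \<lbrakk>x \<in> carrier G; x' \<in> carrier G; v \<in> lists S; q x = q x'; nf (x \<otimes> word_eval G v) = nf x @ v\<rbrakk> \<Longrightarrow>
       nf (x' \<otimes> word_eval G v) = nf x' @ v \<and> \<phi> (x' \<otimes> word_eval G v) - \<phi> x' = \<phi> (x \<otimes> word_eval G v) - \<phi> x"
proof -
  interpret cayley G S by (rule S)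
  have L: "L \<subseteq> lists S" "prefix_closed L" "bij_betw ev L (carrier G)" "\<And>w. w \<in> L \<Longrightarrow> length w = len (ev w)"
    using comb by (auto simp: combing_def)
  obtain \<Gamma> :: "(nat, nat) pre_digraph" and lab v1 and d :: "nat \<Rightarrow> int" where
    par: "parameterizes S \<Gamma> lab v1 L" and
    \<phi>: "\<And>w p v. w \<in> L \<Longrightarrow> pre_digraph.awalk \<Gamma> v1 p v \<Longrightarrow> map lab p = w \<Longrightarrow>
           \<phi> (ev w) = (\<Sum>i=0..length w. d (pre_digraph.awalk_verts \<Gamma> v1 p ! i))"
    using wc unfolding weakly_combable_def by blast
  have fin: "fin_digraph \<Gamma>" and det: "\<forall>e\<in>arcs \<Gamma>. \<forall>f\<in>arcs \<Gamma>. tail \<Gamma> e = tail \<Gamma> f \<and> lab e = lab f \<longrightarrow> e = f"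
    and Leq: "L = {map lab p |p v. pre_digraph.awalk \<Gamma> v1 p v}" using par by (auto simp: parameterizes_def)
  interpret \<Gamma>: fin_digraph \<Gamma> by (rule fin)
  define nf where "nf x = inv_into L ev x" for x
  have nfL: "nf x \<in> L" "ev (nf x) = x" if "x \<in> carrier G" for x
    using L(3) that unfolding nf_def bij_betw_def by (auto intro: inv_into_into f_inv_into_f)
  have nf_ev: "nf (ev w) = w" if "w \<in> L" for w
    using L(3) that unfolding nf_def bij_betw_def by (simp add: inv_into_f_f)
  have ex: "\<exists>p. \<Gamma>.awalk v1 p (\<Gamma>.awlast v1 p) \<and> map lab p = nf x" if x: "x \<in> carrier G" for x
  proof -
    obtain p v where p: "nf x = map lab p" "\<Gamma>.awalk v1 p v" using nfL(1)[OF x] unfolding Leq by blast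
    then have "\<Gamma>.awlast v1 p = v" by blast
    then show ?thesis using p by auto
  qed
  then obtain pth where pth: "\<And>x. x \<in> carrier G \<Longrightarrow> \<Gamma>.awalk v1 (pth x) (\<Gamma>.awlast v1 (pth x)) \<and> map lab (pth x) = nf x"
    by metis
  define q where "q x = \<Gamma>.awlast v1 (pth x)" for x
  have val: "\<phi> x = sum_list (map d (\<Gamma>.awalk_verts v1 p))"
    if x: "x \<in> carrier G" "\<Gamma>.awalk v1 p v" "map lab p = nf x" for x p v
  proof -
    have "length (\<Gamma>.awalk_verts v1 p) = Suc (length (nf x))" using x(3)
      by (metis \<Gamma>.length_awalk_verts length_map)
    then have "sum_list (map d (\<Gamma>.awalk_verts v1 p)) = (\<Sum>i=0..length (nf x). d (\<Gamma>.awalk_verts v1 p ! i))"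
      by (simp add: sum_list_sum_nth atLeastLessThanSuc_atLeastAtMost)
    then show ?thesis using \<phi>[OF nfL(1)[OF x(1)] x(2,3)] nfL(2)[OF x(1)] by simp
  qed
  show ?thesis
  proof (rule that[of q nf])
    show "finite (q ` carrier G)"
    proof (rule finite_subset[OF _ \<Gamma>.finite_verts])
      show "q ` carrier G \<subseteq> verts \<Gamma>" unfolding q_def using pth \<Gamma>.awalk_last_in_verts by blast
    qed
    show "nf x \<in> lists S \<and> ev (nf x) = x \<and> length (nf x) = len x" if "x \<in> carrier G" for x
      using nfL[OF that] L(1) L(4)[of "nf x"] by auto
    show "nf (ev u) = u" if "x \<in> carrier G" "nf x = u @ v" for x u v
    proof (rule nf_ev)
      show "u \<in> L" using L(2) nfL(1)[OF that(1)] unfolding that(2) prefix_closed_def by auto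
    qed
    fix x x' v assume x: "x \<in> carrier G" "x' \<in> carrier G" "v \<in> lists S" "q x = q x'" "nf (x \<otimes> ev v) = nf x @ v"
    have vc: "ev v \<in> carrier G" using x(3) ev_lists by blast
    let ?y = "x \<otimes> ev v"
    have y: "?y \<in> carrier G" using x vc by simp
    obtain p1 p2 where p: "pth ?y = p1 @ p2" "map lab p1 = nf x" "map lab p2 = v"
      using pth[OF y] x(5) map_eq_append_conv by metis
    have aw: "\<Gamma>.awalk v1 (p1 @ p2) (\<Gamma>.awlast v1 (pth ?y))" using pth[OF y] p(1) by metis
    then have w1: "\<Gamma>.awalk v1 p1 (\<Gamma>.awlast v1 p1)" and w2: "\<Gamma>.awalk (\<Gamma>.awlast v1 p1) p2 (\<Gamma>.awlast v1 (pth ?y))"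
      by (simp_all only: \<Gamma>.awalk_append_iff)
    have "p1 = pth x"
      using deterministic_awalk_unique[OF \<Gamma>.wf_digraph det w1] pth[OF x(1)] p(2) by metis
    then have l1: "\<Gamma>.awlast v1 p1 = q x'" using x(4) by (simp add: q_def)
    have aw': "\<Gamma>.awalk v1 (pth x' @ p2) (\<Gamma>.awlast v1 (pth ?y))"
      using pth[OF x(2)] w2 unfolding l1 q_def by (intro \<Gamma>.awalk_appendI) auto
    have lab': "map lab (pth x' @ p2) = nf x' @ v" using pth[OF x(2)] p(3) by simp
    then have inL: "nf x' @ v \<in> L" unfolding Leq lab'[symmetric] using aw' by blast
    have "ev (nf x' @ v) = ev (nf x') \<otimes> ev v"
      using nfL(1)[OF x(2)] L(1) x(3) lists_carrier by (intro ev_append) blast+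
    then have e': "ev (nf x' @ v) = x' \<otimes> ev v" using nfL(2)[OF x(2)] by simp
    have nf': "nf (x' \<otimes> ev v) = nf x' @ v" using nf_ev[OF inL] e' by simp
    have y': "x' \<otimes> ev v \<in> carrier G" using x vc by simp
    have "\<phi> ?y = sum_list (map d (\<Gamma>.awalk_verts v1 (p1 @ p2)))"
      using aw x(5) p by (intro val[OF y]) auto
    \<comment> \<open>\<open>tl\<close> drops the vertex shared by the two walks, which is already
      counted in \<open>\<phi> x\<close>.\<close>
    also have "\<dots> = \<phi> x + sum_list (map d (tl (\<Gamma>.awalk_verts (q x') p2)))"
      unfolding \<Gamma>.awalk_verts_append[OF aw] l1 using val[OF x(1) w1 p(2)] by simp
    finally have s1: "\<phi> ?y = \<phi> x + sum_list (map d (tl (\<Gamma>.awalk_verts (q x') p2)))" .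
    have "\<phi> (x' \<otimes> ev v) = sum_list (map d (\<Gamma>.awalk_verts v1 (pth x' @ p2)))"
      using aw' lab' nf' by (intro val[OF y']) auto
    also have "\<dots> = \<phi> x' + sum_list (map d (tl (\<Gamma>.awalk_verts (q x') p2)))"
      unfolding \<Gamma>.awalk_verts_append[OF aw'] q_def[of x', symmetric]
      using val[OF x(2) conjunct1[OF pth[OF x(2)]] conjunct2[OF pth[OF x(2)]]] by simp
    finally show "nf (x' \<otimes> ev v) = nf x' @ v \<and> \<phi> (x' \<otimes> ev v) - \<phi> x' = \<phi> ?y - \<phi> x"
      using s1 nf' by simp
  qed
qed

section \<open>The tree of geodesics of a combable function\<close>

context cayley
begin

definition rank :: "'a \<Rightarrow> nat" where
  "rank = (SOME f. inj_on f S)"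

lemma rank_inj: "inj_on rank S"
  unfolding rank_def
  using finite_imp_inj_to_nat_seg[OF S_finite] by (metis (mono_tags) someI_ex)

text \<open>Every \<open>g \<noteq> \<one>\<close> has as its parent \<open>g s\<^sup>-\<^sup>1\<close> for the letter \<open>s\<close> of least rank with which a geodesic
  word for \<open>g\<close> can end.\<close>

definition downs :: "'a \<Rightarrow> 'a \<Rightarrow> bool" where
  "downs x s \<longleftrightarrow> s \<in> S \<and> len (x \<otimes> s) = Suc (len x) \<and>
     (\<forall>t\<in>S. rank t < rank s \<longrightarrow> len (x \<otimes> s \<otimes> inv t) \<noteq> len x)"

definition children :: "'a \<Rightarrow> 'a set" where
  "children x = (if x \<in> carrier G then {x \<otimes> s |s. downs x s} else {})"

primrec path_word :: "'a \<Rightarrow> 'a list \<Rightarrow> bool" where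
  "path_word x [] = True"
| "path_word x (s # w) = (downs x s \<and> path_word (x \<otimes> s) w)"

text \<open>The type of a vertex is its entire labelled subtree. Equal types are then isomorphic by
  construction, and the work lies in proving that there are finitely many. Outside the group the
  value is empty, which never happens inside because the empty word is always present.\<close>

definition subtree :: "('a \<Rightarrow> real) \<Rightarrow> 'a \<Rightarrow> ('a list \<times> real) set" where
  "subtree \<phi> x = (if x \<in> carrier G then {(w, \<phi> (x \<otimes> ev w) - \<phi> x) |w. path_word x w} else {})"

lemma downs_carrier: "downs x s \<Longrightarrow> s \<in> carrier G"
  using S_carrier by (auto simp: downs_def)

lemma childrenE:
  assumes "c \<in> children x"
  obtains s where "x \<in> carrier G" "c = x \<otimes> s" "downs x s" "s \<in> carrier G"
  using assms downs_carrier unfolding children_def by (auto split: if_splits)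

lemma finite_children: "finite (children x)"
proof (rule finite_subset)
  show "children x \<subseteq> (\<lambda>s. x \<otimes> s) ` S" unfolding children_def downs_def by auto
qed (simp add: S_finite)

lemma children_disjoint:
  assumes "x \<noteq> y"
  shows "children x \<inter> children y = {}"
proof (rule ccontr)
  assume "\<not> ?thesis"
  then obtain c where c: "c \<in> children x" "c \<in> children y" by blast
  obtain s where s: "x \<in> carrier G" "c = x \<otimes> s" "downs x s" "s \<in> carrier G" using c(1) by (rule childrenE)
  obtain t where t: "y \<in> carrier G" "c = y \<otimes> t" "downs y t" "t \<in> carrier G" using c(2) by (rule childrenE)
  have ll: "len x = len y" using s(2,3) t(2,3) unfolding downs_def by simp
  have "c \<otimes> inv s = x" "c \<otimes> inv t = y"
    using s(1,4) t(1,4) unfolding s(2) by (simp add: m_assoc) (use t in \<open>simp add: s(2)[symmetric] m_assoc\<close>)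
  then have "\<not> rank s < rank t" "\<not> rank t < rank s" 
    using s(2,3) t(2,3) ll unfolding downs_def by auto
  then have "rank s = rank t" by simp
  then have "s = t" using rank_inj s(3) t(3) unfolding downs_def inj_on_def by blast
  then show False using \<open>c \<otimes> inv s = x\<close> \<open>c \<otimes> inv t = y\<close> assms by simp
qed

lemma sphere_0: "sphere 0 = {\<one>}"
  using len_eq_0 by (auto simp: sphere_iff)

lemma sphere_Suc: "sphere (Suc n) = (\<Union>x\<in>sphere n. children x)"
proof (intro equalityI subsetI)
  fix g assume "g \<in> sphere (Suc n)"
  then have g: "g \<in> carrier G" "len g = Suc n" by (auto simp: sphere_iff)
  have "n \<le> len g" using g(2) by simp
  with g(1) obtain a b where ab: "a \<in> carrier G" "b \<in> carrier G" "g = a \<otimes> b" "len a = n" "len b = len g - n"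
    by (rule split_len)
  obtain w where w: "w \<in> lists S" "ev w = b" "length w = len b" using len_word[OF ab(2)] by blast
  have "length w = Suc 0" using w(3) ab(5) g(2) by simp
  then obtain s0 where "w = [s0]" by (auto simp: length_Suc_conv)
  then have s0: "s0 \<in> S" "b = s0" using w S_carrier by (auto simp: ev_Cons)
  define Q where "Q = {s \<in> S. len (g \<otimes> inv s) = n}"
  have "s0 \<in> Q" using s0 ab unfolding Q_def by (simp add: m_assoc)
  then obtain s where s: "s \<in> Q" "\<And>t. t \<in> Q \<Longrightarrow> rank s \<le> rank t"
    using ex_has_least_nat[of "\<lambda>s. s \<in> Q" s0 rank] by blast
  have sc: "s \<in> carrier G" "s \<in> S" "len (g \<otimes> inv s) = n" using s(1) S_carrier by (auto simp: Q_def)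
  have "g \<otimes> inv s \<otimes> s = g" using g sc by (simp add: m_assoc)
  moreover have "len (g \<otimes> inv t) \<noteq> n" if "t \<in> S" "rank t < rank s" for t
    using s(2)[of t] that unfolding Q_def by fastforce
  ultimately have "downs (g \<otimes> inv s) s" using sc g unfolding downs_def by simp
  then have "g \<in> children (g \<otimes> inv s)"
    unfolding children_def using g sc \<open>g \<otimes> inv s \<otimes> s = g\<close> by (auto intro!: exI[of _ s])
  moreover have "g \<otimes> inv s \<in> sphere n" using g sc by (simp add: sphere_iff)
  ultimately show "g \<in> (\<Union>x\<in>sphere n. children x)" by blast
next
  fix g assume "g \<in> (\<Union>x\<in>sphere n. children x)"
  then obtain x where x: "x \<in> sphere n" "g \<in> children x" by blast
  then obtain s where "x \<in> carrier G" "g = x \<otimes> s" "downs x s" "s \<in> carrier G" by (auto elim: childrenE)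
  then show "g \<in> sphere (Suc n)" using x(1) by (simp add: sphere_iff downs_def)
qed

lemma desc_one: "desc children n \<one> = sphere n"
  by (induction n) (simp_all add: sphere_0 sphere_Suc)

lemma desc_geodesic:
  assumes "x \<in> carrier G"
  shows "g \<in> desc children m x \<Longrightarrow> g \<in> carrier G \<and> len g = len x + m \<and> dst x g = m"
proof (induction m arbitrary: g)
  case 0
  then show ?case using assms by simp
next
  case (Suc m)
  then obtain y where y: "y \<in> desc children m x" "g \<in> children y" by auto
  have yc: "y \<in> carrier G" "len y = len x + m" "dst x y = m" using Suc.IH[OF y(1)] by auto
  obtain s where s: "g = y \<otimes> s" "downs y s" "s \<in> carrier G" using y(2) by (rule childrenE)
  have g: "g \<in> carrier G" "len g = len x + Suc m" using s yc by (auto simp: downs_def)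
  have "dst y g \<le> 1" using s yc len_gen[of s] dst_right_mult[of y s] by (simp add: downs_def)
  then have "dst x g \<le> Suc m" using dst_tri[of x y g] assms yc g by simp
  moreover have "len g \<le> len x + dst x g" using dst_tri[of \<one> x g] dst_one assms g by simp
  ultimately show ?case using g by simp
qed

text \<open>Descendants at depth \<open>m\<close> have distance \<open>m\<close> from
  \<open>x\<close>, so left translation puts them into a sphere around the identity. This extends
  the growth bound to every subtree.\<close>

lemma card_desc_le:
  assumes "x \<in> carrier G"
  shows "card (desc children m x) \<le> card (sphere m)"
proof (rule card_inj_on_le[OF _ _ finite_sphere])
  have dc: "desc children m x \<subseteq> carrier G" using desc_geodesic[OF assms] by blast
  show "inj_on (\<lambda>g. inv x \<otimes> g) (desc children m x)"
    by (rule inj_onI) (use assms in \<open>simp add: subsetD[OF dc]\<close>)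
  show "(\<lambda>g. inv x \<otimes> g) ` desc children m x \<subseteq> sphere m"
    using desc_geodesic[OF assms] assms by (auto simp: sphere_iff word_dist_def)
qed

lemma desc_add: "desc ch (k + m) x = (\<Union>y\<in>desc ch k x. desc ch m y)"
  by (induction m) auto

lemma sphere_ancestor:
  assumes "g \<in> sphere (k + m)"
  obtains x where "x \<in> sphere k" "g \<in> desc children m x"
  using assms unfolding desc_one[symmetric] desc_add by blast

lemma path_word_props:
  "x \<in> carrier G \<Longrightarrow> path_word x w \<Longrightarrow> w \<in> lists S \<and> len (x \<otimes> ev w) = len x + length w \<and> len (ev w) = length w"
proof (induction w arbitrary: x)
  case (Cons s w)
  have s: "s \<in> S" "s \<in> carrier G" "len (x \<otimes> s) = Suc (len x)" "x \<otimes> s \<in> carrier G"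
    using Cons.prems downs_carrier by (auto simp: downs_def)
  have IH: "w \<in> lists S" "len (x \<otimes> s \<otimes> ev w) = len (x \<otimes> s) + length w"
    using Cons.IH[OF s(4)] Cons.prems by auto
  have wc: "ev w \<in> carrier G" using IH ev_lists by blast
  have l: "len (x \<otimes> ev (s # w)) = len x + length (s # w)"
    using IH s wc Cons.prems(1) by (simp add: ev_Cons m_assoc)
  have "len (ev (s # w)) \<le> length (s # w)" using IH s by (intro len_le) auto
  moreover have "len (x \<otimes> ev (s # w)) \<le> len x + len (ev (s # w))"
    using s wc Cons.prems(1) by (intro len_mult) (auto simp: ev_Cons)
  ultimately show ?case using l IH s by auto
qed simp

lemma subtree_children_iso:
  assumes eq: "subtree \<phi> x = subtree \<phi> y"
  shows "\<exists>\<beta>. bij_betw \<beta> (children x) (children y) \<and>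
    (\<forall>c\<in>children x. subtree \<phi> (\<beta> c) = subtree \<phi> c \<and> \<phi> (\<beta> c) - \<phi> y = \<phi> c - \<phi> x)"
proof (cases "x \<in> carrier G \<and> y \<in> carrier G")
  case False
  have "subtree \<phi> z \<noteq> {}" if "z \<in> carrier G" for z
    using that unfolding subtree_def by (auto intro!: exI[of _ "[]"])
  moreover have "subtree \<phi> z = {}" if "z \<notin> carrier G" for z using that by (simp add: subtree_def)
  ultimately have "x \<notin> carrier G" "y \<notin> carrier G" using False eq by metis+
  then show ?thesis by (simp add: children_def bij_betw_def)
next
  case True
  then have x: "x \<in> carrier G" and y: "y \<in> carrier G" by auto
  have mem: "path_word x w \<longleftrightarrow> path_word y w" "path_word x w \<Longrightarrow> \<phi> (y \<otimes> ev w) - \<phi> y = \<phi> (x \<otimes> ev w) - \<phi> x" for w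
  proof -
    have sx: "(w, d) \<in> subtree \<phi> x \<longleftrightarrow> path_word x w \<and> d = \<phi> (x \<otimes> ev w) - \<phi> x" for d
      using x by (auto simp: subtree_def)
    have sy: "(w, d) \<in> subtree \<phi> y \<longleftrightarrow> path_word y w \<and> d = \<phi> (y \<otimes> ev w) - \<phi> y" for d
      using y by (auto simp: subtree_def)
    show "path_word x w \<longleftrightarrow> path_word y w" "path_word x w \<Longrightarrow> \<phi> (y \<otimes> ev w) - \<phi> y = \<phi> (x \<otimes> ev w) - \<phi> x"
      using sx sy eq by metis+
  qed
  have d: "downs x s \<longleftrightarrow> downs y s" for s using mem(1)[of "[s]"] by simp
  have inc: "\<phi> (y \<otimes> s) - \<phi> y = \<phi> (x \<otimes> s) - \<phi> x" if "downs x s" for s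
    using mem(2)[of "[s]"] that downs_carrier[OF that] by (simp add: ev_Cons)
  have sub: "subtree \<phi> (y \<otimes> s) = subtree \<phi> (x \<otimes> s)" if s: "downs x s" for s
  proof -
    have sc: "s \<in> carrier G" using downs_carrier[OF s] .
    have pw: "path_word (y \<otimes> s) w \<longleftrightarrow> path_word (x \<otimes> s) w" for w
      using mem(1)[of "s # w"] s d by simp
    have "\<phi> (y \<otimes> s \<otimes> ev w) - \<phi> (y \<otimes> s) = \<phi> (x \<otimes> s \<otimes> ev w) - \<phi> (x \<otimes> s)" if w: "path_word (x \<otimes> s) w" for w
    proof -
      have wc: "ev w \<in> carrier G" using path_word_props[OF _ w] x sc ev_lists by blast
      show ?thesis using mem(2)[of "s # w"] s w inc[OF s] x y sc wc by (simp add: ev_Cons m_assoc)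
    qed
    then show ?thesis using x y sc pw unfolding subtree_def by auto
  qed
  define \<beta> where "\<beta> c = y \<otimes> (inv x \<otimes> c)" for c
  have \<beta>: "\<beta> (x \<otimes> s) = y \<otimes> s" if "s \<in> carrier G" for s
    unfolding \<beta>_def using x that by (simp add: m_assoc[symmetric])
  have cx: "children x = (\<lambda>s. x \<otimes> s) ` {s. downs x s}" "children y = (\<lambda>s. y \<otimes> s) ` {s. downs x s}"
    using x y d unfolding children_def by auto
  have "bij_betw \<beta> (children x) (children y)"
  proof (rule bij_betwI')
    fix c c' assume "c \<in> children x" "c' \<in> children x"
    then have "c \<in> carrier G" "c' \<in> carrier G" by (auto elim!: childrenE)
    then show "(\<beta> c = \<beta> c') = (c = c')" unfolding \<beta>_def using x y by simp
  next
    fix c assume "c \<in> children x"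
    then show "\<beta> c \<in> children y" unfolding cx using \<beta> downs_carrier by auto
  next
    fix c assume "c \<in> children y"
    then show "\<exists>c'\<in>children x. c = \<beta> c'" unfolding cx using \<beta> downs_carrier by auto
  qed
  moreover have "subtree \<phi> (\<beta> c) = subtree \<phi> c \<and> \<phi> (\<beta> c) - \<phi> y = \<phi> c - \<phi> x" if "c \<in> children x" for c
    using that sub inc \<beta> downs_carrier unfolding cx by auto
  ultimately show ?thesis by blast
qed

section \<open>Finiteness of the subtree types\<close>

lemma cone_length_le:
  assumes t: "thin \<delta>" and g: "g \<in> carrier G" "g' \<in> carrier G"
    and same: "\<And>h. h \<in> carrier G \<Longrightarrow> len h \<le> 2 * \<delta> + 3 \<Longrightarrow>
      int (len (g \<otimes> h)) - int (len g) = int (len (g' \<otimes> h)) - int (len g')"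
    and b: "b \<in> carrier G" "len (g \<otimes> b) = len g + len b" and e: "e \<in> carrier G" "len e \<le> 2"
  shows "int (len (g' \<otimes> b \<otimes> e)) - int (len g') \<le> int (len (g \<otimes> b \<otimes> e)) - int (len g)"
proof -
  define z where "z = g \<otimes> b \<otimes> e"
  have z: "z \<in> carrier G" "z = g \<otimes> (b \<otimes> e)" using g b e by (simp_all add: z_def m_assoc)
  have be: "len (b \<otimes> e) \<le> len b + 2" using len_mult[of b e] b e by simp
  have "g \<otimes> b = z \<otimes> inv e" using g b e by (simp add: z_def m_assoc)
  then have gz: "len g + len b \<le> len z + 2" using len_mult[of z "inv e"] z b e by simp
  obtain p where p: "p \<in> seg \<one> z" "2 * dst g p + dst \<one> z \<le> dst \<one> g + dst z g + (4 * \<delta> + 2)"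
    using seg_near_gromov_product[OF t one_closed z(1) g(1)] by blast
  have pc: "p \<in> carrier G" "len p + dst p z = len z" using segD[OF p(1)] dst_one z(1) by auto
  have "dst z g = len (b \<otimes> e)" using dst_sym[OF z(1) g(1)] dst_right_mult[of g "b \<otimes> e"] g b e
    unfolding z(2) by simp
  then have near: "dst g p \<le> 2 * \<delta> + 3" using p(2) be gz dst_one[OF z(1)] dst_one[OF g(1)] by linarith
  define h where "h = inv g \<otimes> p"
  have h: "h \<in> carrier G" "len h \<le> 2 * \<delta> + 3" "g \<otimes> h = p"
    using near pc g unfolding h_def word_dist_def by (auto simp: m_assoc[symmetric])
  have "g' \<otimes> b \<otimes> e = (g' \<otimes> h) \<otimes> (inv p \<otimes> z)"
  proof -
    have "h \<otimes> (inv p \<otimes> z) = inv g \<otimes> (p \<otimes> (inv p \<otimes> z))" unfolding h_def using g pc z(1) by (simp add: m_assoc)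
    also have "p \<otimes> (inv p \<otimes> z) = z" using pc z(1) by (simp add: m_assoc[symmetric])
    also have "inv g \<otimes> z = b \<otimes> e" unfolding z(2) using g b e by (simp add: m_assoc[symmetric])
    finally show ?thesis using g h pc z(1) b e by (simp add: m_assoc)
  qed
  then have "len (g' \<otimes> b \<otimes> e) \<le> len (g' \<otimes> h) + dst p z"
    using len_mult[of "g' \<otimes> h" "inv p \<otimes> z"] g h pc z(1) by (simp add: word_dist_def)
  then show ?thesis using same[OF h(1,2)] h(3) pc(2) unfolding z_def[symmetric] by simp
qed

text \<open>\<open>downs\<close> only compares lengths of products with some \<open>e\<close> of
  length at most 2, and \<open>cone_length_le\<close> used in both directions makes these agree for
  \<open>g\<close> and \<open>g'\<close>. The element \<open>b\<close> is the part already
  read.\<close>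

lemma path_word_transfer:
  assumes t: "thin \<delta>" and g: "g \<in> carrier G" "g' \<in> carrier G"
    and same: "\<And>h. h \<in> carrier G \<Longrightarrow> len h \<le> 2 * \<delta> + 3 \<Longrightarrow>
      int (len (g \<otimes> h)) - int (len g) = int (len (g' \<otimes> h)) - int (len g')"
  shows "\<lbrakk>b \<in> carrier G; len (g \<otimes> b) = len g + len b; len (g' \<otimes> b) = len g' + len b; path_word (g \<otimes> b) w\<rbrakk>
    \<Longrightarrow> path_word (g' \<otimes> b) w"
proof (induction w arbitrary: b)
  case (Cons s w)
  have s: "s \<in> S" "s \<in> carrier G" "len (g \<otimes> b \<otimes> s) = Suc (len (g \<otimes> b))"
    using Cons.prems(4) downs_carrier by (auto simp: downs_def)
  have eq: "int (len (g' \<otimes> b \<otimes> e)) - int (len g') = int (len (g \<otimes> b \<otimes> e)) - int (len g)"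
    if "e \<in> carrier G" "len e \<le> 2" for e
    using cone_length_le[OF t g same Cons.prems(1,2) that] cone_length_le[OF t g(2,1) same[symmetric] Cons.prems(1,3) that]
    by linarith
  have up: "len (g' \<otimes> b \<otimes> s) = Suc (len (g' \<otimes> b))"
    using eq[OF s(2)] s len_gen[OF s(1)] Cons.prems(2,3) by simp
  have "len (g' \<otimes> b \<otimes> s \<otimes> inv u) \<noteq> len (g' \<otimes> b)" if u: "u \<in> S" "rank u < rank s" for u
  proof -
    have uc: "u \<in> carrier G" "inv u \<in> S" using u S_carrier S_inv by auto
    have "len (s \<otimes> inv u) \<le> 2" using len_mult[of s "inv u"] s uc len_gen[OF s(1)] len_gen[OF uc(2)] by simp
    then have "int (len (g' \<otimes> b \<otimes> (s \<otimes> inv u))) - int (len g') = int (len (g \<otimes> b \<otimes> (s \<otimes> inv u))) - int (len g)"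
      using s uc by (intro eq) auto
    moreover have "len (g \<otimes> b \<otimes> s \<otimes> inv u) \<noteq> len (g \<otimes> b)"
      using Cons.prems(4) u by (simp add: downs_def)
    ultimately show ?thesis using Cons.prems(1-3) g s uc by (simp add: m_assoc)
  qed
  then have "downs (g' \<otimes> b) s" using s up by (simp add: downs_def)
  moreover have "path_word (g' \<otimes> b \<otimes> s) w"
  proof -
    have bs: "b \<otimes> s \<in> carrier G" "len (b \<otimes> s) \<le> len b + 1"
      using len_mult[of b s] Cons.prems(1) s len_gen[OF s(1)] by auto
    have "len (g \<otimes> (b \<otimes> s)) = len g + (len b + 1)" "len (g' \<otimes> (b \<otimes> s)) = len g' + (len b + 1)"
      using s up Cons.prems(1-3) g by (simp_all add: m_assoc)
    moreover have "len (g \<otimes> (b \<otimes> s)) \<le> len g + len (b \<otimes> s)" using g bs by (intro len_mult)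
    ultimately have "len (g \<otimes> (b \<otimes> s)) = len g + len (b \<otimes> s)" "len (g' \<otimes> (b \<otimes> s)) = len g' + len (b \<otimes> s)"
      using bs(2) by simp_all
    moreover have "path_word (g \<otimes> (b \<otimes> s)) w" using Cons.prems(1,4) g s by (simp add: m_assoc)
    ultimately show ?thesis using Cons.IH[OF bs(1)] Cons.prems(1) g s by (simp add: m_assoc)
  qed
  ultimately show ?case by simp
qed simp

end

lemma bicombable_lipschitz:
  fixes G (structure)
  assumes T: "cayley G T" and bi: "bicombable_wrt G T L \<phi>"
  obtains C :: nat where
    "\<And>x h. x \<in> carrier G \<Longrightarrow> h \<in> carrier G \<Longrightarrow> \<bar>\<phi> (x \<otimes> h) - \<phi> x\<bar> \<le> int (C * word_length G T h)"
    "\<And>x h. x \<in> carrier G \<Longrightarrow> h \<in> carrier G \<Longrightarrow> \<bar>\<phi> (h \<otimes> x) - \<phi> x\<bar> \<le> int (C * word_length G T h)"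
proof -
  interpret cayley G T by (rule T)
  obtain C0 where C0: "\<forall>a\<in>carrier G. \<forall>s\<in>T. \<bar>\<phi> (a \<otimes> s) - \<phi> a\<bar> \<le> C0 \<and> \<bar>\<phi> (s \<otimes> a) - \<phi> a\<bar> \<le> C0"
    using bi unfolding bicombable_wrt_def by blast
  define C where "C = nat \<bar>C0\<bar>"
  have C: "\<bar>\<phi> (a \<otimes> s) - \<phi> a\<bar> \<le> int C" "\<bar>\<phi> (s \<otimes> a) - \<phi> a\<bar> \<le> int C" if "a \<in> carrier G" "s \<in> T" for a s
    using C0 that unfolding C_def by fastforce+
  have r: "\<bar>\<phi> (x \<otimes> ev w) - \<phi> x\<bar> \<le> int C * int (length w)" if "x \<in> carrier G" "w \<in> lists T" for x w
    using that
  proof (induction w arbitrary: x)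
    case (Cons s w)
    then have s: "s \<in> T" "s \<in> carrier G" "w \<in> lists T" "ev w \<in> carrier G" using S_carrier ev_lists by auto
    have "\<bar>\<phi> (x \<otimes> s \<otimes> ev w) - \<phi> (x \<otimes> s)\<bar> \<le> int C * int (length w)" using Cons.IH[of "x \<otimes> s"] Cons.prems s
      by simp
    then show ?case using C(1)[OF Cons.prems(1) s(1)] s Cons.prems(1)
      by (simp add: ev_Cons m_assoc distrib_left)
  qed simp
  have l: "\<bar>\<phi> (ev w \<otimes> x) - \<phi> x\<bar> \<le> int C * int (length w)" if "x \<in> carrier G" "w \<in> lists T" for x w
    using that(2)
  proof (induction w)
    case (Cons s w)
    then have s: "s \<in> T" "s \<in> carrier G" "w \<in> lists T" "ev w \<in> carrier G" using S_carrier ev_lists by auto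
    have "\<bar>\<phi> (s \<otimes> (ev w \<otimes> x)) - \<phi> (ev w \<otimes> x)\<bar> \<le> int C" using C(2)[of "ev w \<otimes> x" s] s that(1) by simp
    then show ?case using Cons.IH s that(1) by (simp add: ev_Cons m_assoc distrib_left)
  qed (use that in simp)
  show ?thesis
  proof (rule that[of C])
    fix x h assume x: "x \<in> carrier G" and h: "h \<in> carrier G"
    obtain w where w: "w \<in> lists T" "ev w = h" "length w = len h" using len_word[OF h] by blast
    show "\<bar>\<phi> (x \<otimes> h) - \<phi> x\<bar> \<le> int (C * len h)" using r[OF x w(1)] w by simp
    show "\<bar>\<phi> (h \<otimes> x) - \<phi> x\<bar> \<le> int (C * len h)" using l[OF x w(1)] w by simp
  qed
qed

lemma finite_image_factor:
  assumes "finite (D ` A)" "\<And>x y. x \<in> A \<Longrightarrow> y \<in> A \<Longrightarrow> D x = D y \<Longrightarrow> f x = f y"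
  shows "finite (f ` A)"
proof -
  define r where "r d = f (SOME x. x \<in> A \<and> D x = d)" for d
  have "f x = r (D x)" if "x \<in> A" for x
  proof -
    have "(SOME y. y \<in> A \<and> D y = D x) \<in> A \<and> D (SOME y. y \<in> A \<and> D y = D x) = D x"
      by (rule someI[of _ x]) (use that in simp)
    then show ?thesis unfolding r_def using assms(2) that by metis
  qed
  then have "f ` A \<subseteq> r ` D ` A" by auto
  then show ?thesis using assms(1) finite_surj by blast
qed

lemma finite_subtree_types:
  fixes G (structure) and \<phi> :: "'a \<Rightarrow> int"
  assumes S: "cayley G S" and T: "cayley G T"
    and thin: "nat_geodesic.thin (carrier G) (word_dist G S) \<delta>"
    and comb: "combing G T L" and bi: "bicombable_wrt G T L \<phi>"
  shows "finite (range (cayley.subtree G S (\<lambda>x. real_of_int (\<phi> x))))"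
proof -
  interpret S: cayley G S by (rule S)
  interpret T: cayley G T by (rule T)
  obtain k where k: "k \<ge> 1" "\<And>g. g \<in> carrier G \<Longrightarrow> S.len g \<le> k * T.len g"
    "\<And>g. g \<in> carrier G \<Longrightarrow> T.len g \<le> k * S.len g"
    using cayley_bilipschitz[OF S T] by blast
  have wc: "weakly_combable G T L \<phi>" using bi by (simp add: bicombable_wrt_def)
  obtain nf :: "'a \<Rightarrow> 'a list" and q :: "'a \<Rightarrow> nat" where q: "finite (q ` carrier G)"
    and nf: "\<And>x. x \<in> carrier G \<Longrightarrow> nf x \<in> lists T \<and> T.ev (nf x) = x \<and> length (nf x) = T.len x"
    and pre: "\<And>x u v. x \<in> carrier G \<Longrightarrow> nf x = u @ v \<Longrightarrow> nf (T.ev u) = u"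
    and step: "\<And>x x' v. \<lbrakk>x \<in> carrier G; x' \<in> carrier G; v \<in> lists T; q x = q x'; nf (x \<otimes> T.ev v) = nf x @ v\<rbrakk> \<Longrightarrow>
       nf (x' \<otimes> T.ev v) = nf x' @ v \<and> \<phi> (x' \<otimes> T.ev v) - \<phi> x' = \<phi> (x \<otimes> T.ev v) - \<phi> x"
    by (rule combable_normal_form[OF T comb wc]) (rule that)
  obtain C :: nat where C: "\<And>x h. x \<in> carrier G \<Longrightarrow> h \<in> carrier G \<Longrightarrow> \<bar>\<phi> (x \<otimes> h) - \<phi> x\<bar> \<le> int (C * T.len h)"
    by (rule bicombable_lipschitz[OF T bi]) (rule that)
  obtain R where R: "\<And>c n p. S.quasi_path k c n \<Longrightarrow> p \<in> S.seg (c 0) (c n) \<Longrightarrow> \<exists>i\<le>n. S.dst p (c i) \<le> R"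
    using S.geodesic_near_quasi_path[OF thin] by blast
  have near: "\<exists>u v. nf (g \<otimes> b) = u @ v \<and> S.dst g (T.ev u) \<le> R"
    if g: "g \<in> carrier G" and b: "b \<in> carrier G" and gb: "S.len (g \<otimes> b) = S.len g + S.len b" for g b
  proof -
    define w where "w = nf (g \<otimes> b)"
    have w: "w \<in> lists T" "T.ev w = g \<otimes> b" "length w = T.len (T.ev w)"
      using nf[of "g \<otimes> b"] g b unfolding w_def by auto
    have tc: "T.ev (take i w) \<in> carrier G" for i
      using T.lists_carrier[OF w(1)] set_take_subset[of i w] by (intro T.ev_closed) auto
    have "S.quasi_path k (\<lambda>i. T.ev (take i w)) (length w)"
      by (rule geodesic_imp_quasi_path[OF S T k(2,3) tc T.dst_prefix[OF w(1,3)]])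
    moreover have "g \<in> S.seg \<one> (g \<otimes> b)"
      using g b gb S.dst_one S.dst_right_mult by (simp add: S.seg_def)
    ultimately obtain i where "S.dst g (T.ev (take i w)) \<le> R"
      using R[of "\<lambda>i. T.ev (take i w)" "length w" g] w(2) by auto
    then show ?thesis unfolding w_def[symmetric] by (metis append_take_drop_id)
  qed
  \<comment> \<open>The radius \<open>R\<close> reaches the normal form, and
    \<open>2 * \<delta> + 3\<close> is what the comparison of cones needs.\<close>
  define N where "N = max R (2 * \<delta> + 3)"
  define B where "B = {h \<in> carrier G. S.len h \<le> N}"
  define M where "M = int (C * (k * N))"
  define D where "D g = (\<lambda>h\<in>B. (int (S.len (g \<otimes> h)) - int (S.len g), q (g \<otimes> h), \<phi> (g \<otimes> h) - \<phi> g))" for g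
  have "D g \<in> PiE B (\<lambda>_. {- int N..int N} \<times> q ` carrier G \<times> {-M..M})" if g: "g \<in> carrier G" for g
  proof (rule PiE_I)
    fix h assume "h \<in> B"
    then have h: "h \<in> carrier G" "S.len h \<le> N" by (auto simp: B_def)
    have gh: "g \<otimes> h \<in> carrier G" using g h by simp
    have "g = (g \<otimes> h) \<otimes> inv h" using g h by (simp add: S.m_assoc)
    then have "S.len g \<le> S.len (g \<otimes> h) + S.len h" using S.len_mult[of "g \<otimes> h" "inv h"] g h by simp
    moreover have "S.len (g \<otimes> h) \<le> S.len g + S.len h" using g h by (intro S.len_mult)
    moreover have "T.len h \<le> k * N" using k(3)[OF h(1)] h(2) by (meson le_trans mult_le_mono2)
    then have "\<bar>\<phi> (g \<otimes> h) - \<phi> g\<bar> \<le> M"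
      unfolding M_def using C[OF g h(1)] by (meson le_trans mult_le_mono2 of_nat_mono order_trans)
    ultimately show "D g h \<in> {- int N..int N} \<times> q ` carrier G \<times> {-M..M}"
      using \<open>h \<in> B\<close> h(2) gh unfolding D_def by (auto simp: abs_le_iff)
  qed (simp add: D_def)
  then have "D ` carrier G \<subseteq> PiE B (\<lambda>_. {- int N..int N} \<times> q ` carrier G \<times> {-M..M})" by blast
  moreover have "finite (PiE B (\<lambda>_. {- int N..int N} \<times> q ` carrier G \<times> {-M..M}))"
    using S.finite_len_ball[of N] q unfolding B_def by (intro finite_PiE) auto
  ultimately have finD: "finite (D ` carrier G)" by (rule finite_subset)
  let ?\<psi> = "\<lambda>x. real_of_int (\<phi> x)"
  have sub: "S.subtree ?\<psi> g \<subseteq> S.subtree ?\<psi> g'"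
    if g: "g \<in> carrier G" "g' \<in> carrier G" and eq: "D g = D g'" for g g'
  proof -
    have same: "int (S.len (g \<otimes> h)) - int (S.len g) = int (S.len (g' \<otimes> h)) - int (S.len g')"
      "q (g \<otimes> h) = q (g' \<otimes> h)" "\<phi> (g \<otimes> h) - \<phi> g = \<phi> (g' \<otimes> h) - \<phi> g'" if "h \<in> B" for h
      using fun_cong[OF eq, of h] that by (auto simp: D_def)
    have "S.path_word g' w \<and> \<phi> (g' \<otimes> S.ev w) - \<phi> g' = \<phi> (g \<otimes> S.ev w) - \<phi> g" if w: "S.path_word g w" for w
    proof
      have "S.path_word (g' \<otimes> \<one>) w"
        by (rule S.path_word_transfer[OF thin g same(1) S.one_closed])
           (use g w in \<open>auto simp: B_def N_def\<close>)
      then show "S.path_word g' w" using g by simp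
      define b where "b = S.ev w"
      have b: "b \<in> carrier G" "S.len (g \<otimes> b) = S.len g + S.len b"
        using S.path_word_props[OF g(1) w] S.ev_lists unfolding b_def by auto
      obtain u v where uv: "nf (g \<otimes> b) = u @ v" "S.dst g (T.ev u) \<le> R" using near[OF g(1) b] by blast
      have gb: "g \<otimes> b \<in> carrier G" using g b by simp
      have lists: "u \<in> lists T" "v \<in> lists T" using nf[OF gb] unfolding uv(1) by auto
      have uvc: "T.ev u \<in> carrier G" "T.ev v \<in> carrier G" using lists T.ev_lists by auto
      have evuv: "T.ev u \<otimes> T.ev v = g \<otimes> b"
        using nf[OF gb] T.ev_append[OF T.lists_carrier[OF lists(1)] T.lists_carrier[OF lists(2)]]
          unfolding uv(1) by simp
      define h where "h = inv g \<otimes> T.ev u"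
      have h: "h \<in> carrier G" "g \<otimes> h = T.ev u" "h \<in> B"
        using uv(2) uvc g unfolding h_def B_def N_def word_dist_def by (auto simp: S.m_assoc[symmetric])
      have hv: "h \<otimes> T.ev v = b"
        unfolding h_def using g b uvc evuv by (simp add: S.m_assoc) (simp add: S.m_assoc[symmetric])
      have g'h: "g' \<otimes> h \<in> carrier G" using g h by simp
      \<comment> \<open>The normal form splits at \<open>g \<otimes> h\<close>. Since
        \<open>g' \<otimes> h\<close> has the same state, the rest \<open>v\<close> can also be read
        from there with the same increment of \<phi>.\<close>
      have "nf (g \<otimes> h \<otimes> T.ev v) = nf (g \<otimes> h) @ v"
        unfolding h(2) evuv uv(1) pre[OF gb uv(1)] ..
      then have "\<phi> (g' \<otimes> h \<otimes> T.ev v) - \<phi> (g' \<otimes> h) = \<phi> (g \<otimes> h \<otimes> T.ev v) - \<phi> (g \<otimes> h)"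
        using step[of "g \<otimes> h" "g' \<otimes> h" v] g'h h uvc lists(2) same(2)[OF h(3)] by simp
      moreover have "g' \<otimes> h \<otimes> T.ev v = g' \<otimes> b" "g \<otimes> h \<otimes> T.ev v = g \<otimes> b"
        using g h(1) uvc by (simp_all add: S.m_assoc hv)
      ultimately show "\<phi> (g' \<otimes> S.ev w) - \<phi> g' = \<phi> (g \<otimes> S.ev w) - \<phi> g"
        using same(3)[OF h(3)] unfolding b_def[symmetric] by simp
    qed
    then show ?thesis
      using g unfolding S.subtree_def by (auto simp: of_int_diff[symmetric] simp del: of_int_diff)
  qed
  have "finite (S.subtree ?\<psi> ` carrier G)"
    by (rule finite_image_factor[OF finD]) (intro equalityI sub; simp)
  moreover have "range (S.subtree ?\<psi>) \<subseteq> insert {} (S.subtree ?\<psi> ` carrier G)"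
    by (auto simp: S.subtree_def)
  ultimately show ?thesis by (meson finite_insert finite_subset)
qed

section \<open>Constancy of the mean and concentration\<close>

text \<open>The interface between geometry and probability: hyperbolicity, nonelementarity and
  combability enter the remaining argument only through these assumptions.\<close>

locale combable_tree = cayley G S for G (structure) and S +
  fixes \<phi> :: "'a \<Rightarrow> real" and lam A Lip :: real and D R C :: nat
  assumes four_point: "four_point D"
    and insertion: "\<And>a b. a \<in> carrier G \<Longrightarrow> b \<in> carrier G \<Longrightarrow>
      \<exists>y\<in>carrier G. len y \<le> R \<and> len a + len b \<le> len (a \<otimes> y \<otimes> b) + C"
    and lam_ge_1': "lam \<ge> 1"
    and sphere_lower: "\<And>n. lam ^ n \<le> real (card (sphere n))"
    and sphere_upper: "\<And>n. real (card (sphere n)) \<le> A * lam ^ n"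
    and finite_subtrees: "finite (range (subtree \<phi>))"
    and Lip_nonneg: "Lip \<ge> 0"
    and lip_right: "\<And>x h. x \<in> carrier G \<Longrightarrow> h \<in> carrier G \<Longrightarrow> \<bar>\<phi> (x \<otimes> h) - \<phi> x\<bar> \<le> Lip * real (len h)"
    and lip_left: "\<And>x h. x \<in> carrier G \<Longrightarrow> h \<in> carrier G \<Longrightarrow> \<bar>\<phi> (h \<otimes> x) - \<phi> x\<bar> \<le> Lip * real (len h)"
begin

lemma desc_outside: "x \<notin> carrier G \<Longrightarrow> desc children n x \<subseteq> {x}"
  by (induction n) (auto simp: children_def)

sublocale tree: typed_tree children "subtree \<phi>" \<phi> lam A
proof
  have A1: "A \<ge> 1" using sphere_upper[of 0] by (simp add: sphere_0)
  show "real (card (desc children n x)) \<le> A * lam ^ n" for n x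
  proof (cases "x \<in> carrier G")
    case True
    then show ?thesis using card_desc_le[OF True, of n] sphere_upper[of n] by simp
  next
    case False
    have "card (desc children n x) \<le> card {x}" using desc_outside[OF False] by (intro card_mono) auto
    moreover have "1 * 1 \<le> A * lam ^ n" using A1 lam_ge_1' by (intro mult_mono) auto
    ultimately show ?thesis by simp
  qed
qed (use finite_subtrees finite_children subtree_children_iso children_disjoint lam_ge_1' in auto)

lemma wt_one: "tree.wt \<one> > 0"
  by (rule tree.wt_pos) (simp add: desc_one sphere_lower)

text \<open>Outside the group there are no children, so harmonicity of the weight forces it to be
  0.\<close>

lemma wt_carrier: "tree.wt x > 0 \<Longrightarrow> x \<in> carrier G"
  using tree.wt_children[of x] lam_ge_1' by (cases "x \<in> carrier G") (auto simp: children_def)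

text \<open>Otherwise a bounded right multiplication would take a positive proportion of the typical elements
  \<open>g\<close> below \<open>a\<close>, on which \<open>\<phi> g\<close> is close to \<open>n * E a\<close>, to heavy elements of smaller mean, contradicting
  \<open>tree.weighted_deviation_subquadratic\<close>.\<close>

lemma neighbours_of_max:
  assumes dp: "tree.drift_pair E h" and a: "tree.wt a > 0"
    and max: "\<And>y. tree.wt y > 0 \<Longrightarrow> E y \<le> E a"
  shows "\<exists>x\<in>carrier G. \<forall>z\<in>carrier G. len z \<le> r \<longrightarrow> len (x \<otimes> z) = len x \<longrightarrow> tree.wt (x \<otimes> z) > 0 \<longrightarrow>
    E (x \<otimes> z) = E a"
proof (rule ccontr)
  assume neg: "\<not> ?thesis"
  then have "\<forall>x\<in>carrier G. \<exists>z\<in>carrier G. len z \<le> r \<and> len (x \<otimes> z) = len x \<and> tree.wt (x \<otimes> z) > 0 \<and> E (x \<otimes> z) \<noteq> E a"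
    by blast
  then obtain z where z: "\<And>x. x \<in> carrier G \<Longrightarrow> z x \<in> carrier G \<and> len (z x) \<le> r \<and> len (x \<otimes> z x) = len x \<and>
      tree.wt (x \<otimes> z x) > 0 \<and> E (x \<otimes> z x) \<noteq> E a"
    by metis
  have PE: "tree.Pw E = E" and invE: "tree.type_inv E" using dp by (auto simp: tree.drift_pair_def)
  define e where "e = E a"
  define k where "k = len a"
  have ac: "a \<in> carrier G" using a by (rule wt_carrier)
  obtain \<eta> where \<eta>: "\<eta> > 0" "\<And>y. E y < e \<Longrightarrow> E y \<le> e - \<eta>" using tree.type_inv_gap[OF invE] by blast
  have const: "tree.constant_below E a e"
    unfolding tree.constant_below_def e_def using tree.harmonic_max_desc[OF PE max] by blast
  define X where "X n = {g \<in> desc children n a. \<bar>\<phi> g - \<phi> a - real n * e\<bar> < \<eta> / 4 * real n}" for n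
  obtain c J where c: "c > 0" "\<And>n. n \<ge> J \<Longrightarrow> c * lam ^ n \<le> real (card (X n))"
    using tree.deviation_typical[OF dp const _ a, of "\<eta> / 4"] \<eta>(1) unfolding X_def by auto
  define B where "B = {g \<in> carrier G. len g \<le> r}"
  have finB: "finite B" unfolding B_def by (rule finite_len_ball)
  have "\<one> \<in> B" by (simp add: B_def)
  then have cB: "real (card B) > 0" using finB by (auto simp: card_gt_0_iff)
  \<comment> \<open>The sum of all bounded errors; from \<open>N1\<close> on it stays below a
    quarter of \<open>\<eta> * real n\<close>.\<close>
  define K where "K = \<bar>\<phi> a\<bar> + \<bar>\<phi> \<one>\<bar> + Lip * real r + real k * \<bar>e - \<eta>\<bar>"
  obtain N1 where N1: "\<And>n. n \<ge> N1 \<Longrightarrow> K \<le> \<eta> / 4 * real n" using eventually_linear_ge[of "\<eta> / 4" K] \<eta>(1) by auto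
  \<comment> \<open>The images \<open>g \<otimes> z g\<close> land here: their \<phi> still grows at
    the rate \<open>e\<close>, while their own mean is at most \<open>e - \<eta>\<close>. The weak
    law allows only few such elements.\<close>
  define Y where "Y n = {y \<in> sphere (n + k). tree.wt y > 0 \<and> \<eta> / 2 * real n \<le> \<bar>\<phi> y - \<phi> \<one> - real (n + k) * E y\<bar>}" for n
  have finY: "finite (Y n)" for n unfolding Y_def using finite_sphere by auto
  have XY: "card (X n) \<le> card (Y n) * card B" if n: "n \<ge> N1" for n
  proof -
    have "X n \<subseteq> (\<lambda>(y, u). y \<otimes> inv u) ` (Y n \<times> B)"
    proof
      fix g assume g: "g \<in> X n"
      then have gd: "g \<in> desc children n a" "\<bar>\<phi> g - \<phi> a - real n * e\<bar> < \<eta> / 4 * real n" by (auto simp: X_def)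
      have gc: "g \<in> carrier G" "len g = k + n" using desc_geodesic[OF ac gd(1)] by (auto simp: k_def)
      note zg = z[OF gc(1)]
      define y where "y = g \<otimes> z g"
      have y: "y \<in> carrier G" "len y = n + k" "tree.wt y > 0" using zg gc by (auto simp: y_def)
      have "E y < e" using max[OF y(3)] zg unfolding y_def e_def by simp
      then have Ey: "real (n + k) * E y \<le> real (n + k) * (e - \<eta>)" using \<eta>(2) by (intro mult_left_mono) auto
      have "Lip * real (len (z g)) \<le> Lip * real r" using zg Lip_nonneg by (intro mult_left_mono) auto
      then have py: "\<phi> g - Lip * real r \<le> \<phi> y" using lip_right[of g "z g"] gc zg unfolding y_def
        by (simp add: abs_le_iff)
      have ke: "real (n + k) * (e - \<eta>) \<le> real n * e - real n * \<eta> + real k * \<bar>e - \<eta>\<bar>"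
        using mult_left_mono[OF abs_ge_self[of "e - \<eta>"], of "real k"] by (simp add: algebra_simps)
      have arith: "s / 2 \<le> py - p1 - u"
        if "u \<le> q" "q \<le> ne - s + l" "pg - t \<le> py" "\<bar>pg - pa - ne\<bar> < s / 4" "\<bar>pa\<bar> + \<bar>p1\<bar> + t + l \<le> s / 4"
        for u q ne s l pg t py pa p1 :: real using that by linarith
      have "real n * \<eta> / 2 \<le> \<phi> y - \<phi> \<one> - real (n + k) * E y"
        by (rule arith[OF Ey ke py]) (use gd(2) N1[OF n] in \<open>simp_all add: K_def mult.commute\<close>)
      then have "\<eta> / 2 * real n \<le> \<phi> y - \<phi> \<one> - real (n + k) * E y" by (simp add: mult.commute)
      also have "\<dots> \<le> \<bar>\<phi> y - \<phi> \<one> - real (n + k) * E y\<bar>" by (rule abs_ge_self)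
      finally have "\<eta> / 2 * real n \<le> \<bar>\<phi> y - \<phi> \<one> - real (n + k) * E y\<bar>" .
      then have "y \<in> Y n" using y by (simp add: Y_def sphere_iff)
      moreover have "g = y \<otimes> inv (z g)" using gc zg by (simp add: y_def m_assoc)
      moreover have "z g \<in> B" using zg by (simp add: B_def)
      ultimately show "g \<in> (\<lambda>(y, u). y \<otimes> inv u) ` (Y n \<times> B)" by (intro image_eqI[of _ _ "(y, z g)"]) auto
    qed
    then have "card (X n) \<le> card (Y n \<times> B)" using finY finB by (intro surj_card_le) auto
    then show ?thesis by (simp add: card_cartesian_product)
  qed
  obtain w where w: "w > 0" "\<And>x. tree.wt x > 0 \<Longrightarrow> w \<le> tree.wt x" using tree.wt_bounds by metis
  \<comment> \<open>The factor 32 consists of 4 from \<open>(\<eta> / 2)^2\<close>, 4 from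
    \<open>(2 * n)^2\<close>, and 2 for a strict contradiction.\<close>
  define \<epsilon> where "\<epsilon> = c * w * \<eta>\<^sup>2 / (32 * real (card B) * lam ^ k)"
  have lk: "lam ^ k > 0" by (rule tree.lam_pow_pos)
  have \<epsilon>: "\<epsilon> > 0" using c(1) w(1) \<eta>(1) cB lk by (simp add: \<epsilon>_def)
  obtain N2 where N2: "\<And>n. n \<ge> N2 \<Longrightarrow> (\<Sum>g\<in>desc children n \<one>. tree.wt g * (\<phi> g - \<phi> \<one> - real n * E g)\<^sup>2)
      \<le> \<epsilon> * (real n)\<^sup>2 * lam ^ n"
    using tree.weighted_deviation_subquadratic[OF dp \<epsilon>] by blast
  define n where "n = Max {J, N1, N2, k, 1}"
  have n: "n \<ge> J" "n \<ge> N1" "n \<ge> N2" "n \<ge> k" "n \<ge> 1" unfolding n_def by (auto intro: Max_ge)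
  have "real (card (Y n)) * (w * (\<eta> / 2 * real n)\<^sup>2) = (\<Sum>g\<in>Y n. w * (\<eta> / 2 * real n)\<^sup>2)" by simp
  also have "\<dots> \<le> (\<Sum>g\<in>Y n. tree.wt g * (\<phi> g - \<phi> \<one> - real (n + k) * E g)\<^sup>2)"
  proof (rule sum_mono)
    fix g assume g: "g \<in> Y n"
    have "(\<eta> / 2 * real n)\<^sup>2 \<le> \<bar>\<phi> g - \<phi> \<one> - real (n + k) * E g\<bar>\<^sup>2"
      using g \<eta>(1) by (intro power_mono) (auto simp: Y_def)
    then show "w * (\<eta> / 2 * real n)\<^sup>2 \<le> tree.wt g * (\<phi> g - \<phi> \<one> - real (n + k) * E g)\<^sup>2"
      using g w by (intro mult_mono) (auto simp: Y_def)
  qed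
  also have "\<dots> \<le> (\<Sum>g\<in>sphere (n + k). tree.wt g * (\<phi> g - \<phi> \<one> - real (n + k) * E g)\<^sup>2)"
    using tree.wt_nonneg by (intro sum_mono2 finite_sphere) (auto simp: Y_def)
  also have "\<dots> \<le> \<epsilon> * (real (n + k))\<^sup>2 * lam ^ (n + k)"
    using N2[of "n + k"] n(3) by (simp add: desc_one)
  also have "\<dots> \<le> \<epsilon> * (2 * real n)\<^sup>2 * lam ^ (n + k)"
    using \<epsilon> n(4) tree.lam_pow_pos[of "n + k"] by (intro mult_right_mono mult_left_mono power_mono) auto
  finally have main: "real (card (Y n)) * (w * (\<eta> / 2 * real n)\<^sup>2) \<le> \<epsilon> * (2 * real n)\<^sup>2 * lam ^ (n + k)" .
  have "c * lam ^ n \<le> real (card (Y n)) * real (card B)"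
    using c(2)[OF n(1)] XY[OF n(2)] by (metis of_nat_le_iff of_nat_mult order_trans)
  then have "c * lam ^ n * (w * (\<eta> / 2 * real n)\<^sup>2) \<le> real (card (Y n)) * real (card B) * (w * (\<eta> / 2 * real n)\<^sup>2)"
    using w(1) by (intro mult_right_mono) auto
  also have "\<dots> = real (card B) * (real (card (Y n)) * (w * (\<eta> / 2 * real n)\<^sup>2))" by simp
  also have "\<dots> \<le> real (card B) * (\<epsilon> * (2 * real n)\<^sup>2 * lam ^ (n + k))" using main by (intro mult_left_mono) auto
  also have "\<dots> = (c * w * \<eta>\<^sup>2 / 8) * (lam ^ n * (real n)\<^sup>2)"
    using cB lk unfolding \<epsilon>_def by (simp add: power_add power2_eq_square)
  also have "c * lam ^ n * (w * (\<eta> / 2 * real n)\<^sup>2) = (c * w * \<eta>\<^sup>2 / 4) * (lam ^ n * (real n)\<^sup>2)"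
    by (simp add: power2_eq_square)
  finally have le: "(c * w * \<eta>\<^sup>2 / 4) * (lam ^ n * (real n)\<^sup>2) \<le> (c * w * \<eta>\<^sup>2 / 8) * (lam ^ n * (real n)\<^sup>2)" .
  have "lam ^ n * (real n)\<^sup>2 > 0" using tree.lam_pow_pos[of n] n(5) by simp
  then have "c * w * \<eta>\<^sup>2 / 4 \<le> c * w * \<eta>\<^sup>2 / 8" using le by (rule mult_right_le_imp_le[rotated])
  moreover have "c * w * \<eta>\<^sup>2 > 0" using c(1) w(1) \<eta>(1) by simp
  ultimately show False by simp
qed

text \<open>By \<open>prefix_near\<close> the ancestor of \<open>x \<otimes> y \<otimes> b\<close>
  on the sphere of \<open>x\<close> is near \<open>x\<close>. So placing elements behind
  \<open>x\<close> puts them into one of boundedly many subtrees, at a depth that differs boundedly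
  from their length.\<close>

lemma inserted_translate:
  assumes x: "x \<in> carrier G" and b: "b \<in> carrier G" "C \<le> len b"
  obtains y j p where "y \<in> carrier G" "len y \<le> R" "len b \<le> j + C" "j \<le> len b + R"
    "p \<in> carrier G" "len p = len x" "dst x p \<le> C + R + D" "x \<otimes> y \<otimes> b \<in> desc children j p"
proof -
  obtain y where y: "y \<in> carrier G" "len y \<le> R" "len x + len b \<le> len (x \<otimes> y \<otimes> b) + C"
    using insertion[OF x b(1)] by blast
  define g where "g = x \<otimes> (y \<otimes> b)"
  have g: "g \<in> carrier G" "x \<otimes> y \<otimes> b = g" using x b y by (simp_all add: g_def m_assoc)
  define j where "j = len g - len x"
  have yb: "y \<otimes> b \<in> carrier G" "len (y \<otimes> b) \<le> R + len b" using len_mult[of y b] y b by auto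
  have lg: "len g = len x + j" "len b \<le> j + C" "j \<le> len b + R"
    using y(3) b(2) yb len_mult[OF x yb(1)] unfolding j_def g(2) g_def[symmetric] by auto
  have "g \<in> sphere (len x + j)" using g lg by (simp add: sphere_iff)
  then obtain p where p: "p \<in> sphere (len x)" "g \<in> desc children j p" by (rule sphere_ancestor)
  have pc: "p \<in> carrier G" "len p = len x" using p(1) by (auto simp: sphere_iff)
  have "p \<in> seg \<one> (x \<otimes> (y \<otimes> b))"
    using desc_geodesic[OF pc(1) p(2)] pc dst_one unfolding g_def[symmetric] by (simp add: seg_def)
  then have "dst x p \<le> (C + R) + D"
    using x yb lg pc(2) unfolding g_def by (intro prefix_near[OF four_point]) auto
  then show ?thesis using that[of y j p] y lg pc p(2) g(2) by simp
qed

lemma mean_max_le_min: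
  assumes dp: "tree.drift_pair E h"
    and a: "tree.wt a > 0" "\<And>y. tree.wt y > 0 \<Longrightarrow> E y \<le> E a"
    and b: "tree.wt b > 0" "\<And>y. tree.wt y > 0 \<Longrightarrow> E b \<le> E y"
  shows "E a \<le> E b"
proof (rule ccontr)
  assume "\<not> E a \<le> E b"
  define \<eta> where "\<eta> = E a - E b"
  have \<eta>: "\<eta> > 0" using \<open>\<not> E a \<le> E b\<close> by (simp add: \<eta>_def)
  have PE: "tree.Pw E = E" using dp by (simp add: tree.drift_pair_def)
  have bc: "b \<in> carrier G" using b(1) by (rule wt_carrier)
  \<comment> \<open>The distance from \<open>x\<close> within which
    \<open>inserted_translate\<close> finds the ancestor.\<close>
  define r where "r = C + R + D"
  obtain x where x: "x \<in> carrier G" "\<And>z. z \<in> carrier G \<Longrightarrow> len z \<le> r \<Longrightarrow> len (x \<otimes> z) = len x \<Longrightarrow>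
      tree.wt (x \<otimes> z) > 0 \<Longrightarrow> E (x \<otimes> z) = E a"
    using neighbours_of_max[OF dp a] by blast
  define W where "W m = {g \<in> desc children m b. \<bar>\<phi> g - \<phi> b - real m * E b\<bar> < \<eta> / 8 * real m}" for m
  have constb: "tree.constant_below E b (E b)"
    unfolding tree.constant_below_def using tree.harmonic_min_desc[OF PE b(2)] by blast
  obtain c J where c: "c > 0" "\<And>m. m \<ge> J \<Longrightarrow> c * lam ^ m \<le> real (card (W m))"
    using tree.deviation_typical[OF dp constb _ b(1), of "\<eta> / 8"] \<eta> unfolding W_def by auto
  define Q where "Q = {p \<in> carrier G. len p = len x \<and> dst x p \<le> r}"
  have finQ: "finite Q" by (rule finite_subset[OF _ finite_sphere[of "len x"]]) (auto simp: Q_def sphere_iff)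
  have "x \<in> Q" using x by (simp add: Q_def)
  then have cQ: "real (card Q) > 0" using finQ by (auto simp: card_gt_0_iff)
  define B where "B = {g \<in> carrier G. len g \<le> R}"
  have finB: "finite B" unfolding B_def by (rule finite_len_ball)
  have "\<one> \<in> B" by (simp add: B_def)
  then have cB: "real (card B) > 0" using finB by (auto simp: card_gt_0_iff)
  define V where "V j p = {g \<in> desc children j p. \<eta> / 4 * real j \<le> \<bar>\<phi> g - \<phi> p - real j * E a\<bar>}" for j p
  have cancel: "q * (s * (c / (2 * b * q * s * l) * (u * l))) * b = c / 2 * u"
    if "b > 0" "q > 0" "s > 0" "l > 0" for b q s l u :: real
    using that by (simp add: field_simps)
  \<comment> \<open>Half of \<open>c\<close>, divided by the numbers of inserted elements, of
    ancestors and of depths, and by the growth from depth \<open>m\<close> to the largest depth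
    \<open>m + R\<close>.\<close>
  define \<epsilon> where "\<epsilon> = c / (2 * real (card B) * real (card Q) * real (Suc (C + R)) * lam ^ R)"
  have lR: "lam ^ R > 0" by (rule tree.lam_pow_pos)
  have \<epsilon>: "\<epsilon> > 0" using c(1) cB cQ lR by (simp add: \<epsilon>_def)
  have "\<exists>J. \<forall>j\<ge>J. real (card (V j p)) \<le> \<epsilon> * lam ^ j" if p: "p \<in> Q" for p
  proof -
    have pc: "p \<in> carrier G" "len p = len x" "dst x p \<le> r" using p by (auto simp: Q_def)
    have xp: "x \<otimes> (inv x \<otimes> p) = p" using x pc by (simp add: m_assoc[symmetric])
    \<comment> \<open>A heavy descendant makes \<open>p\<close> heavy, so the choice of
      \<open>x\<close> gives \<open>p\<close> the maximal mean, which is inherited by heavy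
      descendants. For light \<open>p\<close> the claim is void.\<close>
    have "E g = E a" if g: "g \<in> desc children n p" "tree.wt g > 0" for n g
    proof -
      have "tree.wt p > 0" using tree.wt_zero_desc[OF _ g(1)] g(2) tree.wt_nonneg[of p]
        by (cases "tree.wt p = 0") auto
      then have "E p = E a" using x(2)[of "inv x \<otimes> p"] pc x(1) xp by (simp add: word_dist_def)
      then show ?thesis using tree.harmonic_max_desc[OF PE _ g] a(2) by simp
    qed
    then have "tree.constant_below E p (E a)" unfolding tree.constant_below_def by blast
    then show ?thesis unfolding V_def using \<eta> by (intro tree.deviation_rare[OF dp _ _ \<epsilon>]) auto
  qed
  then obtain Jp where Jp: "\<And>p j. p \<in> Q \<Longrightarrow> j \<ge> Jp p \<Longrightarrow> real (card (V j p)) \<le> \<epsilon> * lam ^ j" by metis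
  define K where "K = \<bar>\<phi> b\<bar> + \<bar>\<phi> x\<bar> + Lip * real (len b) + Lip * real (len x + R) + Lip * real r
      + real (C + R) * \<bar>E a\<bar> + \<eta> * real R"
  obtain N where N: "\<And>m. m \<ge> N \<Longrightarrow> K \<le> \<eta> / 2 * real m" using eventually_linear_ge[of "\<eta> / 2" K] \<eta> by auto
  \<comment> \<open>The sum over \<open>Q\<close> exceeds each threshold \<open>Jp p\<close>, and
    the summand \<open>C\<close> makes even the least depth \<open>m - C\<close> large
    enough.\<close>
  define m where "m = Max {J, N, C} + C + (\<Sum>p\<in>Q. Jp p)"
  have m: "m \<ge> J" "m \<ge> N" "m \<ge> C" unfolding m_def by (auto intro: Max_ge trans_le_add1)
  have mJ: "m - C \<ge> Jp p" if "p \<in> Q" for p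
    using member_le_sum[of p Q Jp] that finQ unfolding m_def by simp
  let ?V = "\<Union>p\<in>Q. \<Union>j\<in>{m - C..m + R}. V j p"
  have "W m \<subseteq> (\<lambda>(g, y). b \<otimes> (inv y \<otimes> (inv x \<otimes> g))) ` (?V \<times> B)"
  proof
    fix g' assume "g' \<in> W m"
    then have g': "g' \<in> desc children m b" "\<bar>\<phi> g' - \<phi> b - real m * E b\<bar> < \<eta> / 8 * real m" by (auto simp: W_def)
    have g'c: "g' \<in> carrier G" "dst b g' = m" using desc_geodesic[OF bc g'(1)] by auto
    \<comment> \<open>The descendant is first translated back to the identity, so that it can be
      placed behind \<open>x\<close>; \<open>lip_left\<close> bounds the change of \<phi>.\<close>
    define u where "u = inv b \<otimes> g'"
    have u: "u \<in> carrier G" "len u = m" "b \<otimes> u = g'"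
      using g'c bc unfolding u_def by (auto simp: word_dist_def m_assoc[symmetric])
    obtain y j p where y: "y \<in> carrier G" "len y \<le> R" "len u \<le> j + C" "j \<le> len u + R"
      "p \<in> carrier G" "len p = len x" "dst x p \<le> C + R + D" "x \<otimes> y \<otimes> u \<in> desc children j p"
      by (rule inserted_translate[OF x(1) u(1)]) (use u(2) m(3) in auto)
    define g where "g = x \<otimes> y \<otimes> u"
    have pQ: "p \<in> Q" using y(5-7) by (simp add: Q_def r_def)
    have j: "j \<in> {m - C..m + R}" using y(3,4) u(2) by auto
    have "\<bar>\<phi> g' - \<phi> u\<bar> \<le> Lip * real (len b)" using lip_left[OF u(1) bc] u(3) by simp
    moreover have "\<bar>\<phi> g - \<phi> u\<bar> \<le> Lip * real (len x + R)"
    proof -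
      have "len (x \<otimes> y) \<le> len x + R" using len_mult[OF x(1) y(1)] y(2) by simp
      then have "Lip * real (len (x \<otimes> y)) \<le> Lip * real (len x + R)" using Lip_nonneg
        by (intro mult_left_mono) auto
      moreover have "\<bar>\<phi> g - \<phi> u\<bar> \<le> Lip * real (len (x \<otimes> y))"
        unfolding g_def using x(1) y(1) u(1) by (intro lip_left) auto
      ultimately show ?thesis by linarith
    qed
    moreover have "\<bar>\<phi> p - \<phi> x\<bar> \<le> Lip * real r"
    proof -
      have "x \<otimes> (inv x \<otimes> p) = p" using x(1) y(5) by (simp add: m_assoc[symmetric])
      then have "\<bar>\<phi> p - \<phi> x\<bar> \<le> Lip * real (len (inv x \<otimes> p))"
        using lip_right[OF x(1), of "inv x \<otimes> p"] x(1) y(5) by simp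
      also have "\<dots> \<le> Lip * real r"
        using y(7) Lip_nonneg unfolding word_dist_def r_def by (intro mult_left_mono) auto
      finally show ?thesis .
    qed
    moreover have "real j * E a \<ge> real m * E a - real (C + R) * \<bar>E a\<bar>"
    proof -
      have "(real m - real j) * E a \<le> \<bar>real m - real j\<bar> * \<bar>E a\<bar>" by (metis abs_ge_self abs_mult)
      also have "\<dots> \<le> real (C + R) * \<bar>E a\<bar>" using y(3,4) u(2) by (intro mult_right_mono) auto
      finally show ?thesis by (simp add: left_diff_distrib)
    qed
    moreover have "real m * E a - real m * E b = \<eta> * real m" by (simp add: \<eta>_def algebra_simps)
    moreover have "\<eta> / 4 * real j \<le> \<eta> / 4 * real m + \<eta> * real R"
    proof -
      have "\<eta> / 4 * real j \<le> \<eta> / 4 * real (m + R)" using \<eta> y(4) u(2) by (intro mult_left_mono) auto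
      moreover have "\<eta> * real R \<ge> 0" using \<eta> by simp
      ultimately show ?thesis by (simp add: distrib_left)
    qed
    ultimately have "\<eta> / 4 * real j \<le> - (\<phi> g - \<phi> p - real j * E a)"
      using g'(2) N[OF m(2)] unfolding K_def by linarith
    also have "\<dots> \<le> \<bar>\<phi> g - \<phi> p - real j * E a\<bar>" by (rule abs_ge_minus_self)
    finally have "g \<in> V j p" using y(8) unfolding V_def g_def by blast
    then have "g \<in> ?V" using pQ j by blast
    moreover have "g' = b \<otimes> (inv y \<otimes> (inv x \<otimes> g))"
    proof -
      have "inv x \<otimes> g = y \<otimes> u" unfolding g_def using x(1) y(1) u(1) by (simp add: m_assoc[symmetric])
      then have "inv y \<otimes> (inv x \<otimes> g) = u" using y(1) u(1) by (simp add: m_assoc[symmetric])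
      then show ?thesis using u(3) by simp
    qed
    moreover have "y \<in> B" using y(1,2) by (simp add: B_def)
    ultimately show "g' \<in> (\<lambda>(g, y). b \<otimes> (inv y \<otimes> (inv x \<otimes> g))) ` (?V \<times> B)"
      by (intro image_eqI[of _ _ "(g, y)"]) auto
  qed
  moreover have finV: "finite ?V" using finQ tree.finite_desc by (auto simp: V_def)
  ultimately have "card (W m) \<le> card (?V \<times> B)" using finB by (intro surj_card_le) auto
  then have WV: "real (card (W m)) \<le> real (card ?V) * real (card B)"
    by (metis card_cartesian_product of_nat_le_iff of_nat_mult)
  have "card ?V \<le> (\<Sum>p\<in>Q. card (\<Union>j\<in>{m - C..m + R}. V j p))" by (rule card_UN_le[OF finQ])
  also have "\<dots> \<le> (\<Sum>p\<in>Q. \<Sum>j\<in>{m - C..m + R}. card (V j p))" by (intro sum_mono card_UN_le) simp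
  finally have "card ?V \<le> (\<Sum>p\<in>Q. \<Sum>j\<in>{m - C..m + R}. card (V j p))" .
  then have "real (card ?V) \<le> real (\<Sum>p\<in>Q. \<Sum>j\<in>{m - C..m + R}. card (V j p))" by (rule of_nat_mono)
  also have "\<dots> = (\<Sum>p\<in>Q. \<Sum>j\<in>{m - C..m + R}. real (card (V j p)))" by (simp only: of_nat_sum)
  also have "\<dots> \<le> (\<Sum>p\<in>Q. \<Sum>j\<in>{m - C..m + R}. \<epsilon> * lam ^ (m + R))"
  proof (intro sum_mono)
    fix p j assume p: "p \<in> Q" and j: "j \<in> {m - C..m + R}"
    have "real (card (V j p)) \<le> \<epsilon> * lam ^ j" using Jp[OF p, of j] mJ[OF p] j by simp
    also have "\<dots> \<le> \<epsilon> * lam ^ (m + R)" using \<epsilon> j lam_ge_1' by (intro mult_left_mono power_increasing) auto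
    finally show "real (card (V j p)) \<le> \<epsilon> * lam ^ (m + R)" .
  qed
  also have "\<dots> = real (card Q) * (real (card {m - C..m + R}) * (\<epsilon> * lam ^ (m + R)))" by simp
  also have "card {m - C..m + R} = Suc (C + R)" using m(3) by simp
  finally have "real (card ?V) * real (card B) \<le> real (card Q) * (real (Suc (C + R)) * (\<epsilon> * lam ^ (m + R))) * real (card B)"
    using cB by (intro mult_right_mono) auto
  also have "\<dots> = c / 2 * lam ^ m"
    unfolding \<epsilon>_def power_add by (rule cancel[OF cB cQ _ lR]) simp
  finally have "c * lam ^ m \<le> c / 2 * lam ^ m" using c(2)[OF m(1)] WV by linarith
  moreover have "c * lam ^ m > 0" using c(1) tree.lam_pow_pos[of m] by simp
  ultimately show False by simp
qed

lemma mean_constant: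
  assumes dp: "tree.drift_pair E h" and x: "tree.wt x > 0" and y: "tree.wt y > 0"
  shows "E x = E y"
proof -
  have "tree.type_inv E" using dp by (simp add: tree.drift_pair_def)
  then have fin: "finite (range E)" by (intro tree.type_inv_finite_range tree.type_invD)
  let ?H = "{z. tree.wt z > 0}"
  have finH: "finite (E ` ?H)" using fin by (rule finite_subset[rotated]) auto
  have ne: "E ` ?H \<noteq> {}" using x by auto
  obtain a where a: "tree.wt a > 0" "E a = Max (E ` ?H)" using Max_in[OF finH ne] by auto
  obtain b where b: "tree.wt b > 0" "E b = Min (E ` ?H)" using Min_in[OF finH ne] by auto
  have amax: "E z \<le> E a" if "tree.wt z > 0" for z unfolding a(2) using finH that by (intro Max_ge) auto
  have bmin: "E b \<le> E z" if "tree.wt z > 0" for z unfolding b(2) using finH that by (intro Min_le) auto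
  have "E a \<le> E b" by (rule mean_max_le_min[OF dp a(1) amax b(1) bmin])
  then show ?thesis using amax[OF x] amax[OF y] bmin[OF x] bmin[OF y] by linarith
qed

text \<open>The root is heavy, so all heavy vertices have its mean and the linear bound applies to
  the whole tree. The lower growth bound replaces \<open>lam ^ n\<close> by the size of the
  sphere.\<close>

lemma sphere_variance:
  obtains E K :: real where "K \<ge> 0"
    "\<And>n. (\<Sum>g\<in>sphere n. (\<phi> g - \<phi> \<one> - real n * E)\<^sup>2) \<le> K * (real n + 1) * real (card (sphere n))"
proof -
  obtain E h where dp: "tree.drift_pair E h" using tree.drift_pair_ex by blast
  have const: "tree.constant_below E \<one> (E \<one>)"
    unfolding tree.constant_below_def using mean_constant[OF dp _ wt_one] by blast
  obtain K where K: "K \<ge> 0"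
    "\<And>n. (\<Sum>g\<in>desc children n \<one>. (\<phi> g - \<phi> \<one> - real n * E \<one>)\<^sup>2) \<le> K * (real n + 1) * lam ^ n"
    using tree.deviation_linear[OF dp const] by blast
  have "(\<Sum>g\<in>sphere n. (\<phi> g - \<phi> \<one> - real n * E \<one>)\<^sup>2) \<le> K * (real n + 1) * real (card (sphere n))" for n
  proof -
    have "K * (real n + 1) * lam ^ n \<le> K * (real n + 1) * real (card (sphere n))"
      using K(1) sphere_lower[of n] by (intro mult_left_mono) auto
    then show ?thesis using K(2)[of n] unfolding desc_one by linarith
  qed
  then show ?thesis using that K(1) by blast
qed

lemma concentration:
  shows "\<exists>E::real. \<forall>\<epsilon>::real. \<epsilon> > 0 \<longrightarrow>
    (\<exists>(K::real) (N::nat). \<forall>n\<ge>N. \<exists>A \<subseteq> sphere n.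
       real (card A) / real (card (sphere n)) \<ge> 1 - \<epsilon> \<and>
       (\<forall>g\<in>A. \<bar>\<phi> g - real n * E\<bar> \<le> K * sqrt (real n)))"
proof -
  obtain E V :: real where V: "V \<ge> 0"
    "\<And>n. (\<Sum>g\<in>sphere n. (\<phi> g - \<phi> \<one> - real n * E)\<^sup>2) \<le> V * (real n + 1) * real (card (sphere n))"
    using sphere_variance by blast
  have "\<exists>(K::real) (N::nat). \<forall>n\<ge>N. \<exists>A \<subseteq> sphere n.
       real (card A) / real (card (sphere n)) \<ge> 1 - \<epsilon> \<and> (\<forall>g\<in>A. \<bar>\<phi> g - real n * E\<bar> \<le> K * sqrt (real n))"
    if \<epsilon>: "\<epsilon> > 0" for \<epsilon>
  proof -
    \<comment> \<open>Chebyshev's inequality with variance at most \<open>2 * V * real n\<close>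
      requires \<open>2 * V \<le> \<epsilon> * t^2\<close>. The summand 1 keeps \<open>t\<close>
      positive when \<open>V = 0\<close>.\<close>
    define t where "t = sqrt (2 * V / \<epsilon>) + 1"
    have t0: "t > 0" using V(1) \<epsilon> by (simp add: t_def add_nonneg_pos)
    have "sqrt (2 * V / \<epsilon>) \<le> t" by (simp add: t_def)
    then have "2 * V / \<epsilon> \<le> t\<^sup>2" by (rule sqrt_le_D)
    then have t: "2 * V \<le> \<epsilon> * t\<^sup>2" using \<epsilon> by (simp add: divide_le_eq mult.commute)
    show ?thesis
    \<comment> \<open>For \<open>n \<ge> 1\<close> both \<open>n + 1 \<le> 2 * n\<close> and
      \<open>sqrt n \<ge> 1\<close> hold; the latter absorbs the value of \<phi> at the identity
      into the constant.\<close>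
    proof (intro exI[of _ "t + \<bar>\<phi> \<one>\<bar>"] exI[of _ 1] allI impI)
      fix n :: nat assume n: "n \<ge> 1"
      define bad where "bad = {g \<in> sphere n. t * sqrt (real n) \<le> \<bar>\<phi> g - \<phi> \<one> - real n * E\<bar>}"
      define A where "A = sphere n - bad"
      have card_pos: "real (card (sphere n)) > 0" using sphere_lower[of n] tree.lam_pow_pos[of n] by linarith
      have "real (card bad) * (t * sqrt (real n))\<^sup>2 \<le> V * (real n + 1) * real (card (sphere n))"
        unfolding bad_def using chebyshev_card[OF finite_sphere, of "t * sqrt (real n)"] t0 V(2)[of n]
        by (meson less_imp_le mult_nonneg_nonneg of_nat_0_le_iff order_trans real_sqrt_ge_zero)
      also have "\<dots> \<le> (2 * V * real n) * real (card (sphere n))"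
      proof (rule mult_right_mono)
        have "V * (real n + 1) \<le> V * (2 * real n)" using V(1) n by (intro mult_left_mono) auto
        then show "V * (real n + 1) \<le> 2 * V * real n" by simp
      qed simp
      also have "\<dots> \<le> (\<epsilon> * t\<^sup>2 * real n) * real (card (sphere n))" using t by (intro mult_right_mono) auto
      also have "\<dots> = (\<epsilon> * real (card (sphere n))) * (t * sqrt (real n))\<^sup>2" by (simp add: power_mult_distrib)
      finally have "real (card bad) \<le> \<epsilon> * real (card (sphere n))"
        using t0 n by (simp add: mult_le_cancel_right)
      moreover have "real (card A) = real (card (sphere n)) - real (card bad)"
        unfolding A_def using finite_sphere[of n]
        by (subst card_Diff_subset) (auto simp: bad_def of_nat_diff card_mono)
      ultimately have "real (card A) / real (card (sphere n)) \<ge> 1 - \<epsilon>"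
        using card_pos by (simp add: le_divide_eq algebra_simps)
      moreover have "\<bar>\<phi> g - real n * E\<bar> \<le> (t + \<bar>\<phi> \<one>\<bar>) * sqrt (real n)" if "g \<in> A" for g
      proof -
        have "\<bar>\<phi> g - \<phi> \<one> - real n * E\<bar> < t * sqrt (real n)" using that unfolding A_def bad_def by auto
        moreover have "\<bar>\<phi> \<one>\<bar> * 1 \<le> \<bar>\<phi> \<one>\<bar> * sqrt (real n)" using n by (intro mult_left_mono) auto
        ultimately show ?thesis unfolding distrib_right by linarith
      qed
      moreover have "A \<subseteq> sphere n" by (auto simp: A_def)
      ultimately show "\<exists>A\<subseteq>sphere n. 1 - \<epsilon> \<le> real (card A) / real (card (sphere n)) \<and>
          (\<forall>g\<in>A. \<bar>\<phi> g - real n * E\<bar> \<le> (t + \<bar>\<phi> \<one>\<bar>) * sqrt (real n))" by blast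
    qed
  qed
  then show ?thesis by blast
qed

end

theorem corollary4p26:
  fixes G :: "('a, 'b) monoid_scheme" and S :: "'a set" and \<phi> :: "'a \<Rightarrow> int"
  assumes "group G"
    and "word_hyperbolic G"
    and "\<not> elementary G"
    and "finite_symmetric_generating_set G S"
    and "bicombable G \<phi>"
  shows "\<exists>E::real. \<forall>\<epsilon>::real. \<epsilon> > 0 \<longrightarrow>
    (\<exists>(K::real) (N::nat). \<forall>n\<ge>N. \<exists>A \<subseteq> word_sphere G S n.
       real (card A) / real (card (word_sphere G S n)) \<ge> 1 - \<epsilon> \<and>
       (\<forall>g\<in>A. \<bar>real_of_int (\<phi> g) - real n * E\<bar> \<le> K * sqrt (real n)))"
proof -
  have cay: "cayley G U" if "finite_symmetric_generating_set G U" for U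
    using assms(1) that by (simp add: cayley_def cayley_axioms_def)
  have S: "cayley G S" by (rule cay[OF assms(4)])
  interpret S: cayley G S by (rule S)
  \<comment> \<open>Hyperbolicity is given for one generating set and the combing for another.
    Hyperbolicity is carried over to \<open>S\<close>, while the combing stays with its own
    generators.\<close>
  obtain H \<delta>0 where H: "cayley G H" "cayley_hyperbolic G H \<delta>0"
    using assms(2) cay unfolding word_hyperbolic_def by blast
  obtain \<delta> where \<delta>: "S.thin \<delta>"
    using thin_change_generators[OF H(1) S cayley.thin_of_hyperbolic[OF H]] by blast
  note fp = S.thin_imp_four_point[OF \<delta>]
  obtain R C where ins: "\<And>a b. a \<in> carrier G \<Longrightarrow> b \<in> carrier G \<Longrightarrow>
      \<exists>y\<in>carrier G. S.len y \<le> R \<and> S.len a + S.len b \<le> S.len (a \<otimes>\<^bsub>G\<^esub> y \<otimes>\<^bsub>G\<^esub> b) + C"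
    by (rule S.insert_without_cancellation[OF \<delta> assms(3)]) (rule that)
  have "infinite (carrier G)" using S.finite_imp_elementary assms(3) by blast
  then obtain lam A :: real where growth: "lam \<ge> 1" "\<And>n. lam ^ n \<le> real (card (S.sphere n))"
    "\<And>n. real (card (S.sphere n)) \<le> A * lam ^ n"
    using S.sphere_growth[OF fp _ ins] by blast
  obtain T L where T: "cayley G T" and comb: "combing G T L" and bi: "bicombable_wrt G T L \<phi>"
    using assms(5) cay unfolding bicombable_def by blast
  obtain k where k: "\<And>g. g \<in> carrier G \<Longrightarrow> word_length G T g \<le> k * S.len g"
    by (rule cayley_bilipschitz[OF S T]) (rule that)
  obtain B :: nat where
    B: "\<And>x h. x \<in> carrier G \<Longrightarrow> h \<in> carrier G \<Longrightarrow> \<bar>\<phi> (x \<otimes>\<^bsub>G\<^esub> h) - \<phi> x\<bar> \<le> int (B * word_length G T h)"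
      "\<And>x h. x \<in> carrier G \<Longrightarrow> h \<in> carrier G \<Longrightarrow> \<bar>\<phi> (h \<otimes>\<^bsub>G\<^esub> x) - \<phi> x\<bar> \<le> int (B * word_length G T h)"
    by (rule bicombable_lipschitz[OF T bi]) (rule that)
  have lip: "\<bar>real_of_int u - real_of_int v\<bar> \<le> real (B * k) * real (S.len h)"
    if "\<bar>u - v\<bar> \<le> int (B * word_length G T h)" "h \<in> carrier G" for u v h
  proof -
    have "B * word_length G T h \<le> B * k * S.len h" using k[OF that(2)] by (simp add: mult.assoc)
    then have "\<bar>u - v\<bar> \<le> int (B * k * S.len h)" using that(1) by linarith
    then have "real_of_int \<bar>u - v\<bar> \<le> real_of_int (int (B * k * S.len h))" by (simp only: of_int_le_iff)
    then show ?thesis by simp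
  qed
  interpret combable_tree G S "\<lambda>x. real_of_int (\<phi> x)" lam A "real (B * k)" "6 * \<delta> + 2" R C
    using fp ins growth finite_subtree_types[OF S T \<delta> comb bi] lip[OF B(1)] lip[OF B(2)]
    by unfold_locales auto
  show ?thesis by (rule concentration)
qed

end
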